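(* Let $\Omega\subset\mathbb{C}$ be a bounded simply connected Jordan domain, let $\varphi$ be a solution of the minimal surface equation over $\Omega$, $\psi$ its dual solution of the maximal surface equation, and $f\colon\mathbb{D}\to\Omega$ the corresponding harmonic mapping. Suppose $\partial\Omega$ contains line segments $I_1,I_2$ which have a common endpoint $z_0$ with interior angle $\alpha$. Assume also that $\varphi$ tends to plus or minus infinity on $I_1$ and $I_2$, and that the signs on $I_1$ and $I_2$ differ if $\alpha=\pi$. Let $X_{\min}$ and $X_{\max}$ be the isothermal parametrizations $(f,\varphi\circ f)$ of $\mathrm{graph}(\varphi)$ and $(f,\psi\circ f)$ of $\mathrm{graph}(\psi)$, and let $X_{\min}^*$, $X_{\max}^*$ be their conjugate surfaces, each of these four surfaces being regarded as the extended surface. Then: - $X_{\min}$ admits a vertical segment $L$ over $z_0$, and has the line symmetry there. Further, the following statements hold at the part corresponding to $L$: - $X_{\max}$ admits a shrinking singularity, and has the point symmetry there. - $X_{\min}^*$ admits a horizontal geodesic curvature line, and has the planar symmetry there. - $X_{\max}^*$ admits a null curve as a folding singularity, and has the folded symmetry there.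
   Context: Conventions: line segments are open; $\mathbb{D}$ is the open unit disk in $\mathbb{C}$; $\mathbb{E}^3$ is Euclidean 3-space and $\mathbb{L}^3$ is $\mathbb{R}^3$ with the Lorentzian inner product of signature $(+,+,-)$; both are identified with $\mathbb{C}\times\mathbb{R}$; "vertical" refers to the direction of the last coordinate, "horizontal" to planes on which it is constant. Minimal surface equation: $\mathrm{div}\big(\nabla\varphi/\sqrt{1+|\nabla\varphi|^2}\big)=0$. Maximal surface equation: $\mathrm{div}\big(\nabla\psi/\sqrt{1-|\nabla\psi|^2}\big)=0$ with $|\nabla\psi|<1$. Dual: for a solution $\varphi$ of the minimal surface equation over a simply connected domain, its dual $\psi$ (unique up to an additive constant, and a solution of the maximal surface equation) is defined by $d\psi=-\frac{\varphi_y}{\sqrt{1+|\nabla\varphi|^2}}dx+\frac{\varphi_x}{\sqrt{1+|\nabla\varphi|^2}}dy$. Corresponding harmonic mapping: the orientation-preserving univalent complex-valued harmonic mapping $f$ from $\mathbb{D}$ onto $\Omega$ such that $(f,\varphi\circ f)$ is an isothermal parametrization of $\mathrm{graph}(\varphi)\subset\mathbb{E}^3$; it exists, is unique up to precomposition with a Möbius transformation of $\mathbb{D}$, and $(f,\psi\circ f)$ is then an isothermal parametrization of $\mathrm{graph}(\psi)\subset\mathbb{L}^3$. "$\varphi$ tends to plus (minus) infinity on $I$" means $\varphi(z)\to+\infty$ ($-\infty$) as $z\in\Omega$ tends to any point of $I$; the sign may be different on $I_1$ and $I_2$. Generalized surfaces: a non-constant harmonic map $X$ from a Riemann surface to $\mathbb{E}^3$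 (resp. $\mathbb{L}^3$) is a generalized minimal (resp. maximal) surface if near every point there is a complex coordinate $w=u+iv$ such that $(\Phi_1,\Phi_2,\Phi_3)=\partial X/\partial w$ satisfies $\Phi_1^2+\Phi_2^2+\Phi_3^2=0$ (resp. $\Phi_1^2+\Phi_2^2-\Phi_3^2=0$ and $|\Phi_1|^2+|\Phi_2|^2-|\Phi_3|^2\not\equiv0$). For a generalized maximal surface let $\mathcal{A}$ be the set of points where $X_u$ or $X_v$ is lightlike. A point $p\in\mathcal{A}$ is a shrinking singular point if there are a neighborhood $U$ of $p$ and a regular curve $\gamma\colon J\to U$ from an interval $J$ with $\gamma(J)\subset\mathcal{A}$ and $X\circ\gamma(J)$ a single point; this image point is called a shrinking singularity. A point $p\in\mathcal{A}$ is a folding singular point if there is an isothermal coordinate system $(U;u,v)$ with $p=(0,0)$ and $X_v(u,0)\equiv0$; the image $\{X(u,0)\}$ is called a folding singularity. A null curve is a curve whose velocity vector field is lightlike. Extended surfaces: under the stated assumptions, after a conformal change of parameter from $\mathbb{D}$ to the upper half disk $\{w\in\mathbb{D}:\mathrm{Im}\,w>0\}$, the two parametrizations extend to a generalized minimal surface $X_{\min}=(\tilde f,t)\colon\mathbb{D}\to\mathbb{E}^3$ and a generalized maximal surface $X_{\max}=(\tilde f,t^* )\colon\mathbb{D}\to\mathbb{L}^3$, where $(-1,1)$ is mapped by $X_{\min}$ to $L$; the part corresponding to $L$ is the image of $(-1,1)$. Conjugate surfaces: for a real harmonic function $\xi$, $\xi^*$ is its conjugate harmonic function; for complex-valued harmonic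 $\xi+i\eta$ put $(\xi+i\eta)^*=\xi^*+i\eta^*$. The conjugate minimal surface of $X_{\min}=(\tilde f,t)$ is $X_{\min}^*=(\tilde f^*,t^* )$ and the conjugate maximal surface of $X_{\max}=(\tilde f,t^* )$ is $X_{\max}^*=(\tilde f^*,-t)$. Symmetries: each symmetry relates the values at $\overline w$ and $w$ in $\mathbb{D}$. Line symmetry: $X(\overline w)$ is the image of $X(w)$ under the $\pi$-rotation with respect to $L$. Point symmetry: the same with the point symmetry with respect to the shrinking singularity. Planar symmetry: the same with the reflection in the horizontal plane containing the curve. Folded symmetry: $X(\overline w)=X(w)$. A horizontal geodesic curvature line is a curve in a horizontal plane that is both a geodesic and a curvature line of the surface. *)

theory Defs
  imports "HOL-Analysis.Analysis"
begin

section \<open>Partial derivatives and harmonic maps\<close>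

definition pdx :: "(complex \<Rightarrow> 'a::real_normed_vector) \<Rightarrow> complex \<Rightarrow> 'a" where
  "pdx g z = frechet_derivative g (at z) 1"

definition pdy :: "(complex \<Rightarrow> 'a::real_normed_vector) \<Rightarrow> complex \<Rightarrow> 'a" where
  "pdy g z = frechet_derivative g (at z) \<i>"

text \<open>The following predicates are meant for open sets \<open>S\<close>.\<close>

definition C1_on :: "complex set \<Rightarrow> (complex \<Rightarrow> 'a::real_normed_vector) \<Rightarrow> bool" where
  "C1_on S g \<longleftrightarrow>
     (\<forall>z\<in>S. g differentiable (at z)) \<and> continuous_on S (pdx g) \<and> continuous_on S (pdy g)"

definition C2_on :: "complex set \<Rightarrow> (complex \<Rightarrow> 'a::real_normed_vector) \<Rightarrow> bool" where
  "C2_on S g \<longleftrightarrow> C1_on S g \<and> C1_on S (pdx g) \<and> C1_on S (pdy g)"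

definition harmonic_on :: "complex set \<Rightarrow> (complex \<Rightarrow> 'a::real_normed_vector) \<Rightarrow> bool" where
  "harmonic_on S g \<longleftrightarrow> C2_on S g \<and> (\<forall>z\<in>S. pdx (pdx g) z + pdy (pdy g) z = 0)"

definition harmonic_conjugate :: "complex set \<Rightarrow> (complex \<Rightarrow> real) \<Rightarrow> (complex \<Rightarrow> real) \<Rightarrow> bool" where
  "harmonic_conjugate S u v \<longleftrightarrow> (\<lambda>w. Complex (u w) (v w)) holomorphic_on S"

text \<open>For complex-valued functions the conjugate is taken in the real and in the
  imaginary part separately.\<close>

definition harmonic_conjugate_c ::
    "complex set \<Rightarrow> (complex \<Rightarrow> complex) \<Rightarrow> (complex \<Rightarrow> complex) \<Rightarrow> bool" where
  "harmonic_conjugate_c S F G \<longleftrightarrow>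
     harmonic_conjugate S (\<lambda>w. Re (F w)) (\<lambda>w. Re (G w)) \<and>
     harmonic_conjugate S (\<lambda>w. Im (F w)) (\<lambda>w. Im (G w))"


section \<open>Minimal and maximal graphs over plane domains\<close>

definition jordan_domain :: "complex set \<Rightarrow> bool" where
  "jordan_domain \<Omega> \<longleftrightarrow>
     open \<Omega> \<and> \<Omega> \<noteq> {} \<and> bounded \<Omega> \<and> simply_connected \<Omega> \<and>
     (\<exists>\<gamma>. simple_path \<gamma> \<and> pathfinish \<gamma> = pathstart \<gamma> \<and> path_image \<gamma> = frontier \<Omega>)"

definition grad_sq :: "(complex \<Rightarrow> real) \<Rightarrow> complex \<Rightarrow> real" where
  "grad_sq g z = (pdx g z)\<^sup>2 + (pdy g z)\<^sup>2"

definition minimal_surface_solution :: "complex set \<Rightarrow> (complex \<Rightarrow> real) \<Rightarrow> bool" where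
  "minimal_surface_solution \<Omega> \<phi> \<longleftrightarrow> C2_on \<Omega> \<phi> \<and>
     (\<forall>z\<in>\<Omega>. pdx (\<lambda>\<zeta>. pdx \<phi> \<zeta> / sqrt (1 + grad_sq \<phi> \<zeta>)) z
           + pdy (\<lambda>\<zeta>. pdy \<phi> \<zeta> / sqrt (1 + grad_sq \<phi> \<zeta>)) z = 0)"

definition maximal_surface_solution :: "complex set \<Rightarrow> (complex \<Rightarrow> real) \<Rightarrow> bool" where
  "maximal_surface_solution \<Omega> \<psi> \<longleftrightarrow> C2_on \<Omega> \<psi> \<and> (\<forall>z\<in>\<Omega>. grad_sq \<psi> z < 1) \<and>
     (\<forall>z\<in>\<Omega>. pdx (\<lambda>\<zeta>. pdx \<psi> \<zeta> / sqrt (1 - grad_sq \<psi> \<zeta>)) z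
           + pdy (\<lambda>\<zeta>. pdy \<psi> \<zeta> / sqrt (1 - grad_sq \<psi> \<zeta>)) z = 0)"

definition dual_solution :: "complex set \<Rightarrow> (complex \<Rightarrow> real) \<Rightarrow> (complex \<Rightarrow> real) \<Rightarrow> bool" where
  "dual_solution \<Omega> \<phi> \<psi> \<longleftrightarrow>
     (\<forall>z\<in>\<Omega>. (\<psi> has_derivative
        (\<lambda>h. - (pdy \<phi> z / sqrt (1 + grad_sq \<phi> z)) * Re h
             + (pdx \<phi> z / sqrt (1 + grad_sq \<phi> z)) * Im h)) (at z))"

text \<open>Points of \<open>\<complex> \<times> \<real>\<close> carry the library's inner product, which is that of Euclidean 3-space.\<close>

definition isothermal_param :: "complex set \<Rightarrow> (complex \<Rightarrow> complex \<times> real) \<Rightarrow> bool" where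
  "isothermal_param S X \<longleftrightarrow> C1_on S X \<and>
     (\<forall>w\<in>S. pdx X w \<bullet> pdx X w = pdy X w \<bullet> pdy X w \<and> pdx X w \<bullet> pdy X w = 0 \<and> pdx X w \<noteq> 0)"

abbreviation unit_disk :: "complex set" where
  "unit_disk \<equiv> ball 0 1"

text \<open>Orientation preservation of \<open>f\<close> is positivity of its Jacobian determinant.\<close>

definition corresponding_harmonic_map ::
    "complex set \<Rightarrow> (complex \<Rightarrow> real) \<Rightarrow> (complex \<Rightarrow> complex) \<Rightarrow> bool" where
  "corresponding_harmonic_map \<Omega> \<phi> f \<longleftrightarrow>
     harmonic_on unit_disk f \<and> bij_betw f unit_disk \<Omega> \<and>
     (\<forall>w\<in>unit_disk. Re (pdx f w) * Im (pdy f w) - Im (pdx f w) * Re (pdy f w) > 0) \<and>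
     isothermal_param unit_disk (\<lambda>w. (f w, \<phi> (f w)))"

text \<open>The domain \<open>\<Omega>\<close> has interior angle \<open>\<alpha>\<close> at \<open>z0\<close>, between the segments from \<open>z0\<close> to \<open>z1\<close> and to
  \<open>z2\<close>: near \<open>z0\<close> it is a circular sector of opening \<open>\<alpha>\<close> bounded by these two segments,
  in either order. At a corner of a Jordan domain formed by two boundary segments the
  values 0 and \<open>2 * pi\<close> do not occur.\<close>

definition interior_angle ::
    "complex set \<Rightarrow> complex \<Rightarrow> complex \<Rightarrow> complex \<Rightarrow> real \<Rightarrow> bool" where
  "interior_angle \<Omega> z0 z1 z2 \<alpha> \<longleftrightarrow> 0 < \<alpha> \<and> \<alpha> < 2 * pi \<and>
     (\<exists>r \<theta> \<theta>1 \<theta>2. 0 < r \<and>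
        (\<theta>1 = \<theta> \<and> \<theta>2 = \<theta> + \<alpha> \<or> \<theta>1 = \<theta> + \<alpha> \<and> \<theta>2 = \<theta>) \<and>
        z1 = z0 + of_real (dist z0 z1) * cis \<theta>1 \<and>
        z2 = z0 + of_real (dist z0 z2) * cis \<theta>2 \<and>
        \<Omega> \<inter> ball z0 r =
          {z0 + of_real \<rho> * cis s | \<rho> s. 0 < \<rho> \<and> \<rho> < r \<and> \<theta> < s \<and> s < \<theta> + \<alpha>})"

definition tends_to_plus_infinity_on ::
    "complex set \<Rightarrow> (complex \<Rightarrow> real) \<Rightarrow> complex set \<Rightarrow> bool" where
  "tends_to_plus_infinity_on \<Omega> \<phi> I \<longleftrightarrow> (\<forall>\<zeta>\<in>I. filterlim \<phi> at_top (at \<zeta> within \<Omega>))"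

definition tends_to_minus_infinity_on ::
    "complex set \<Rightarrow> (complex \<Rightarrow> real) \<Rightarrow> complex set \<Rightarrow> bool" where
  "tends_to_minus_infinity_on \<Omega> \<phi> I \<longleftrightarrow> (\<forall>\<zeta>\<in>I. filterlim \<phi> at_bot (at \<zeta> within \<Omega>))"


section \<open>Generalized minimal and maximal surfaces\<close>

text \<open>\<open>lorentz\<close> is the inner product of signature (+,+,-) on \<open>\<complex> \<times> \<real>\<close>. Lightlike vectors are
  nonzero by convention.\<close>

definition lorentz :: "complex \<times> real \<Rightarrow> complex \<times> real \<Rightarrow> real" where
  "lorentz p q = fst p \<bullet> fst q - snd p * snd q"

definition lightlike :: "complex \<times> real \<Rightarrow> bool" where
  "lightlike p \<longleftrightarrow> p \<noteq> 0 \<and> lorentz p p = 0"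

text \<open>\<open>\<xi>\<close> is the inverse of a complex coordinate centred at \<open>p\<close> on the plane domain \<open>S\<close>.\<close>

definition complex_coordinate ::
    "complex set \<Rightarrow> complex \<Rightarrow> complex set \<Rightarrow> (complex \<Rightarrow> complex) \<Rightarrow> bool" where
  "complex_coordinate S p V \<xi> \<longleftrightarrow>
     open V \<and> connected V \<and> 0 \<in> V \<and> \<xi> 0 = p \<and> \<xi> holomorphic_on V \<and> inj_on \<xi> V \<and> \<xi> ` V \<subseteq> S"

text \<open>The Wirtinger derivative with respect to \<open>w\<close> of a real function, and of the three
  coordinate functions of a map into \<open>\<complex> \<times> \<real>\<close>.\<close>

definition wirtinger :: "(complex \<Rightarrow> real) \<Rightarrow> complex \<Rightarrow> complex" where
  "wirtinger g w = (of_real (pdx g w) - \<i> * of_real (pdy g w)) / 2"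

definition Phi1 :: "(complex \<Rightarrow> complex \<times> real) \<Rightarrow> complex \<Rightarrow> complex" where
  "Phi1 X = wirtinger (\<lambda>w. Re (fst (X w)))"

definition Phi2 :: "(complex \<Rightarrow> complex \<times> real) \<Rightarrow> complex \<Rightarrow> complex" where
  "Phi2 X = wirtinger (\<lambda>w. Im (fst (X w)))"

definition Phi3 :: "(complex \<Rightarrow> complex \<times> real) \<Rightarrow> complex \<Rightarrow> complex" where
  "Phi3 X = wirtinger (\<lambda>w. snd (X w))"

definition generalized_minimal_surface ::
    "complex set \<Rightarrow> (complex \<Rightarrow> complex \<times> real) \<Rightarrow> bool" where
  "generalized_minimal_surface S X \<longleftrightarrow>
     harmonic_on S X \<and> \<not> X constant_on S \<and>
     (\<forall>p\<in>S. \<exists>V \<xi>. complex_coordinate S p V \<xi> \<and>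
        (\<forall>w\<in>V. (Phi1 (X \<circ> \<xi>) w)\<^sup>2 + (Phi2 (X \<circ> \<xi>) w)\<^sup>2 + (Phi3 (X \<circ> \<xi>) w)\<^sup>2 = 0))"

definition generalized_maximal_surface ::
    "complex set \<Rightarrow> (complex \<Rightarrow> complex \<times> real) \<Rightarrow> bool" where
  "generalized_maximal_surface S X \<longleftrightarrow>
     harmonic_on S X \<and> \<not> X constant_on S \<and>
     (\<forall>p\<in>S. \<exists>V \<xi>. complex_coordinate S p V \<xi> \<and>
        (\<forall>w\<in>V. (Phi1 (X \<circ> \<xi>) w)\<^sup>2 + (Phi2 (X \<circ> \<xi>) w)\<^sup>2 - (Phi3 (X \<circ> \<xi>) w)\<^sup>2 = 0) \<and>
        (\<exists>w\<in>V. (cmod (Phi1 (X \<circ> \<xi>) w))\<^sup>2 + (cmod (Phi2 (X \<circ> \<xi>) w))\<^sup>2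
               - (cmod (Phi3 (X \<circ> \<xi>) w))\<^sup>2 \<noteq> 0))"


section \<open>Singularities of maximal surfaces\<close>

text \<open>This is the set usually denoted by a calligraphic A.\<close>

definition lightlike_points :: "complex set \<Rightarrow> (complex \<Rightarrow> complex \<times> real) \<Rightarrow> complex set" where
  "lightlike_points S X = {w \<in> S. lightlike (pdx X w) \<or> lightlike (pdy X w)}"

definition regular_curve :: "real set \<Rightarrow> (real \<Rightarrow> 'a::real_normed_vector) \<Rightarrow> bool" where
  "regular_curve J \<gamma> \<longleftrightarrow> is_interval J \<and> interior J \<noteq> {} \<and>
     (\<exists>v. continuous_on J v \<and>
        (\<forall>s\<in>J. (\<gamma> has_vector_derivative v s) (at s within J) \<and> v s \<noteq> 0))"

text \<open>\<open>p\<close> is a shrinking singular point with shrinking singularity \<open>q\<close>. The curve is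
  understood to pass through \<open>p\<close>.\<close>

definition shrinking_singularity ::
    "complex set \<Rightarrow> (complex \<Rightarrow> complex \<times> real) \<Rightarrow> complex \<Rightarrow> complex \<times> real \<Rightarrow> bool" where
  "shrinking_singularity S X p q \<longleftrightarrow> p \<in> lightlike_points S X \<and>
     (\<exists>U J \<gamma>. open U \<and> p \<in> U \<and> U \<subseteq> S \<and> regular_curve J \<gamma> \<and> p \<in> \<gamma> ` J \<and>
        \<gamma> ` J \<subseteq> U \<inter> lightlike_points S X \<and> X ` \<gamma> ` J = {q})"

text \<open>\<open>p\<close> is a folding singular point with folding singularity \<open>\<Gamma>\<close>. On a generalized maximal
  surface every complex coordinate is isothermal.\<close>

definition folding_singularity ::
    "complex set \<Rightarrow> (complex \<Rightarrow> complex \<times> real) \<Rightarrow> complex \<Rightarrow> (complex \<times> real) set \<Rightarrow> bool" where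
  "folding_singularity S X p \<Gamma> \<longleftrightarrow> p \<in> lightlike_points S X \<and>
     (\<exists>V \<xi>. complex_coordinate S p V \<xi> \<and>
        (\<forall>u::real. of_real u \<in> V \<longrightarrow> pdy (X \<circ> \<xi>) (of_real u) = 0) \<and>
        \<Gamma> = {X (\<xi> (of_real u)) | u::real. of_real u \<in> V})"

definition null_curve :: "real set \<Rightarrow> (real \<Rightarrow> complex \<times> real) \<Rightarrow> bool" where
  "null_curve J \<sigma> \<longleftrightarrow>
     (\<exists>v. \<forall>s\<in>J. (\<sigma> has_vector_derivative v s) (at s within J) \<and> lightlike (v s))"


section \<open>Curves on surfaces in Euclidean space\<close>

text \<open>Here \<open>X\<close> is a surface, \<open>c\<close> a curve in its parameter domain over an open interval \<open>J\<close>.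
  Both notions refer to regular curves along which the surface is immersed, and neither depends
  on the parametrization of the curve. Geodesic: the tangential part of the acceleration is
  proportional to the velocity, i.e. the geodesic curvature vanishes.
  Curvature line: the velocity is a principal direction.\<close>

definition immersed_at :: "(complex \<Rightarrow> complex \<times> real) \<Rightarrow> complex \<Rightarrow> bool" where
  "immersed_at X w \<longleftrightarrow> X differentiable (at w) \<and>
     (\<forall>a b::real. a *\<^sub>R pdx X w + b *\<^sub>R pdy X w = 0 \<longrightarrow> a = 0 \<and> b = 0)"

definition normal_vector :: "(complex \<Rightarrow> complex \<times> real) \<Rightarrow> complex \<Rightarrow> complex \<times> real \<Rightarrow> bool" where
  "normal_vector X w n \<longleftrightarrow> n \<bullet> pdx X w = 0 \<and> n \<bullet> pdy X w = 0"

definition geodesic_on ::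
    "complex set \<Rightarrow> (complex \<Rightarrow> complex \<times> real) \<Rightarrow> real set \<Rightarrow> (real \<Rightarrow> complex) \<Rightarrow> bool" where
  "geodesic_on S X J c \<longleftrightarrow>
     (\<exists>v a. \<forall>s\<in>J. c s \<in> S \<and> immersed_at X (c s) \<and>
        (X \<circ> c has_vector_derivative v s) (at s) \<and> (v has_vector_derivative a s) (at s) \<and>
        v s \<noteq> 0 \<and> (\<exists>l::real. normal_vector X (c s) (a s - l *\<^sub>R v s)))"

definition curvature_line_on ::
    "complex set \<Rightarrow> (complex \<Rightarrow> complex \<times> real) \<Rightarrow> real set \<Rightarrow> (real \<Rightarrow> complex) \<Rightarrow> bool" where
  "curvature_line_on S X J c \<longleftrightarrow>
     (\<exists>U N. open U \<and> c ` J \<subseteq> U \<and> U \<subseteq> S \<and> C1_on U N \<and>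
        (\<forall>w\<in>U. immersed_at X w \<and> normal_vector X w (N w) \<and> norm (N w) = 1) \<and>
        (\<forall>s\<in>J. \<exists>v k. (X \<circ> c has_vector_derivative v) (at s) \<and> v \<noteq> 0 \<and>
           (N \<circ> c has_vector_derivative (k::real) *\<^sub>R v) (at s)))"

definition horizontal_geodesic_curvature_line ::
    "complex set \<Rightarrow> (complex \<Rightarrow> complex \<times> real) \<Rightarrow> real set \<Rightarrow> (real \<Rightarrow> complex) \<Rightarrow> real \<Rightarrow> bool" where
  "horizontal_geodesic_curvature_line S X J c h \<longleftrightarrow>
     (\<forall>s\<in>J. snd (X (c s)) = h) \<and> geodesic_on S X J c \<and> curvature_line_on S X J c"


section \<open>Extended surfaces and symmetries\<close>

definition upper_half_disk :: "complex set" where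
  "upper_half_disk = {w \<in> unit_disk. 0 < Im w}"

definition real_diameter :: "complex set" where
  "real_diameter = complex_of_real ` {-1<..<1}"

text \<open>\<open>(F, t)\<close> and \<open>(F, t')\<close> are the extensions to the unit disk of \<open>(f, \<phi> \<circ> f)\<close> and
  \<open>(f, \<psi> \<circ> f)\<close>, after the conformal change of parameter \<open>\<kappa>\<close>, with \<open>t'\<close> conjugate to \<open>t\<close>.
  The diameter corresponds to \<open>L\<close>.\<close>

definition extended_surfaces ::
    "(complex \<Rightarrow> real) \<Rightarrow> (complex \<Rightarrow> real) \<Rightarrow> (complex \<Rightarrow> complex) \<Rightarrow> (complex \<times> real) set \<Rightarrow>
     (complex \<Rightarrow> complex) \<Rightarrow> (complex \<Rightarrow> real) \<Rightarrow> (complex \<Rightarrow> real) \<Rightarrow> bool" where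
  "extended_surfaces \<phi> \<psi> f L F t t' \<longleftrightarrow>
     (\<exists>\<kappa>. \<kappa> holomorphic_on upper_half_disk \<and> bij_betw \<kappa> upper_half_disk unit_disk \<and>
        (\<forall>w\<in>upper_half_disk. F w = f (\<kappa> w) \<and> t w = \<phi> (f (\<kappa> w)) \<and> t' w = \<psi> (f (\<kappa> w)))) \<and>
     generalized_minimal_surface unit_disk (\<lambda>w. (F w, t w)) \<and>
     generalized_maximal_surface unit_disk (\<lambda>w. (F w, t' w)) \<and>
     harmonic_conjugate unit_disk t t' \<and>
     (\<lambda>w. (F w, t w)) ` real_diameter = L"

definition vertical_segment_over :: "complex \<Rightarrow> (complex \<times> real) set \<Rightarrow> bool" where
  "vertical_segment_over z0 L \<longleftrightarrow> (\<exists>a b. a < b \<and> L = open_segment (z0, a) (z0, b))"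

text \<open>The rotation by the angle \<open>pi\<close> about the vertical line over \<open>z0\<close>, the point symmetry
  with respect to \<open>q\<close>, and the reflection in the horizontal plane at height \<open>h\<close>.\<close>

definition vertical_half_turn :: "complex \<Rightarrow> complex \<times> real \<Rightarrow> complex \<times> real" where
  "vertical_half_turn z0 p = (2 * z0 - fst p, snd p)"

definition point_reflection :: "complex \<times> real \<Rightarrow> complex \<times> real \<Rightarrow> complex \<times> real" where
  "point_reflection q p = 2 *\<^sub>R q - p"

definition horizontal_reflection :: "real \<Rightarrow> complex \<times> real \<Rightarrow> complex \<times> real" where
  "horizontal_reflection h p = (fst p, 2 * h - snd p)"

definition symmetric_by ::
    "(complex \<times> real \<Rightarrow> complex \<times> real) \<Rightarrow> (complex \<Rightarrow> complex \<times> real) \<Rightarrow> bool" where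
  "symmetric_by R X \<longleftrightarrow> (\<forall>w\<in>unit_disk. X (cnj w) = R (X w))"

end

theory Submission
  imports Defs "HOL-Complex_Analysis.Complex_Analysis"
begin

text \<open>
  On the unit disk, the coordinates of \<open>f\<close> are the imaginary parts of holomorphic functions \<open>X\<^sub>1\<close> and \<open>X\<^sub>2\<close>, and
  \<open>T = \<phi> \<circ> f + \<i> \<psi> \<circ> f\<close> is holomorphic with \<open>X\<^sub>1'\<^sup>2 + X\<^sub>2'\<^sup>2 = T'\<^sup>2\<close>. Rotate the corner so that its bisector is vertical, and let
  \<open>X\<close> be the function whose imaginary part is the horizontal coordinate. Since \<open>f\<close> is a diffeomorphism, \<open>Re X\<close> is
  strictly monotone on the vertical segments in \<open>\<Omega>\<close>, so \<open>X\<close> is injective over a neighbourhood of the corner and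
  can be used as a conformal coordinate there. A vertical segment that ends at a boundary point where \<open>\<phi>\<close> is
  infinite corresponds to an infinite half-line in this coordinate, by comparison with a harmonic barrier.
  For the vertical segment ending at the corner, an infinite half-line is excluded: it would give a harmonic
  limit with a kink, or, for a straight angle, equal signs of \<open>\<phi>\<close> on both sides. So it ends at a finite point,
  beyond which there is a slit where \<open>f\<close> tends to the corner; by reflection the slit is an arc
  of the unit circle. Reflecting once more across a part of this arc where \<open>T'\<close> has no zeros yields the extended surfaces,
  and all symmetries are instances of \<open>K (cnj w) = cnj (K w)\<close>.
\<close>

section \<open>Reflection of holomorphic functions with real boundary values\<close>

text \<open>No boundary values of \<open>f\<close> are known in advance. A priori the corner could
  be reached through a single boundary point of the disk, and then there would be no arc to reflect
  across; the whole middle part serves to exclude this. In the coordinate \<open>X\<close> the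
  question is about lines: since \<open>Im X\<close> is the abscissa, a vertical segment becomes a
  horizontal line, and the only unknown is whether that line ends at a finite point or runs to
  infinity. Only lines are compared, never convexity: the box above the graph of
  \<open>k * \<bar>x\<bar>\<close> contains its vertical segments for either sign of
  \<open>k\<close>, so reflex angles are treated together with convex ones. The coordinates of
  \<open>f\<close> are written as imaginary parts because they become constant on the arc; after
  subtraction of the constants the holomorphic functions have real boundary values, which is what
  reflection needs. The last restriction has two purposes: without zeros of \<open>T'\<close> the
  height is strictly monotone along the arc, so the image does not turn back, and a compact subarc
  keeps the height bounded, so the image is a segment with finite ends.\<close>

lemma maximum_modulus_limsup:
  assumes W: "open W" "bounded W" and hol: "Z holomorphic_on W"
    and bd: "\<And>p e. p \<in> frontier W \<Longrightarrow> 0 < e \<Longrightarrow> \<exists>d>0. \<forall>w\<in>W. dist w p < d \<longrightarrow> cmod (Z w) \<le> B + e"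
    and w: "w \<in> W"
  shows "cmod (Z w) \<le> B"
proof (rule field_le_epsilon)
  fix e :: real assume e: "0 < e"
  show "cmod (Z w) \<le> B + e"
  proof (rule ccontr)
    assume "\<not> ?thesis"
    then have big: "cmod (Z w) > B + e" by simp
    define S where "S = {z\<in>W. cmod (Z z) > B + e}"
    have cont: "continuous_on W (\<lambda>z. cmod (Z z))"
      using hol by (intro continuous_intros holomorphic_on_imp_continuous_on)
    have openS: "open S"
    proof -
      have "S = (\<lambda>z. cmod (Z z)) -` {B + e<..} \<inter> W" by (auto simp: S_def)
      then show ?thesis using cont W(1) continuous_on_open_vimage[OF W(1)] by (metis open_greaterThan)
    qed
    \<comment> \<open>The limsup hypothesis at level \<open>e\<close> keeps \<open>S\<close> away
      from the frontier of \<open>W\<close>. So the closure of \<open>S\<close> stays in the region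
      of holomorphy, and on the frontier of \<open>S\<close> the modulus is at most
      \<open>B + e\<close>: the maximum principle with continuous boundary values applies to
      \<open>S\<close>.\<close>
    have clS: "closure S \<subseteq> W"
    proof
      fix p assume p: "p \<in> closure S"
      have "p \<in> closure W" using p closure_mono[of S W] by (auto simp: S_def)
      show "p \<in> W"
      proof (rule ccontr)
        assume "p \<notin> W"
        then have "p \<in> frontier W" using \<open>p \<in> closure W\<close> W(1) by (simp add: frontier_def interior_open)
        from bd[OF this e] obtain d where d: "d > 0" "\<forall>w\<in>W. dist w p < d \<longrightarrow> cmod (Z w) \<le> B + e" by blast
        obtain y where "y \<in> S" "dist y p < d" using p d(1) by (meson closure_approachable)
        then show False using d(2) by (force simp: S_def)
      qed
    qed
    have bS: "bounded S" using W(2) by (rule bounded_subset) (auto simp: S_def)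
    have "cmod (Z w) \<le> B + e"
    proof (rule maximum_modulus_frontier[of Z S])
      show "Z holomorphic_on interior S" using hol openS by (auto simp: interior_open S_def intro: holomorphic_on_subset)
      show "continuous_on (closure S) Z" using hol clS holomorphic_on_imp_continuous_on holomorphic_on_subset by blast
      show "bounded S" by fact
      fix z assume z: "z \<in> frontier S"
      then have "z \<in> W" "z \<notin> S" using clS openS by (auto simp: frontier_def interior_open)
      then show "cmod (Z z) \<le> B + e" by (auto simp: S_def)
      next show "w \<in> S" using w big by (simp add: S_def)
    qed
    then show False using big by simp
  qed
qed

text \<open>Exponentiation turns the one-sided information into a modulus bound:
  \<open>exp (\<i> * H / M)\<close> has logarithmic modulus \<open>- Im H / M\<close>, so it is at
  most 3 on the ball and at least 1/3 at the centre. Cauchy's estimate on half the radius gives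
  \<open>6 / r\<close> for its derivative, and the lower bound costs the last factor 3 of
  18.\<close>

lemma norm_deriv_le_of_Im_bound:
  assumes hol: "H holomorphic_on ball c r" and r: "0 < r" and M: "0 < M"
    and Im: "\<And>w. w \<in> ball c r \<Longrightarrow> \<bar>Im (H w)\<bar> \<le> M"
  shows "cmod (deriv H c) \<le> 18 * M / r"
proof -
  define K where "K = (\<lambda>w. exp (\<i> * H w / of_real M))"
  have nK: "cmod (K w) = exp (- Im (H w) / M)" for w
    by (simp add: K_def norm_exp_eq_Re)
  have e3: "exp (1::real) \<le> 3" using exp_le by simp
  have ub: "cmod (K w) \<le> 3" if "w \<in> ball c r" for w
  proof -
    have "- Im (H w) / M \<le> 1" using Im[OF that] M by (auto simp: field_simps abs_le_iff)
    then have "exp (- Im (H w) / M) \<le> exp 1" by simp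
    then show ?thesis using e3 nK by (metis order_trans)
  qed
  have lb: "cmod (K c) \<ge> 1/3"
  proof -
    have "- 1 \<le> - Im (H c) / M" using Im[of c] r M by (auto simp: field_simps abs_le_iff)
    then have "exp (-1) \<le> exp (- Im (H c) / M)" by simp
    moreover have "exp (-1) \<ge> (1/3::real)" using e3 by (simp add: exp_minus field_simps)
    ultimately show ?thesis using nK by (metis order_trans)
  qed
  have holK: "K holomorphic_on ball c r" unfolding K_def by (intro holomorphic_intros hol) (use M in auto)
  have "cmod ((deriv ^^ 1) K c) \<le> fact 1 * 3 / (r/2)^1"
  proof (rule Cauchy_inequality)
    show "K holomorphic_on ball c (r/2)" by (rule holomorphic_on_subset[OF holK]) (use r in auto)
    show "continuous_on (cball c (r/2)) K"
      by (rule holomorphic_on_imp_continuous_on[OF holomorphic_on_subset[OF holK]]) (use r in auto)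
    show "0 < r/2" using r by simp
    fix x assume "cmod (c - x) = r/2"
    then show "cmod (K x) \<le> 3" using r by (intro ub) (auto simp: dist_norm)
  qed
  then have dK: "cmod (deriv K c) \<le> 6 / r" by simp
  have "H field_differentiable at c" using hol r holomorphic_on_imp_differentiable_at by force
  then have dH: "(H has_field_derivative deriv H c) (at c)" by (simp add: field_differentiable_derivI)
  have "(K has_field_derivative (K c * (\<i> * deriv H c / of_real M))) (at c)"
    unfolding K_def using M by (auto intro!: derivative_eq_intros dH)
  then have "deriv K c = K c * (\<i> * deriv H c / of_real M)" by (rule DERIV_imp_deriv)
  then have "cmod (K c) * cmod (deriv H c) / M \<le> 6 / r" using dK M by (simp add: norm_mult norm_divide)
  moreover have "(1/3) * cmod (deriv H c) / M \<le> cmod (K c) * cmod (deriv H c) / M"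
    using lb M by (intro divide_right_mono mult_right_mono) auto
  ultimately have "cmod (deriv H c) / M / 3 \<le> 6 / r" by simp
  then show ?thesis using M r by (simp add: field_simps)
qed

section \<open>Half-disks over the real axis: barrier, derivative bound, reflection\<close>

definition upper_half_ball :: "real \<Rightarrow> real \<Rightarrow> complex set" where
  "upper_half_ball c r = {w \<in> ball (of_real c) r. 0 < Im w}"

lemma open_upper_half_ball: "open (upper_half_ball c r)"
proof -
  have "upper_half_ball c r = ball (of_real c) r \<inter> {w. 0 < Im w}" by (auto simp: upper_half_ball_def)
  then show ?thesis by (simp add: open_Int open_halfspace_Im_gt)
qed

lemma convex_upper_half_ball: "convex (upper_half_ball c r)"
proof -
  have "upper_half_ball c r = ball (of_real c) r \<inter> {w. 0 < Im w}" by (auto simp: upper_half_ball_def)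
  then show ?thesis by (simp add: convex_Int convex_halfspace_Im_gt)
qed

text \<open>The barrier \<open>x\<^sup>2 - y\<^sup>2 + 2 y = Re (w\<^sup>2 - 2 \<i> w)\<close> is nonnegative on the diameter and at least 1
  on the upper unit semicircle.\<close>

lemma Im_le_linear_half_ball:
  assumes hol: "H holomorphic_on upper_half_ball c r" and r: "0 < r" and M: "0 \<le> M"
    and le: "\<And>w. w \<in> upper_half_ball c r \<Longrightarrow> Im (H w) \<le> M"
    and bd: "\<And>u e. \<bar>u - c\<bar> < r \<Longrightarrow> 0 < e \<Longrightarrow>
       \<exists>d>0. \<forall>w\<in>upper_half_ball c r. dist w (of_real u) < d \<longrightarrow> Im (H w) \<le> e"
    and y: "0 < y" "y < s" and s: "0 < s" "s < r"
  shows "Im (H (Complex c y)) \<le> 2 * M * y / s"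
proof -
  define W where "W = upper_half_ball c s"
  define q where "q = (\<lambda>w. ((w - of_real c) / of_real s)\<^sup>2 - 2 * \<i> * ((w - of_real c) / of_real s))"
  \<comment> \<open>The comparison of the harmonic functions \<open>Im H\<close> and
    \<open>M * Re q\<close> becomes the maximum modulus principle for this exponential of their
    difference.\<close>
  define Z where "Z = (\<lambda>w. exp (- \<i> * H w - of_real M * q w))"
  have Wsub: "W \<subseteq> upper_half_ball c r" using s by (auto simp: W_def upper_half_ball_def)
  have Req: "Re (q w) = ((Re w - c)\<^sup>2 - (Im w)\<^sup>2) / s\<^sup>2 + 2 * Im w / s" for w
    using s by (simp add: q_def power2_eq_square field_simps)
  have nZ: "cmod (Z w) = exp (Im (H w) - M * Re (q w))" for w
    by (simp add: Z_def norm_exp_eq_Re)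
  have contq: "isCont q p" for p unfolding q_def using s by (intro continuous_intros) auto
  have "cmod (Z (Complex c y)) \<le> 1"
  proof (rule maximum_modulus_limsup[of W Z])
    show "open W" by (simp add: W_def open_upper_half_ball)
    show "bounded W" by (rule bounded_subset[of "ball (of_real c) s"]) (auto simp: W_def upper_half_ball_def)
    show "Z holomorphic_on W" unfolding Z_def q_def
      using hol Wsub s by (intro holomorphic_intros) (auto intro: holomorphic_on_subset)
    show "Complex c y \<in> W" using y by (auto simp: W_def upper_half_ball_def dist_norm cmod_def)
    fix p :: complex and e :: real assume p: "p \<in> frontier W" and e: "0 < e"
    have pcl: "p \<in> closure W" and pn: "p \<notin> W" using p \<open>open W\<close> by (auto simp: frontier_def interior_open)
    have cl: "p \<in> cball (of_real c) s" "0 \<le> Im p"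
    proof -
      have "closure W \<subseteq> cball (of_real c) s \<inter> {z. 0 \<le> Im z}"
        by (rule closure_minimal) (auto simp: W_def upper_half_ball_def closed_halfspace_Im_ge)
      then show "p \<in> cball (of_real c) s" "0 \<le> Im p" using pcl by auto
    qed
    \<comment> \<open>One \<open>e'\<close> is spent on the variation of the barrier near
      \<open>p\<close>, the other on the boundary values of \<open>Im H\<close>; together they cost
      the factor \<open>exp (2 * e')\<close>.\<close>
    define e' where "e' = min (ln (1 + e)) 1 / 2"
    have e': "0 < e'" "exp (2 * e') \<le> 1 + e"
    proof -
      show "0 < e'" using e by (simp add: e'_def)
      have "exp (2 * e') \<le> exp (ln (1+e))" by (simp add: e'_def)
      then show "exp (2 * e') \<le> 1 + e" using e by simp
    qed
    have key: "\<exists>d>0. \<forall>w\<in>W. dist w p < d \<longrightarrow> Im (H w) - M * Re (q w) \<le> 2 * e'"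
    proof -
      have "isCont (\<lambda>w. M * Re (q w)) p" by (intro continuous_mult continuous_const continuous_Re contq)
      then obtain d1 where d1: "d1 > 0" "\<forall>w. dist w p < d1 \<longrightarrow> dist (M * Re (q w)) (M * Re (q p)) < e'"
        using e'(1) unfolding continuous_at_eps_delta by blast
      show ?thesis
      proof (cases "Im p = 0")
        case True
        have pr: "p = of_real (Re p)" using True by (simp add: complex_eq_iff)
        have "cmod (of_real c - p) \<le> s" using cl(1) by (simp add: dist_norm)
        then have "\<bar>Re p - c\<bar> < r" using s abs_Re_le_cmod[of "of_real c - p"] by simp
        from bd[OF this e'(1)] obtain d2 where d2: "d2 > 0"
          "\<forall>w\<in>upper_half_ball c r. dist w p < d2 \<longrightarrow> Im (H w) \<le> e'" using pr by auto
        have "M * Re (q p) \<ge> 0" using M True by (simp add: Req)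
        then show ?thesis using d1 d2 Wsub by (intro exI[of _ "min d1 d2"]) (fastforce simp: dist_real_def abs_less_iff)
      next
        case False
        then have ip: "Im p > 0" using cl by simp
        then have "dist (of_real c) p = s" using cl pn by (auto simp: W_def upper_half_ball_def)
        then have n: "(Re p - c)\<^sup>2 + (Im p)\<^sup>2 = s\<^sup>2"
          using cmod_power2[of "p - of_real c"] by (simp add: dist_norm norm_minus_commute)
        have "(Im p)\<^sup>2 \<le> s\<^sup>2" using n by (metis le_add_same_cancel2 zero_le_power2)
        then have "Im p \<le> s" using s by (simp add: power2_le_iff_abs_le)
        have "Re (q p) = ((s\<^sup>2 - (Im p)\<^sup>2) - (Im p)\<^sup>2) / s\<^sup>2 + 2 * Im p / s" unfolding Req using n by (simp add: algebra_simps)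
        also have "\<dots> = 1 + 2 * (Im p / s) * (1 - Im p / s)" using s by (simp add: field_simps power2_eq_square)
        also have "\<dots> \<ge> 1" using ip s \<open>Im p \<le> s\<close> by simp
        finally have "M * Re (q p) \<ge> M" using M by (simp add: mult_le_cancel_left1)
        then show ?thesis using d1 le Wsub e' by (intro exI[of _ d1]) (fastforce simp: dist_real_def abs_less_iff)
      qed
    qed
    then obtain d where d: "d > 0" "\<forall>w\<in>W. dist w p < d \<longrightarrow> Im (H w) - M * Re (q w) \<le> 2 * e'" by blast
    have "\<forall>w\<in>W. dist w p < d \<longrightarrow> cmod (Z w) \<le> 1 + e"
      unfolding nZ using d e'(2) by (meson exp_le_cancel_iff order_trans)
    then show "\<exists>d>0. \<forall>w\<in>W. dist w p < d \<longrightarrow> cmod (Z w) \<le> 1 + e" using d(1) by blast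
  qed
  then have "Im (H (Complex c y)) \<le> M * Re (q (Complex c y))" using nZ by simp
  also have "\<dots> \<le> M * (2 * y / s)" unfolding Req using M s y by (intro mult_left_mono) auto
  finally show ?thesis by (simp add: ac_simps)
qed

text \<open>By the barrier, applied to \<open>H\<close> and to \<open>- H\<close> on half-disks
  centred below the point, \<open>Im H\<close> is at most a multiple of the height
  \<open>Im w\<close>. On the ball of radius \<open>Im w / 2\<close> about \<open>w\<close> it is
  therefore of the order of that radius, and the derivative estimate, which divides by the radius,
  stays bounded up to the axis.\<close>

lemma deriv_bound_near_real:
  assumes hol: "H holomorphic_on upper_half_ball c r"
    and bd: "\<And>u e. \<bar>u - c\<bar> < r \<Longrightarrow> 0 < e \<Longrightarrow>
       \<exists>d>0. \<forall>w\<in>upper_half_ball c r. dist w (of_real u) < d \<longrightarrow> \<bar>Im (H w)\<bar> \<le> e"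
    and u: "\<bar>u - c\<bar> < r"
  shows "\<exists>\<rho>>0. \<exists>C. upper_half_ball u \<rho> \<subseteq> upper_half_ball c r \<and>
           (\<forall>w\<in>upper_half_ball u \<rho>. cmod (deriv H w) \<le> C)"
proof -
  obtain d where d: "d > 0" "\<forall>w\<in>upper_half_ball c r. dist w (of_real u) < d \<longrightarrow> \<bar>Im (H w)\<bar> \<le> 1"
    using bd[OF u, of 1] by auto
  define R where "R = min d (r - \<bar>u - c\<bar>)"
  have R: "0 < R" "R \<le> d" "R \<le> r - \<bar>u - c\<bar>" using d u by (auto simp: R_def)
  have sub: "upper_half_ball v s \<subseteq> upper_half_ball u R" if "\<bar>v - u\<bar> + s \<le> R" for v s
  proof
    fix w assume "w \<in> upper_half_ball v s"
    then have w: "dist (of_real v) w < s" "Im w > 0" by (auto simp: upper_half_ball_def)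
    have "dist (of_real u) w \<le> dist (of_real u) (of_real v :: complex) + dist (of_real v) w" by (rule dist_triangle)
    also have "\<dots> < R" using w that by (simp add: dist_of_real dist_real_def)
    finally show "w \<in> upper_half_ball u R" using w by (simp add: upper_half_ball_def)
  qed
  have subc: "upper_half_ball u R \<subseteq> upper_half_ball c r"
  proof
    fix w assume "w \<in> upper_half_ball u R"
    then have w: "dist (of_real u) w < R" "Im w > 0" by (auto simp: upper_half_ball_def)
    have "dist (of_real c) w \<le> dist (of_real c) (of_real u :: complex) + dist (of_real u) w" by (rule dist_triangle)
    also have "\<dots> < r" using w R by (simp add: dist_of_real dist_real_def)
    finally show "w \<in> upper_half_ball c r" using w by (simp add: upper_half_ball_def)
  qed
  have one: "\<bar>Im (H w)\<bar> \<le> 1" if "w \<in> upper_half_ball u R" for w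
    using d(2) that subc R by (force simp: upper_half_ball_def dist_commute)
  have lin: "\<bar>Im (H w)\<bar> \<le> 5 * Im w / R" if w: "dist (of_real u) w < 3 * R / 8" "0 < Im w" for w
  proof -
    have Rew: "\<bar>Re w - u\<bar> < 3 * R / 8" and Imw: "Im w < 3 * R / 8"
      using w abs_Re_le_cmod[of "w - of_real u"] abs_Im_le_cmod[of "w - of_real u"] by (auto simp: dist_norm norm_minus_commute)
    have s2: "upper_half_ball (Re w) (R/2) \<subseteq> upper_half_ball u R" by (rule sub) (use Rew R in linarith)
    have bd': "\<exists>d>0. \<forall>z\<in>upper_half_ball (Re w) (R/2). dist z (of_real v) < d \<longrightarrow> \<bar>Im (H z)\<bar> \<le> e"
      if "\<bar>v - Re w\<bar> < R/2" "0 < e" for v e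
    proof -
      have "\<bar>v - c\<bar> < r" using that Rew R u by linarith
      from bd[OF this that(2)] show ?thesis using s2 subc by blast
    qed
    have w': "w = Complex (Re w) (Im w)" by simp
    \<comment> \<open>The comparison radius \<open>7 * R / 16\<close> lies strictly between the
      bound \<open>3 * R / 8\<close> for \<open>Im w\<close> and the radius \<open>R / 2\<close> of
      the half-disk. The resulting factor 32/7 is later rounded up to 5.\<close>
    have "Im (H (Complex (Re w) (Im w))) \<le> 2 * 1 * Im w / (7 * R / 16)"
    proof (rule Im_le_linear_half_ball[where r = "R/2"])
      show "H holomorphic_on upper_half_ball (Re w) (R/2)"
        using hol s2 subc by (blast intro: holomorphic_on_subset)
      show "Im (H z) \<le> 1" if "z \<in> upper_half_ball (Re w) (R/2)" for z using one s2 that by fastforce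
      show "\<exists>d>0. \<forall>z\<in>upper_half_ball (Re w) (R/2). dist z (of_real v) < d \<longrightarrow> Im (H z) \<le> e"
        if "\<bar>v - Re w\<bar> < R/2" "0 < e" for v e using bd'[OF that] by (meson abs_le_D1)
    qed (use R w Imw in auto)
    moreover have "Im (- H (Complex (Re w) (Im w))) \<le> 2 * 1 * Im w / (7 * R / 16)"
    proof (rule Im_le_linear_half_ball[where r = "R/2" and H = "\<lambda>z. - H z"])
      show "(\<lambda>z. - H z) holomorphic_on upper_half_ball (Re w) (R/2)"
        using hol s2 subc by (blast intro: holomorphic_on_subset holomorphic_on_minus)
      show "Im (- H z) \<le> 1" if "z \<in> upper_half_ball (Re w) (R/2)" for z using one s2 that by fastforce
      show "\<exists>d>0. \<forall>z\<in>upper_half_ball (Re w) (R/2). dist z (of_real v) < d \<longrightarrow> Im (- H z) \<le> e"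
        if "\<bar>v - Re w\<bar> < R/2" "0 < e" for v e using bd'[OF that] by (simp, meson abs_le_D2)
    qed (use R w Imw in auto)
    ultimately have "\<bar>Im (H w)\<bar> \<le> 2 * Im w / (7 * R / 16)" by simp
    also have "\<dots> \<le> 5 * Im w / R" using R w by (simp add: field_simps)
    finally show ?thesis .
  qed
  have "cmod (deriv H w) \<le> 288 / R" if w: "w \<in> upper_half_ball u (R/4)" for w
  proof -
    have w': "dist (of_real u) w < R/4" "0 < Im w" using w by (auto simp: upper_half_ball_def)
    have Imw: "Im w < R/4" using w' abs_Im_le_cmod[of "w - of_real u"] by (auto simp: dist_norm norm_minus_commute)
    have in1: "dist (of_real u) z < 3 * R / 8 \<and> 0 < Im z \<and> Im z \<le> 3/2 * Im w" if "z \<in> ball w (Im w / 2)" for z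
    proof -
      have "dist (of_real u) z \<le> dist (of_real u) w + dist w z" by (rule dist_triangle)
      moreover have "\<bar>Im z - Im w\<bar> < Im w / 2"
        using that abs_Im_le_cmod[of "z - w"] by (auto simp: dist_norm norm_minus_commute)
      moreover have "dist w z < Im w / 2" using that by simp
      ultimately show ?thesis using w' Imw by linarith
    qed
    \<comment> \<open>On this ball the height is at most \<open>3/2 * Im w\<close>, so the linear
      bound gives 7.5, rounded up to 8. The factor \<open>Im w\<close> cancels against the
      radius.\<close>
    have "cmod (deriv H w) \<le> 18 * (8 * Im w / R) / (Im w / 2)"
    proof (rule norm_deriv_le_of_Im_bound)
      have "ball w (Im w / 2) \<subseteq> upper_half_ball u R" using in1 R(1) by (force simp: upper_half_ball_def)
      then show "H holomorphic_on ball w (Im w / 2)" using hol subc by (blast intro: holomorphic_on_subset)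
      fix z assume z: "z \<in> ball w (Im w / 2)"
      have "\<bar>Im (H z)\<bar> \<le> 5 * Im z / R" using lin in1[OF z] by blast
      also have "\<dots> \<le> 8 * Im w / R" using in1[OF z] R by (intro divide_right_mono) auto
      finally show "\<bar>Im (H z)\<bar> \<le> 8 * Im w / R" .
    qed (use w' R in auto)
    also have "\<dots> = 288 / R" using w' R by (simp add: field_simps)
    finally show ?thesis .
  qed
  moreover have "upper_half_ball u (R/4) \<subseteq> upper_half_ball c r" using sub[of u "R/4"] subc R by auto
  ultimately show ?thesis using R by (intro exI[of _ "R/4"]) auto
qed

text \<open>Only the imaginary part is assumed to have a boundary limit; the derivative bound makes
  \<open>H\<close> itself extend continuously.\<close>

lemma Schwarz_reflection_Im:
  assumes hol: "H holomorphic_on upper_half_ball c r" and r: "0 < r"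
    and bd: "\<And>u e. \<bar>u - c\<bar> < r \<Longrightarrow> 0 < e \<Longrightarrow>
       \<exists>d>0. \<forall>w\<in>upper_half_ball c r. dist w (of_real u) < d \<longrightarrow> \<bar>Im (H w)\<bar> \<le> e"
  obtains K where "K holomorphic_on ball (of_real c) r"
    "\<And>w. w \<in> upper_half_ball c r \<Longrightarrow> K w = H w"
    "\<And>w. w \<in> ball (of_real c) r \<Longrightarrow> K (cnj w) = cnj (K w)"
proof -
  let ?U = "upper_half_ball c r"
  have lim: "\<exists>l. (H \<longlongrightarrow> l) (at (of_real u) within ?U)" if u: "\<bar>u - c\<bar> < r" for u
  proof -
    obtain \<rho> C where \<rho>: "\<rho> > 0" and sub: "upper_half_ball u \<rho> \<subseteq> ?U"
      and C: "\<And>w. w \<in> upper_half_ball u \<rho> \<Longrightarrow> cmod (deriv H w) \<le> C"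
      using deriv_bound_near_real[OF hol bd u] by blast
    let ?V = "upper_half_ball u \<rho>"
    have der: "(H has_field_derivative deriv H z) (at z within ?V)" if "z \<in> ?V" for z
    proof -
      have "H field_differentiable at z"
        using that sub hol open_upper_half_ball holomorphic_on_imp_differentiable_at by blast
      then show ?thesis by (simp add: field_differentiable_derivI has_field_derivative_at_within)
    qed
    have "(C + 1)-lipschitz_on ?V H" if "0 \<le> C"
    proof (rule lipschitz_onI)
      fix x y assume xy: "x \<in> ?V" "y \<in> ?V"
      have "cmod (H x - H y) \<le> C * cmod (x - y)"
        by (rule field_differentiable_bound[OF convex_upper_half_ball der C xy])
      also have "\<dots> \<le> (C + 1) * cmod (x - y)" by (simp add: mult_right_mono)
      finally show "dist (H x) (H y) \<le> (C + 1) * dist x y" by (simp add: dist_norm)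
    qed (use that in simp)
    moreover have "0 \<le> C"
    proof -
      have "Complex u (\<rho>/2) \<in> ?V" using \<rho> by (auto simp: upper_half_ball_def dist_norm cmod_def)
      from C[OF this] show ?thesis by (meson norm_ge_zero order_trans)
    qed
    ultimately have uc: "uniformly_continuous_on ?V H" using lipschitz_on_uniformly_continuous by blast
    have "of_real u \<in> closure ?V"
    proof (subst closure_approachable, intro allI impI)
      fix e :: real assume "0 < e"
      then show "\<exists>y\<in>?V. dist y (of_real u) < e" using \<rho>
        by (intro bexI[of _ "Complex u (min e \<rho> / 2)"]) (auto simp: upper_half_ball_def dist_norm cmod_def)
    qed
    then obtain l where l: "(H \<longlongrightarrow> l) (at (of_real u) within ?V)"
      using uniformly_continuous_on_extension_at_closure[OF uc] by blast
    have "at (of_real u) within ?V = at (of_real u) within ?U"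
      by (rule at_within_nhd[of _ "ball (of_real u) \<rho>"]) (use \<rho> sub in \<open>auto simp: upper_half_ball_def\<close>)
    then show ?thesis using l by auto
  qed
  define L where "L = (\<lambda>w. SOME l. (H \<longlongrightarrow> l) (at w within ?U))"
  have L: "(H \<longlongrightarrow> L (of_real u)) (at (of_real u) within ?U)" if "\<bar>u - c\<bar> < r" for u
    unfolding L_def using lim[OF that] by (rule someI_ex)
  have Leps: "\<exists>d>0. \<forall>w\<in>?U. dist w (of_real u) < d \<longrightarrow> dist (H w) (L (of_real u)) < e" if u: "\<bar>u - c\<bar> < r" and e: "0 < e" for u e
  proof -
    obtain d where "d > 0" "\<forall>w\<in>?U. 0 < dist w (of_real u) \<and> dist w (of_real u) < d \<longrightarrow> dist (H w) (L (of_real u)) < e"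
      using L[OF u] e unfolding Lim_within by blast
    then show ?thesis by (intro exI[of _ d]) (auto simp: upper_half_ball_def)
  qed
  have adh: "\<exists>w\<in>?U. dist w (of_real u) < d" if "\<bar>u - c\<bar> < r" "0 < d" for u d
  proof -
    define y where "y = min d (r - \<bar>u - c\<bar>) / 2"
    have y: "0 < y" "y < d" "\<bar>u - c\<bar> + y < r" using that by (auto simp: y_def min_def field_simps)
    have "dist (of_real c) (Complex u y) \<le> dist (of_real c) (of_real u :: complex) + dist (of_real u) (Complex u y)"
      by (rule dist_triangle)
    also have "\<dots> < r" using y by (simp add: dist_of_real dist_real_def) (simp add: dist_norm cmod_def)
    finally show ?thesis using y by (intro bexI[of _ "Complex u y"]) (auto simp: upper_half_ball_def dist_norm cmod_def)
  qed
  define H2 where "H2 = (\<lambda>w. if 0 < Im w then H w else L w)"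
  let ?S = "ball (of_real c) r :: complex set"
  have real: "\<bar>Re w - c\<bar> < r \<and> w = of_real (Re w)" if "w \<in> ?S" "Im w = 0" for w
    using that by (metis complex_is_Real_iff dist_commute dist_of_real dist_real_def mem_ball of_real_Re)
  have cont: "continuous_on (?S \<inter> {z. 0 \<le> Im z}) H2"
  proof (rule continuous_onI)
    fix p e :: "real" and q :: complex
    show "\<exists>d>0. \<forall>x'\<in>?S \<inter> {z. 0 \<le> Im z}. dist x' q < d \<longrightarrow> dist (H2 x') (H2 q) \<le> e"
      if q: "q \<in> ?S \<inter> {z. 0 \<le> Im z}" and e: "0 < e"
    proof (cases "Im q = 0")
      case True
      define u where "u = Re q"
      have u: "\<bar>u - c\<bar> < r" "q = of_real u" using real[of q] q True by (auto simp: u_def)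
      obtain d where d: "d > 0" "\<forall>w\<in>?U. dist w (of_real u) < d \<longrightarrow> dist (H w) (L (of_real u)) < e/2"
        using Leps[OF u(1), of "e/2"] e by auto
      have "dist (H2 x) (H2 q) \<le> e" if x: "x \<in> ?S \<inter> {z. 0 \<le> Im z}" "dist x q < d" for x
      proof (cases "Im x = 0")
        case xr: True
        define v where "v = Re x"
        have v: "\<bar>v - c\<bar> < r" "x = of_real v" using real[of x] x xr by (auto simp: v_def)
        obtain d' where d': "d' > 0" "\<forall>w\<in>?U. dist w (of_real v) < d' \<longrightarrow> dist (H w) (L (of_real v)) < e/2"
          using Leps[OF v(1), of "e/2"] e by auto
        \<comment> \<open>Two boundary values of \<open>H\<close> are compared through one interior
          point that is close to both boundary points.\<close>
        obtain w where w: "w \<in> ?U" "dist w (of_real v) < min d' (d - dist x q)"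
          using adh[OF v(1), of "min d' (d - dist x q)"] d' x by auto
        have "dist w (of_real u) \<le> dist w x + dist x q" using u dist_triangle by blast
        then have "dist w (of_real u) < d" using w v by simp
        then have "dist (H w) (L (of_real u)) < e/2" "dist (H w) (L (of_real v)) < e/2" using d d' w by auto
        then have "dist (L (of_real v)) (L (of_real u)) < e"
          using dist_triangle3[of "L (of_real v)" "L (of_real u)" "H w"] by simp
        then show ?thesis using u v by (simp add: H2_def)
      next
        case False
        then show ?thesis using x d u e by (force simp: H2_def upper_half_ball_def)
      qed
      then show ?thesis using d(1) by blast
    next
      case False
      then have qU: "q \<in> ?U" using q by (auto simp: upper_half_ball_def)
      have "isCont H q" using hol qU open_upper_half_ball
        by (meson continuous_on_eq_continuous_at holomorphic_on_imp_continuous_on)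
      then obtain d1 where d1: "d1 > 0" "\<And>x. dist x q < d1 \<Longrightarrow> dist (H x) (H q) < e"
        using e unfolding continuous_at_eps_delta by blast
      obtain d2 where d2: "d2 > 0" "ball q d2 \<subseteq> ?U" using qU open_upper_half_ball open_contains_ball by blast
      have "dist (H2 x) (H2 q) \<le> e" if "dist x q < min d1 d2" for x
      proof -
        have "x \<in> ?U" using d2 that by (auto simp: dist_commute)
        then show ?thesis using d1(2)[of x] that qU by (auto simp: H2_def upper_half_ball_def)
      qed
      then show ?thesis using d1 d2 by (intro exI[of _ "min d1 d2"]) auto
    qed
  qed
  have Lreal: "L (of_real u) \<in> \<real>" if u: "\<bar>u - c\<bar> < r" for u
  proof -
    have "\<bar>Im (L (of_real u))\<bar> \<le> e" if e: "0 < e" for e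
    proof -
      obtain d1 where d1: "d1 > 0" "\<forall>w\<in>?U. dist w (of_real u) < d1 \<longrightarrow> dist (H w) (L (of_real u)) < e/2"
        using Leps[OF u, of "e/2"] e by auto
      obtain d2 where d2: "d2 > 0" "\<forall>w\<in>?U. dist w (of_real u) < d2 \<longrightarrow> \<bar>Im (H w)\<bar> \<le> e/2"
        using bd[OF u, of "e/2"] e by auto
      obtain w where w: "w \<in> ?U" "dist w (of_real u) < min d1 d2" using adh[OF u, of "min d1 d2"] d1 d2 by auto
      have "\<bar>Im (H w) - Im (L (of_real u))\<bar> < e/2"
        using d1 w abs_Im_le_cmod[of "H w - L (of_real u)"] by (force simp: dist_norm)
      moreover have "\<bar>Im (H w)\<bar> \<le> e/2" using d2 w by auto
      ultimately show ?thesis by linarith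
    qed
    then have "\<bar>Im (L (of_real u))\<bar> \<le> 0" by (meson field_le_epsilon add_0 order_trans le_add_same_cancel2 dense_ge)
    then show ?thesis by (simp add: complex_is_Real_iff)
  qed
  define K where "K = (\<lambda>z. if 0 \<le> Im z then H2 z else cnj (H2 (cnj z)))"
  have "K holomorphic_on ?S" unfolding K_def
  proof (rule Schwarz_reflection)
    show "cnj ` ?S \<subseteq> ?S"
    proof
      fix w assume "w \<in> cnj ` ?S"
      then obtain z where "w = cnj z" "z \<in> ?S" by auto
      moreover have "dist (of_real c) (cnj z) = dist (of_real c) z"
        by (metis complex_cnj_complex_of_real complex_cnj_diff complex_mod_cnj dist_norm)
      ultimately show "w \<in> ?S" by simp
    qed
    have "?S \<inter> {z. 0 < Im z} = ?U" by (auto simp: upper_half_ball_def)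
    moreover have "H2 holomorphic_on ?U" by (rule holomorphic_transform[OF hol]) (auto simp: H2_def upper_half_ball_def)
    ultimately show "H2 holomorphic_on ?S \<inter> {z. 0 < Im z}" by simp
    fix z assume z: "z \<in> ?S" "z \<in> \<real>"
    then have "Im z = 0" by (simp add: complex_is_Real_iff)
    with real[OF z(1)] have "\<bar>Re z - c\<bar> < r" "z = of_real (Re z)" by auto
    with Lreal show "H2 z \<in> \<real>" by (metis H2_def \<open>Im z = 0\<close> less_irrefl)
  qed (use cont in auto)
  moreover have "K w = H w" if "w \<in> ?U" for w using that by (auto simp: K_def H2_def upper_half_ball_def)
  moreover have "K (cnj w) = cnj (K w)" if "w \<in> ?S" for w
  proof (cases "Im w = 0")
    case True
    with real[OF that] have w: "\<bar>Re w - c\<bar> < r" "w = of_real (Re w)" by auto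
    have "L w \<in> \<real>" using Lreal w by metis
    moreover have "cnj w = w" using w by (metis complex_cnj_complex_of_real)
    ultimately show ?thesis using True by (simp add: K_def H2_def Reals_cnj_iff)
  next
    case False
    then show ?thesis by (auto simp: K_def)
  qed
  ultimately show ?thesis using that by blast
qed

section \<open>The conformal coordinate at a corner\<close>

text \<open>The corner is moved to 0 with its bisector pointing upwards, so the sector is the part
  of a disk above the graph of \<open>k * \<bar>x\<bar>\<close>; \<open>k\<close> is the cotangent
  of half the angle, negative for reflex angles and 0 for a straight one. \<open>s1\<close> belongs
  to the right edge and \<open>s2\<close> to the left one.
  \<open>Im (deriv X w * cnj (deriv Y w))\<close> is the Jacobian determinant of
  \<open>f\<close>.\<close>

locale graph_corner =
  fixes X Y T :: "complex \<Rightarrow> complex" and \<Omega> :: "complex set" and k r s1 s2 :: real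
    and f g :: "complex \<Rightarrow> complex"
  defines "f \<equiv> (\<lambda>w. Complex (Im (X w)) (Im (Y w)))"
    and "g \<equiv> inv_into unit_disk f"
  assumes holX: "X holomorphic_on unit_disk" and holY: "Y holomorphic_on unit_disk"
    and holT: "T holomorphic_on unit_disk"
    and conformal: "\<And>w. w \<in> unit_disk \<Longrightarrow> (deriv X w)\<^sup>2 + (deriv Y w)\<^sup>2 = (deriv T w)\<^sup>2"
    and jac: "\<And>w. w \<in> unit_disk \<Longrightarrow> 0 < Im (deriv X w * cnj (deriv Y w))"
    and bij: "bij_betw f unit_disk \<Omega>"
    and r: "0 < r" and sector: "\<Omega> \<inter> ball 0 r = {z \<in> ball 0 r. k * \<bar>Re z\<bar> < Im z}"
    and signs: "s1 \<in> {1, -1}" "s2 \<in> {1, -1}" "k = 0 \<Longrightarrow> s1 \<noteq> s2"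
    and edge: "\<And>x. x \<noteq> 0 \<Longrightarrow> cmod (Complex x (k * \<bar>x\<bar>)) < r \<Longrightarrow>
       filterlim (\<lambda>z. (if 0 < x then s1 else s2) * Re (T (g z))) at_top (at (Complex x (k * \<bar>x\<bar>)) within \<Omega>)"
begin

text \<open>\<open>h\<close> and \<open>c\<close> are the height and the half-width of a box above
  the edges. Its points have both coordinates at most \<open>r / 3\<close> in modulus, so it lies in
  the ball of radius \<open>r\<close>; the factor \<open>1 + \<bar>k\<bar>\<close> in
  \<open>c\<close> keeps the edges strictly between the heights \<open>- h\<close> and
  \<open>h\<close>.\<close>

definition "h = r / 3"
definition "c = r / (3 * (1 + \<bar>k\<bar>))"
definition "s x = (if 0 < x then s1 else s2)" for x :: real

lemma hc: "0 < h" "0 < c" "c \<le> r / 3" "\<bar>k\<bar> * c < h" "k * c < h"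
proof -
  show "0 < h" "0 < c" using r by (auto simp: h_def c_def intro!: divide_pos_pos add_pos_nonneg)
  show "c \<le> r / 3" unfolding c_def using r by (intro divide_left_mono) (auto intro!: mult_pos_pos add_pos_nonneg)
  have "\<bar>k\<bar> * c = r / 3 * (\<bar>k\<bar> / (1 + \<bar>k\<bar>))" by (simp add: c_def field_simps)
  also have "\<dots> < r / 3 * 1" using r by (intro mult_strict_left_mono) (auto simp: divide_less_eq_1)
  finally show 1: "\<bar>k\<bar> * c < h" by (simp add: h_def)
  have "k * c \<le> \<bar>k\<bar> * c" using \<open>0 < c\<close> by simp
  then show "k * c < h" using 1 by simp
qed

lemma k_bound: "\<bar>x\<bar> \<le> c \<Longrightarrow> \<bar>k * \<bar>x\<bar>\<bar> < h"
  using hc(4) mult_left_mono[of "\<bar>x\<bar>" c "\<bar>k\<bar>"] by (simp add: abs_mult)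

lemma box_norm: "\<bar>Re z\<bar> \<le> c \<Longrightarrow> k * \<bar>Re z\<bar> \<le> Im z \<Longrightarrow> Im z \<le> h \<Longrightarrow> cmod z < r"
  using k_bound[of "Re z"] hc cmod_le[of z] r by (simp add: h_def)

lemma box: "\<bar>Re z\<bar> \<le> c \<Longrightarrow> k * \<bar>Re z\<bar> < Im z \<Longrightarrow> Im z \<le> h \<Longrightarrow> z \<in> \<Omega>"
  using sector box_norm[of z] by (auto simp: set_eq_iff)

definition "G = {z. \<bar>Re z\<bar> < c \<and> k * \<bar>Re z\<bar> < Im z \<and> Im z < h}"

lemma G_subset: "G \<subseteq> \<Omega>" by (auto simp: G_def intro!: box)

lemma open_G: "open G"
  unfolding G_def by (intro open_Collect_conj open_Collect_less continuous_intros)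

lemma not_edge: "\<bar>x\<bar> \<le> c \<Longrightarrow> Complex x (k * \<bar>x\<bar>) \<notin> \<Omega>"
proof
  assume "\<bar>x\<bar> \<le> c" "Complex x (k * \<bar>x\<bar>) \<in> \<Omega>"
  moreover have "cmod (Complex x (k * \<bar>x\<bar>)) < r"
    using \<open>\<bar>x\<bar> \<le> c\<close> k_bound[of x] by (intro box_norm) auto
  ultimately have "Complex x (k * \<bar>x\<bar>) \<in> \<Omega> \<inter> ball 0 r" by simp
  then show False unfolding sector by simp
qed

section \<open>The inverse of \<open>f\<close> and the monotonicity of \<open>Re X\<close> on
  vertical segments\<close>

lemma f_holomorphic_derivs:
  assumes "w \<in> unit_disk"
  shows "(X has_field_derivative deriv X w) (at w)" "(Y has_field_derivative deriv Y w) (at w)"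
    "(T has_field_derivative deriv T w) (at w)"
  using holomorphic_derivI[OF _ open_ball assms] holX holY holT by auto

lemma f_deriv:
  assumes "w \<in> unit_disk"
  shows "(f has_derivative (\<lambda>v. Complex (Im (deriv X w * v)) (Im (deriv Y w * v)))) (at w)"
proof -
  have "((\<lambda>w. of_real (Im (X w)) + \<i> * of_real (Im (Y w))) has_derivative
         (\<lambda>v. of_real (Im (deriv X w * v)) + \<i> * of_real (Im (deriv Y w * v)))) (at w)"
    using f_holomorphic_derivs[OF assms] unfolding has_field_derivative_def
    by (auto intro!: derivative_eq_intros)
  then show ?thesis by (simp add: f_def Complex_eq)
qed

lemma cont_f: "continuous_on unit_disk f"
  using f_deriv by (meson continuous_at_imp_continuous_on has_derivative_continuous)

lemma inj_f: "inj_on f unit_disk" and f_image: "f ` unit_disk = \<Omega>"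
  using bij by (auto simp: bij_betw_def)

lemma g_f: "w \<in> unit_disk \<Longrightarrow> g (f w) = w"
  using inj_f by (simp add: g_def)

lemma f_g: "z \<in> \<Omega> \<Longrightarrow> f (g z) = z" and g_in: "z \<in> \<Omega> \<Longrightarrow> g z \<in> unit_disk"
  using f_image f_inv_into_f[of z f unit_disk] inv_into_into[of z f unit_disk] unfolding g_def by blast+

lemma open_Omega: "open \<Omega>"
  using invariance_of_domain[OF cont_f open_ball inj_f] f_image by simp

lemma g_deriv:
  assumes z: "z \<in> \<Omega>"
  obtains g' where "(g has_derivative g') (at z)"
    "\<And>v. Im (deriv X (g z) * g' v) = Re v" "\<And>v. Im (deriv Y (g z) * g' v) = Im v"
proof -
  define w where "w = g z"
  have w: "w \<in> unit_disk" "f w = z" using z by (simp_all only: w_def g_in f_g)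
  let ?A = "deriv X w" let ?B = "deriv Y w"
  define J where "J = Im (?A * cnj ?B)"
  have J: "J > 0" using jac[OF w(1)] by (simp add: J_def)
  \<comment> \<open>Cramer's rule for the real linear system \<open>Im (?A * u) = Re v\<close>,
    \<open>Im (?B * u) = Im v\<close> in the unknown \<open>u\<close>, written with
    conjugates.\<close>
  define g' where "g' = (\<lambda>v. - (of_real (Im v) * cnj ?A - of_real (Re v) * cnj ?B) / of_real J)"
  have J': "Im ?A * Re ?B - Re ?A * Im ?B = J" by (simp add: J_def)
  have e1: "Im (?A * g' v) = Re v" "Im (?B * g' v) = Im v" for v
  proof -
    have "Im (?A * g' v) = Re v * (Im ?A * Re ?B - Re ?A * Im ?B) / J"
      by (simp add: g'_def field_simps)
    then show "Im (?A * g' v) = Re v" using J by (simp add: J')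
    have "Im (?B * g' v) = Im v * (Im ?A * Re ?B - Re ?A * Im ?B) / J"
      by (simp add: g'_def field_simps)
    then show "Im (?B * g' v) = Im v" using J by (simp add: J')
  qed
  have "(g has_derivative g') (at (f w))"
  proof (rule has_derivative_inverse_strong[OF open_ball w(1) cont_f])
    show "(f has_derivative (\<lambda>v. Complex (Im (?A * v)) (Im (?B * v)))) (at w)" by (rule f_deriv[OF w(1)])
    show "(\<lambda>v. Complex (Im (?A * v)) (Im (?B * v))) \<circ> g' = id"
      unfolding fun_eq_iff comp_def e1 by simp
  qed (rule g_f)
  then show ?thesis using that e1 w by (simp add: w_def)
qed

lemma cont_g: "continuous_on \<Omega> g"
  by (meson g_deriv continuous_at_imp_continuous_on has_derivative_continuous)

definition "\<Theta> z = X (g z)"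

lemma Im_Theta: "z \<in> \<Omega> \<Longrightarrow> Im (\<Theta> z) = Re z"
  using f_g[of z] by (simp add: \<Theta>_def f_def complex_eq_iff)

lemma cont_Theta: "continuous_on \<Omega> \<Theta>"
  unfolding \<Theta>_def
  by (rule continuous_on_compose2[OF holomorphic_on_imp_continuous_on[OF holX] cont_g]) (use g_in in auto)

lemma isCont_Theta: "z \<in> \<Omega> \<Longrightarrow> isCont \<Theta> z"
  using cont_Theta open_Omega by (simp add: continuous_on_eq_continuous_at)

text \<open>Let \<open>e\<close> be the derivative of \<open>g\<close> in the direction
  \<open>\<i>\<close>. Then \<open>X' * e\<close> is real and \<open>Im (Y' * e) = 1\<close>, so the
  positive number \<open>Im (X' * cnj Y')\<close> times the squared modulus of \<open>e\<close>
  equals \<open>Im ((X' * e) * cnj (Y' * e))\<close>, which is \<open>- X' * e\<close>. The sign of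
  the Jacobian is thus the sign of the monotonicity.\<close>

lemma Theta_decreasing:
  assumes ab: "a < b" and seg: "\<And>y. a \<le> y \<Longrightarrow> y \<le> b \<Longrightarrow> Complex x y \<in> \<Omega>"
  shows "Re (\<Theta> (Complex x b)) < Re (\<Theta> (Complex x a))"
proof (rule DERIV_neg_imp_decreasing[OF ab])
  fix y assume y: "a \<le> y" "y \<le> b"
  let ?z = "Complex x y"
  have z: "?z \<in> \<Omega>" using seg y by simp
  from g_deriv[OF z] obtain g' where g': "(g has_derivative g') (at ?z)"
    "\<And>v. Im (deriv X (g ?z) * g' v) = Re v" "\<And>v. Im (deriv Y (g ?z) * g' v) = Im v" by blast
  let ?A = "deriv X (g ?z)" let ?B = "deriv Y (g ?z)" let ?e = "g' \<i>"
  have "((\<lambda>y. of_real x + \<i> * of_real y) has_derivative (\<lambda>t. \<i> * of_real t)) (at y)"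
    by (auto intro!: derivative_eq_intros)
  then have "((\<lambda>y. Complex x y) has_derivative (\<lambda>t. \<i> * of_real t)) (at y)" by (simp add: Complex_eq)
  from diff_chain_at[OF this g'(1)]
  have "((\<lambda>y. g (Complex x y)) has_derivative (\<lambda>t. g' (\<i> * of_real t))) (at y)" by (simp add: o_def)
  from diff_chain_at[OF this f_holomorphic_derivs(1)[OF g_in[OF z], unfolded has_field_derivative_def]]
  have "((\<lambda>y. \<Theta> (Complex x y)) has_derivative (\<lambda>t. ?A * g' (\<i> * of_real t))) (at y)" by (simp add: o_def \<Theta>_def)
  then have "((\<lambda>y. Re (\<Theta> (Complex x y))) has_derivative (\<lambda>t. Re (?A * g' (\<i> * of_real t)))) (at y)"
    by (rule has_derivative_Re)
  moreover have "Re (?A * g' (\<i> * of_real t)) = Re (?A * ?e) * t" for t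
  proof -
    have "g' (t *\<^sub>R \<i>) = t *\<^sub>R g' \<i>" using g'(1) by (simp add: has_derivative_scaleR linear_cmul has_derivative_linear)
    then show ?thesis by (simp add: scaleR_conv_of_real algebra_simps)
  qed
  ultimately have "((\<lambda>y. Re (\<Theta> (Complex x y))) has_derivative (*) (Re (?A * ?e))) (at y)" by simp
  then have "DERIV (\<lambda>y. Re (\<Theta> (Complex x y))) y :> Re (?A * ?e)" by (simp add: has_field_derivative_def)
  moreover have "Re (?A * ?e) < 0"
  proof -
    have i: "Im (?A * ?e) = 0" "Im (?B * ?e) = 1" using g'(2,3)[of \<i>] by simp_all
    have "?A * cnj ?B * (?e * cnj ?e) = (?A * ?e) * cnj (?B * ?e)" by simp
    then have "Im (?A * cnj ?B * (of_real ((cmod ?e)\<^sup>2))) = Im ((?A * ?e) * cnj (?B * ?e))"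
      by (simp only: complex_norm_square)
    moreover have "Im (a * cnj b) = - Re a" if "Im a = 0" "Im b = 1" for a b using that by simp
    from this[OF i] have "Im ((?A * ?e) * cnj (?B * ?e)) = - Re (?A * ?e)" .
    moreover have "Im (?A * cnj ?B * (of_real ((cmod ?e)\<^sup>2))) = Im (?A * cnj ?B) * (cmod ?e)\<^sup>2" by simp
    moreover have "?e \<noteq> 0" using i(2) by auto
    ultimately show ?thesis using jac[OF g_in[OF z]] by (metis mult_pos_pos neg_0_less_iff_less zero_less_norm_iff zero_less_power)
  qed
  ultimately show "\<exists>m. DERIV (\<lambda>y. Re (\<Theta> (Complex x y))) y :> m \<and> m < 0" by blast
qed

section \<open>The image of the box in the coordinate \<open>X\<close>\<close>

definition "\<tau> x = Re (\<Theta> (Complex x h))"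
text \<open>The part of the strip to the right of the image of the top side of the box. The image
  \<open>P\<close> of the box equals \<open>Q\<close> exactly if no horizontal line of
  \<open>P\<close> ends at a finite point.\<close>

definition "Q = {Z. \<bar>Im Z\<bar> < c \<and> \<tau> (Im Z) < Re Z}"
definition "P = \<Theta> ` G"
definition "U = g ` G"
definition "X_inv = inv_into U X"

lemma k_lt: "\<bar>x\<bar> \<le> c \<Longrightarrow> k * \<bar>x\<bar> < h"
  using k_bound[of x] by simp

lemma cont_tau: "continuous_on {-c..c} \<tau>"
  unfolding \<tau>_def
  by (intro continuous_intros continuous_on_compose2[OF cont_Theta] continuous_on_Complex)
    (auto intro!: box k_lt simp: abs_le_iff)

lemma open_Q: "open Q"
proof -
  have "continuous_on {Z. \<bar>Im Z\<bar> < c} (\<lambda>Z. Re Z - \<tau> (Im Z))"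
    by (intro continuous_intros continuous_on_compose2[OF cont_tau]) auto
  moreover have "open {Z. \<bar>Im Z\<bar> < c}" by (intro open_Collect_less continuous_intros)
  ultimately have "open ((\<lambda>Z. Re Z - \<tau> (Im Z)) -` {0<..} \<inter> {Z. \<bar>Im Z\<bar> < c})"
    using continuous_on_open_vimage open_greaterThan by blast
  moreover have "(\<lambda>Z. Re Z - \<tau> (Im Z)) -` {0<..} \<inter> {Z. \<bar>Im Z\<bar> < c} = Q" by (auto simp: Q_def)
  ultimately show ?thesis by simp
qed

lemma P_subset_Q: "P \<subseteq> Q"
proof
  fix Z assume "Z \<in> P"
  then obtain z where z: "z \<in> G" "Z = \<Theta> z" by (auto simp: P_def)
  have *: "Im Z = Re z" using z G_subset Im_Theta by auto
  have "Re (\<Theta> (Complex (Re z) h)) < Re (\<Theta> (Complex (Re z) (Im z)))"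
    by (rule Theta_decreasing) (use z in \<open>auto simp: G_def intro!: box\<close>)
  then show "Z \<in> Q" using z * by (simp add: Q_def \<tau>_def G_def)
qed

lemma Theta_eq_imp:
  assumes "z \<in> G" "z' \<in> G" "\<Theta> z = \<Theta> z'"
  shows "z = z'"
proof -
  have re: "Re z = Re z'" using assms G_subset Im_Theta by (metis subsetD)
  have False if "Im a < Im b" "a \<in> G" "b \<in> G" "Re a = Re b" "\<Theta> a = \<Theta> b" for a b
  proof -
    have "Re (\<Theta> (Complex (Re a) (Im b))) < Re (\<Theta> (Complex (Re a) (Im a)))"
      by (rule Theta_decreasing) (use that in \<open>auto simp: G_def intro!: box\<close>)
    moreover have "Complex (Re a) (Im b) = b" using that by (simp add: complex_eq_iff)
    moreover have "Complex (Re a) (Im a) = a" by simp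
    ultimately show False using that by (metis order_less_irrefl)
  qed
  from this[of z z'] this[of z' z] show ?thesis using assms re by (metis complex_eqI linorder_neqE_linordered_idom)
qed

lemma U_facts: "U \<subseteq> unit_disk" "open U" "inj_on X U" "X ` U = P"
proof -
  show sub: "U \<subseteq> unit_disk" using g_in G_subset unfolding U_def by blast
  have "U = f -` G \<inter> unit_disk"
  proof -
    have "w \<in> U" if "w \<in> unit_disk" "f w \<in> G" for w using g_f[OF that(1)] that(2) unfolding U_def by (metis imageI)
    moreover have "f w \<in> G" if "w \<in> U" for w using that f_g G_subset unfolding U_def by auto
    ultimately show ?thesis using sub by blast
  qed
  then show "open U" using continuous_on_open_vimage[OF open_ball] cont_f open_G by metis
  show "inj_on X U" by (rule inj_onI) (auto simp: U_def \<Theta>_def[symmetric] dest: Theta_eq_imp)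
  show "X ` U = P" by (auto simp: U_def P_def \<Theta>_def)
qed

lemma X_inv: "Z \<in> P \<Longrightarrow> X_inv Z \<in> U" "Z \<in> P \<Longrightarrow> X (X_inv Z) = Z" "w \<in> U \<Longrightarrow> X_inv (X w) = w"
  using U_facts(3,4) by (auto simp: X_inv_def inv_into_into f_inv_into_f)

lemma X_inv_disk: "Z \<in> P \<Longrightarrow> X_inv Z \<in> unit_disk"
  using X_inv(1) U_facts(1) by blast

lemma f_X_inv: "Z \<in> P \<Longrightarrow> f (X_inv Z) \<in> G" "Z \<in> P \<Longrightarrow> \<Theta> (f (X_inv Z)) = Z"
  "Z \<in> P \<Longrightarrow> Re (f (X_inv Z)) = Im Z" "Z \<in> P \<Longrightarrow> g (f (X_inv Z)) = X_inv Z"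
proof -
  assume Z: "Z \<in> P"
  show "f (X_inv Z) \<in> G" using X_inv(1)[OF Z] f_g G_subset unfolding U_def by auto
  show gf: "g (f (X_inv Z)) = X_inv Z" using g_f[OF X_inv_disk[OF Z]] .
  show "\<Theta> (f (X_inv Z)) = Z" using X_inv(2)[OF Z] by (simp add: \<Theta>_def gf)
  show "Re (f (X_inv Z)) = Im Z" using X_inv(2)[OF Z] by (simp add: f_def)
qed

lemma open_P: "open P" and hol_X_inv: "X_inv holomorphic_on P"
  and deriv_X_inv: "Z \<in> P \<Longrightarrow> deriv X (X_inv Z) * deriv X_inv Z = 1"
proof -
  have hX: "X holomorphic_on U" using holX U_facts(1) by (rule holomorphic_on_subset)
  show op: "open P" using open_mapping_thm3[OF hX U_facts(2,3)] U_facts(4) by simp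
  from holomorphic_has_inverse[OF hX U_facts(2,3)] obtain j where j: "j holomorphic_on X ` U"
    "\<And>z. z \<in> U \<Longrightarrow> deriv X z * deriv j (X z) = 1" "\<And>z. z \<in> U \<Longrightarrow> j (X z) = z" by blast
  have eq: "j Z = X_inv Z" if "Z \<in> P" for Z using j(3)[OF X_inv(1)[OF that]] X_inv(2)[OF that] by simp
  show hX_inv: "X_inv holomorphic_on P" using j(1) U_facts(4) eq by (metis holomorphic_transform)
  show "deriv X (X_inv Z) * deriv X_inv Z = 1" if Z: "Z \<in> P" for Z
  proof -
    have "deriv j Z = deriv X_inv Z"
      by (rule complex_derivative_transform_within_open[of _ P]) (use j(1) U_facts(4) hX_inv op Z eq in auto)
    then show ?thesis using j(2)[OF X_inv(1)[OF Z]] X_inv(2)[OF Z] by simp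
  qed
qed

text \<open>Compactness of the closed box gives an accumulation point \<open>y\<close> of the
  preimages, with abscissa \<open>Im Z0\<close>. If \<open>y\<close> lay off the edge it would be in
  \<Omega>, and continuity would give \<open>\<Theta> y = Z0\<close>; then \<open>Z0\<close> would
  be in \<open>P\<close>, or on the curve \<tau> that bounds \<open>Q\<close> if \<open>y\<close> is
  on the top side.\<close>

lemma boundary_limit:
  assumes Z0: "Z0 \<in> Q" "Z0 \<notin> P" and e: "0 < e"
  shows "\<exists>d>0. \<forall>Z\<in>P. dist Z Z0 < d \<longrightarrow> dist (f (X_inv Z)) (Complex (Im Z0) (k * \<bar>Im Z0\<bar>)) < e"
proof (rule ccontr)
  let ?p = "Complex (Im Z0) (k * \<bar>Im Z0\<bar>)"
  assume "\<not> ?thesis"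
  then have "\<forall>n. \<exists>Z\<in>P. dist Z Z0 < inverse (real (Suc n)) \<and> \<not> dist (f (X_inv Z)) ?p < e"
    by (metis inverse_positive_iff_positive of_nat_0_less_iff zero_less_Suc)
  then obtain Z where Z: "\<And>n. Z n \<in> P" "\<And>n. dist (Z n) Z0 < inverse (real (Suc n))"
    "\<And>n. \<not> dist (f (X_inv (Z n))) ?p < e" by metis
  have limZ: "Z \<longlonglongrightarrow> Z0"
  proof (rule metric_LIMSEQ_I)
    fix e' :: real assume "0 < e'"
    then obtain N where N: "inverse (real (Suc N)) < e'" using reals_Archimedean by blast
    have "dist (Z n) Z0 < e'" if "n \<ge> N" for n
      using Z(2)[of n] N that by (smt (verit) le_imp_inverse_le of_nat_0_less_iff of_nat_le_iff not_less_eq_eq zero_less_Suc Suc_le_mono)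
    then show "\<exists>no. \<forall>n\<ge>no. dist (Z n) Z0 < e'" by blast
  qed
  define z where "z = (\<lambda>n. f (X_inv (Z n)))"
  have zG: "z n \<in> G" for n using f_X_inv(1)[OF Z(1)] by (simp add: z_def)
  define B where "B = {z. \<bar>Re z\<bar> \<le> c \<and> k * \<bar>Re z\<bar> \<le> Im z \<and> Im z \<le> h}"
  have "closed B" unfolding B_def by (intro closed_Collect_conj closed_Collect_le continuous_intros)
  moreover have "B \<subseteq> ball 0 r" using box_norm by (auto simp: B_def)
  ultimately have "compact B" by (meson bounded_ball bounded_subset compact_eq_bounded_closed)
  moreover have "\<forall>n. z n \<in> B" using zG by (auto simp: G_def B_def less_imp_le)
  ultimately obtain y \<sigma> where y: "y \<in> B" "strict_mono \<sigma>" "(z \<circ> \<sigma>) \<longlonglongrightarrow> y"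
    unfolding compact_def by blast
  have limZs: "(Z \<circ> \<sigma>) \<longlonglongrightarrow> Z0" using limZ y(2) by (rule LIMSEQ_subseq_LIMSEQ)
  have rez: "Re (z n) = Im (Z n)" for n using f_X_inv(3)[OF Z(1)] by (simp add: z_def)
  have "(\<lambda>n. Re ((z \<circ> \<sigma>) n)) \<longlonglongrightarrow> Re y" by (intro tendsto_intros y(3))
  moreover have "(\<lambda>n. Im ((Z \<circ> \<sigma>) n)) \<longlonglongrightarrow> Im Z0" by (intro tendsto_intros limZs)
  ultimately have rey: "Re y = Im Z0" using rez by (simp add: LIMSEQ_unique)
  have "y \<noteq> ?p"
  proof
    assume "y = ?p"
    then have "eventually (\<lambda>n. dist ((z \<circ> \<sigma>) n) ?p < e) sequentially" using y(3) e tendstoD by blast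
    then show False using Z(3) by (auto simp: z_def eventually_sequentially)
  qed
  then have imy: "k * \<bar>Re y\<bar> < Im y" using y(1) rey by (auto simp: B_def complex_eq_iff)
  have absy: "\<bar>Re y\<bar> < c" using Z0(1) rey by (simp add: Q_def)
  have yO: "y \<in> \<Omega>" using imy absy y(1) by (intro box) (auto simp: B_def)
  have "(\<lambda>n. \<Theta> ((z \<circ> \<sigma>) n)) \<longlonglongrightarrow> \<Theta> y" by (rule isCont_tendsto_compose[OF isCont_Theta[OF yO] y(3)])
  moreover have "\<Theta> ((z \<circ> \<sigma>) n) = (Z \<circ> \<sigma>) n" for n using f_X_inv(2)[OF Z(1)] by (simp add: z_def)
  ultimately have Ty: "\<Theta> y = Z0" using limZs LIMSEQ_unique by (simp add: o_def) blast
  show False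
  proof (cases "Im y = h")
    case True
    then have "y = Complex (Im Z0) h" using rey by (simp add: complex_eq_iff)
    then have "\<tau> (Im Z0) = Re Z0" using Ty by (simp add: \<tau>_def)
    then show False using Z0(1) by (simp add: Q_def)
  next
    case False
    then have "y \<in> G" using imy absy y(1) by (auto simp: G_def B_def)
    then show False using Ty Z0(2) by (auto simp: P_def)
  qed
qed

text \<open>Intermediate value theorem on the vertical segment from the preimage of \<open>Z\<close>
  to the top side of the box. Each horizontal line thus meets \<open>P\<close> in an initial
  interval of its intersection with \<open>Q\<close>, which makes the notion of its end
  meaningful.\<close>

lemma P_initial:
  assumes Z: "Z \<in> P" and Z': "Im Z' = Im Z" "\<tau> (Im Z) < Re Z'" "Re Z' \<le> Re Z"
  shows "Z' \<in> P"
proof -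
  obtain z where z: "z \<in> G" "Z = \<Theta> z" using Z by (auto simp: P_def)
  have imZ: "Im Z = Re z" using z G_subset Im_Theta by auto
  have seg: "Complex (Re z) y \<in> \<Omega>" if "Im z \<le> y" "y \<le> h" for y
    using z that by (intro box) (auto simp: G_def)
  have "\<exists>y\<ge>Im z. y \<le> h \<and> Re (\<Theta> (Complex (Re z) y)) = Re Z'"
  proof (rule IVT2')
    show "Re (\<Theta> (Complex (Re z) h)) \<le> Re Z'" using Z' imZ by (simp add: \<tau>_def)
    show "Re Z' \<le> Re (\<Theta> (Complex (Re z) (Im z)))" using Z' z by simp
    show "Im z \<le> h" using z by (simp add: G_def)
    show "continuous_on {Im z..h} (\<lambda>y. Re (\<Theta> (Complex (Re z) y)))"
      by (intro continuous_intros continuous_on_compose2[OF cont_Theta] continuous_on_Complex) (auto intro: seg)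
  qed
  then obtain y where y: "Im z \<le> y" "y \<le> h" "Re (\<Theta> (Complex (Re z) y)) = Re Z'" by blast
  have "y \<noteq> h" using y(3) Z'(2) imZ by (auto simp: \<tau>_def)
  then have "Complex (Re z) y \<in> G" using y z by (auto simp: G_def)
  moreover have "\<Theta> (Complex (Re z) y) = Z'"
    using y(3) Im_Theta[OF seg[OF y(1,2)]] Z'(1) imZ by (simp add: complex_eq_iff)
  ultimately show ?thesis by (auto simp: P_def)
qed

section \<open>Horizontal lines off the corner run to infinity\<close>

lemma edge_divergence:
  assumes Z0: "Z0 \<in> Q" "Z0 \<notin> P" "Im Z0 \<noteq> 0"
  shows "\<exists>d>0. \<forall>Z\<in>P. dist Z Z0 < d \<longrightarrow> M \<le> s (Im Z0) * Re (T (X_inv Z))"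
proof -
  let ?p = "Complex (Im Z0) (k * \<bar>Im Z0\<bar>)"
  have ab: "\<bar>Im Z0\<bar> \<le> c" using Z0(1) by (simp add: Q_def)
  then have "cmod ?p < r" using k_bound[OF ab] by (intro box_norm) auto
  from edge[OF Z0(3) this] have "eventually (\<lambda>z. M \<le> s (Im Z0) * Re (T (g z))) (at ?p within \<Omega>)"
    unfolding filterlim_at_top s_def by blast
  then obtain e where e: "e > 0" "\<And>z. z \<in> \<Omega> \<Longrightarrow> z \<noteq> ?p \<Longrightarrow> dist z ?p < e \<Longrightarrow> M \<le> s (Im Z0) * Re (T (g z))"
    unfolding eventually_at by blast
  from boundary_limit[OF Z0(1,2) e(1)] obtain d where d: "d > 0"
    "\<forall>Z\<in>P. dist Z Z0 < d \<longrightarrow> dist (f (X_inv Z)) ?p < e" by blast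
  have "M \<le> s (Im Z0) * Re (T (X_inv Z))" if Z: "Z \<in> P" "dist Z Z0 < d" for Z
  proof -
    have fz: "f (X_inv Z) \<in> \<Omega>" using f_X_inv(1)[OF Z(1)] G_subset by blast
    then have "f (X_inv Z) \<noteq> ?p" using not_edge[OF ab] by auto
    from e(2)[OF fz this] show ?thesis using d(2) Z f_X_inv(4)[OF Z(1)] by simp
  qed
  then show ?thesis using d(1) by blast
qed

text \<open>A finite end of the level line \<open>Im = x\<close> at \<open>Z0\<close> would put the half-line to the right of \<open>Z0\<close>
  outside \<open>P\<close>. The function \<open>1/2 - Re (csqrt ((Z - Z0) / (Z - Z0 - \<delta>)))\<close> is harmonic off the segment
  from \<open>Z0\<close> to \<open>Z0 + \<delta>\<close> of this half-line, bounded above, positive near \<open>Z0\<close> and negative far away.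
  Every multiple of it lies below the height function, which is infinite on the boundary of \<open>P\<close>.\<close>

lemma Q_off_real: "Z1 \<in> Q \<Longrightarrow> Im Z1 \<noteq> 0 \<Longrightarrow> Z1 \<in> P"
proof (rule ccontr)
  assume Z1: "Z1 \<in> Q" "Im Z1 \<noteq> 0" "Z1 \<notin> P"
  define x where "x = Im Z1"
  have x: "\<bar>x\<bar> < c" "x \<noteq> 0" using Z1 by (auto simp: x_def Q_def)
  define S where "S = {t. Complex t x \<in> P}"
  have above: "Complex t x \<in> P" if "Complex t' x \<in> P" "\<tau> x < t" "t \<le> t'" for t t'
    by (rule P_initial[OF that(1)]) (use that in auto)
  have tauS: "\<tau> x < t" if "t \<in> S" for t
    using subsetD[OF P_subset_Q, of "Complex t x"] that by (simp add: S_def Q_def)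
  have Sbd: "t \<le> Re Z1" if "t \<in> S" for t
  proof (rule ccontr)
    assume "\<not> ?thesis"
    moreover have "\<tau> x < Re Z1" using Z1(1) by (simp add: Q_def x_def)
    ultimately have "Complex (Re Z1) x \<in> P" using that above[of t "Re Z1"] by (simp add: S_def)
    then show False using Z1(3) by (simp add: x_def)
  qed
  have "S \<noteq> {}"
  proof -
    define y where "y = (k * \<bar>x\<bar> + h) / 2"
    have "Complex x y \<in> G" using x k_lt[of x] by (auto simp: G_def y_def)
    then have "\<Theta> (Complex x y) \<in> P" by (simp add: P_def)
    moreover have "Im (\<Theta> (Complex x y)) = x" using Im_Theta \<open>Complex x y \<in> G\<close> G_subset by auto
    ultimately have "Re (\<Theta> (Complex x y)) \<in> S" by (metis S_def complex_surj mem_Collect_eq)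
    then show ?thesis by blast
  qed
  have bdd: "bdd_above S" using Sbd by (meson bdd_aboveI)
  define B where "B = Sup S"
  have Bge: "t \<le> B" if "t \<in> S" for t unfolding B_def using that bdd by (rule cSup_upper)
  define Z0 where "Z0 = Complex B x"
  have tauB: "\<tau> x < B" using \<open>S \<noteq> {}\<close> tauS Bge by (meson ex_in_conv order_less_le_trans)
  have Z0Q: "Z0 \<in> Q" using x tauB by (simp add: Z0_def Q_def)
  have Z0P: "Z0 \<notin> P"
  proof
    assume "Z0 \<in> P"
    then obtain e where e: "e > 0" "ball Z0 e \<subseteq> P" using open_P open_contains_ball by blast
    have "Complex (B + e/2) x \<in> ball Z0 e" using e by (simp add: Z0_def dist_norm cmod_def)
    then have "B + e/2 \<in> S" using e by (auto simp: S_def)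
    then show False using Bge e(1) by force
  qed
  have right: "Complex t x \<notin> P" if "B \<le> t" for t
  proof
    assume "Complex t x \<in> P"
    then have "t \<in> S" by (simp add: S_def)
    then have "t = B" using Bge that by force
    then show False using \<open>Complex t x \<in> P\<close> Z0P by (simp add: Z0_def)
  qed
  obtain d1 where d1: "d1 > 0" "\<forall>Z\<in>P. dist Z Z0 < d1 \<longrightarrow> 0 \<le> s x * Re (T (X_inv Z))"
    using edge_divergence[OF Z0Q Z0P, of 0] x by (auto simp: Z0_def)
  obtain d2 where d2: "d2 > 0" "ball Z0 d2 \<subseteq> Q" using open_Q Z0Q open_contains_ball by blast
  \<comment> \<open>The three bounds make the signed height nonnegative on \<open>W\<close>, keep
    the ball in \<open>Q\<close>, and keep it off the real axis, so that the single sign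
    \<open>s x\<close> serves throughout it.\<close>
  define \<rho> where "\<rho> = min (min d1 d2) \<bar>x\<bar>"
  have \<rho>: "0 < \<rho>" "\<rho> \<le> d1" "\<rho> \<le> d2" "\<rho> \<le> \<bar>x\<bar>" using d1 d2 x by (auto simp: \<rho>_def)
  define W where "W = P \<inter> ball Z0 \<rho>"
  define \<delta> where "\<delta> = \<rho> / 8"
  have \<delta>: "\<delta> > 0" using \<rho> by (simp add: \<delta>_def)
  define v where "v = (\<lambda>Z. (Z - Z0) / (Z - Z0 - of_real \<delta>))"
  have nz: "Z - Z0 - of_real \<delta> \<noteq> 0" if "Z \<in> P" for Z
  proof
    assume "Z - Z0 - of_real \<delta> = 0"
    then have "Z = Complex (B + \<delta>) x" by (simp add: Z0_def complex_eq_iff)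
    then show False using that right[of "B + \<delta>"] \<delta> by simp
  qed
  \<comment> \<open>The quotient is real and nonpositive only on the segment from \<open>Z0\<close>
    to \<open>Z0 + \<delta>\<close>, which belongs to the half-line outside \<open>P\<close>. Hence
    the principal root of \<open>v\<close> is holomorphic on \<open>P\<close>.\<close>
  have vslit: "v Z \<notin> \<real>\<^sub>\<le>\<^sub>0" if Z: "Z \<in> P" for Z
  proof
    assume "v Z \<in> \<real>\<^sub>\<le>\<^sub>0"
    then obtain m where m: "v Z = of_real m" "m \<le> 0" by (auto elim: nonpos_Reals_cases)
    then have "Z - Z0 = of_real m * (Z - Z0 - of_real \<delta>)" using nz[OF Z] by (simp add: v_def field_simps)
    then have "(Z - Z0) * of_real (1 - m) = of_real (- m * \<delta>)" by (simp add: algebra_simps)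
    then have "Z - Z0 = of_real (- m * \<delta>) / of_real (1 - m)" using m(2)
      by (metis nonzero_mult_div_cancel_right of_real_eq_0_iff diff_gt_0_iff_gt le_less_trans less_irrefl zero_less_one)
    then have "Z - Z0 = of_real (- m * \<delta> / (1 - m))" by simp
    then have "Z = Complex (B + (- m * \<delta> / (1 - m))) x" by (simp add: Z0_def complex_eq_iff algebra_simps)
    moreover have "0 \<le> - m * \<delta> / (1 - m)" using m \<delta> by (intro divide_nonneg_pos mult_nonneg_nonneg) auto
    ultimately show False using Z right[of "B + (- m * \<delta> / (1 - m))"] by simp
  qed
  \<comment> \<open>Here the distance exceeds \<open>4 * \<delta>\<close>, so the denominator of
    \<open>v\<close> has modulus at least \<open>3 * \<delta>\<close> and \<open>v\<close> is close
    to 1; its root is closer still. The function \<open>1/2 - Re (csqrt (v Z))\<close> is therefore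
    nonpositive near the outer circle, where only the sign of the height is known.\<close>
  have far: "cmod (csqrt (v Z) - 1) \<le> 1/2" if Z: "\<rho> / 2 < dist Z Z0" for Z
  proof -
    have "\<rho> / 2 < cmod (Z - Z0)" using Z by (simp add: dist_norm)
    moreover have "cmod (Z - Z0) - cmod (of_real \<delta>) \<le> cmod (Z - Z0 - of_real \<delta>)" by (rule norm_triangle_ineq2)
    moreover have "cmod (of_real \<delta>) = \<delta>" using \<delta> by simp
    ultimately have n: "3 * \<delta> \<le> cmod (Z - Z0 - of_real \<delta>)" by (simp add: \<delta>_def)
    then have nz': "Z - Z0 - of_real \<delta> \<noteq> 0" using \<delta> by auto
    have "v Z - 1 = of_real \<delta> / (Z - Z0 - of_real \<delta>)" using nz' by (simp add: v_def field_simps)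
    then have "cmod (v Z - 1) = \<delta> / cmod (Z - Z0 - of_real \<delta>)" using \<delta> by (simp add: norm_divide)
    also have "\<dots> \<le> 1/2" using n \<delta> nz' by (simp add: divide_le_eq)
    finally have 1: "cmod (v Z - 1) \<le> 1/2" .
    have "v Z - 1 = (csqrt (v Z) - 1) * (csqrt (v Z) + 1)"
      by (metis power2_csqrt power2_eq_square square_diff_one_factored mult.commute)
    then have "cmod (v Z - 1) = cmod (csqrt (v Z) - 1) * cmod (csqrt (v Z) + 1)" by (simp add: norm_mult)
    moreover have "1 \<le> cmod (csqrt (v Z) + 1)"
      using complex_Re_le_cmod[of "csqrt (v Z) + 1"] Re_csqrt[of "v Z"] by (simp del: csqrt.simps)
    ultimately have "cmod (csqrt (v Z) - 1) \<le> cmod (v Z - 1)" by (simp add: mult_le_cancel_left1)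
    then show ?thesis using 1 by simp
  qed
  \<comment> \<open>Near the outer part of the frontier the left side is at most 0 and the signed
    height at least 0. Every other frontier point of \<open>W\<close> is in \<open>Q\<close> but not
    in \<open>P\<close>, and near it the signed height exceeds \<open>C\<close>, hence also the left
    side.\<close>
  have bound: "C * (1/2 - Re (csqrt (v Z))) \<le> s x * Re (T (X_inv Z))" if C: "0 < C" and Z: "Z \<in> W" for C Z
  proof -
    define E where "E = (\<lambda>Z. exp (of_real C * (1/2 - csqrt (v Z)) - of_real (s x) * T (X_inv Z)))"
    have nE: "cmod (E Z) = exp (C * (1/2 - Re (csqrt (v Z))) - s x * Re (T (X_inv Z)))" for Z
      by (simp add: E_def norm_exp_eq_Re)
    have "cmod (E Z) \<le> 1"
    proof (rule maximum_modulus_limsup[of W E])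
      show "open W" "bounded W" using open_P by (auto simp: W_def bounded_Int)
      have "X_inv holomorphic_on W" using hol_X_inv by (rule holomorphic_on_subset) (simp add: W_def)
      moreover have "X_inv ` W \<subseteq> unit_disk" using X_inv_disk unfolding W_def by blast
      ultimately have "(T \<circ> X_inv) holomorphic_on W" by (rule holomorphic_on_compose_gen[OF _ holT])
      then have "(\<lambda>Z. T (X_inv Z)) holomorphic_on W" by (simp add: o_def)
      moreover have "v holomorphic_on W" unfolding v_def by (intro holomorphic_intros) (use nz in \<open>auto simp: W_def\<close>)
      ultimately show "E holomorphic_on W" unfolding E_def by (intro holomorphic_intros) (use vslit in \<open>auto simp: W_def\<close>)
      show "Z \<in> W" by fact
      fix p :: complex and e :: real assume p: "p \<in> frontier W" and e: "0 < e"
      have pcl: "p \<in> closure W" and pn: "p \<notin> W" using p \<open>open W\<close> by (auto simp: frontier_def interior_open)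
      have pball: "dist p Z0 \<le> \<rho>"
      proof -
        have "closure W \<subseteq> cball Z0 \<rho>" by (rule closure_minimal) (auto simp: W_def)
        then show ?thesis using pcl by (auto simp: dist_commute)
      qed
      show "\<exists>d>0. \<forall>w\<in>W. dist w p < d \<longrightarrow> cmod (E w) \<le> 1 + e"
      proof (cases "\<rho> / 2 < dist p Z0")
        case True
        have "cmod (E w) \<le> 1 + e" if w: "w \<in> W" "dist w p < dist p Z0 - \<rho>/2" for w
        proof -
          have "dist p Z0 \<le> dist w p + dist w Z0" by (metis dist_commute dist_triangle)
          then have "cmod (csqrt (v w) - 1) \<le> 1/2" using w by (intro far) simp
          then have "1/2 \<le> Re (csqrt (v w))" using abs_Re_le_cmod[of "csqrt (v w) - 1"] by (simp del: csqrt.simps)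
          moreover have "0 \<le> s x * Re (T (X_inv w))" using d1 w \<rho> by (auto simp: W_def dist_commute)
          ultimately have "C * (1/2 - Re (csqrt (v w))) - s x * Re (T (X_inv w)) \<le> 0"
            using C by (smt (verit) mult_nonneg_nonpos)
          then have "cmod (E w) \<le> exp 0" unfolding nE by (simp only: exp_le_cancel_iff)
          then show ?thesis using e by simp
        qed
        then show ?thesis using True by (intro exI[of _ "dist p Z0 - \<rho>/2"]) auto
      next
        case False
        then have pb: "dist p Z0 < \<rho>" using \<rho> by simp
        then have pQ: "p \<in> Q" "p \<notin> P" using d2 \<rho> pn by (auto simp: W_def dist_commute)
        have "\<bar>Im p - x\<bar> < \<bar>x\<bar>" using pb \<rho> abs_Im_le_cmod[of "p - Z0"] by (simp add: dist_norm Z0_def)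
        then have imp: "Im p \<noteq> 0" "s (Im p) = s x" by (auto simp: s_def)
        from edge_divergence[OF pQ imp(1), of C] obtain d where d: "d > 0"
          "\<forall>Z\<in>P. dist Z p < d \<longrightarrow> C \<le> s x * Re (T (X_inv Z))" using imp by auto
        have "cmod (E w) \<le> 1 + e" if w: "w \<in> W" "dist w p < d" for w
        proof -
          have "C \<le> s x * Re (T (X_inv w))" using d w by (auto simp: W_def)
          moreover have "C * (1/2 - Re (csqrt (v w))) \<le> C * 1"
            using C Re_csqrt[of "v w"] by (intro mult_left_mono) (auto simp del: csqrt.simps)
          ultimately have "C * (1/2 - Re (csqrt (v w))) - s x * Re (T (X_inv w)) \<le> 0" by simp
          then have "cmod (E w) \<le> exp 0" unfolding nE by (simp only: exp_le_cancel_iff)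
          then show ?thesis using e by simp
        qed
        then show ?thesis using d(1) by blast
      qed
    qed
    then show ?thesis by (simp add: nE)
  qed
  \<comment> \<open>With \<open>B - t\<close> below \<open>\<delta> / 8\<close> the quotient
    \<open>v\<close> is at most 1/9, its root at most 1/3, and the barrier at least 1/6. A finite
    height at this point contradicts the bound for large \<open>C\<close>.\<close>
  obtain t where t: "t \<in> S" "B - \<delta> / 8 < t"
    using less_cSup_iff[OF \<open>S \<noteq> {}\<close> bdd, of "B - \<delta>/8"] \<delta> by (auto simp: B_def)
  have tB: "t < B" using Bge[OF t(1)] t(1) Z0P by (cases "t = B") (auto simp: S_def Z0_def)
  define Z where "Z = Complex t x"
  have ZZ0: "Z - Z0 = of_real (t - B)" by (simp add: Z_def Z0_def complex_eq_iff)
  have ZW: "Z \<in> W"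
  proof -
    have "dist Z0 Z = B - t" using tB by (metis ZZ0 dist_commute dist_norm norm_of_real abs_of_neg minus_diff_eq diff_less_0_iff_less)
    then show ?thesis using t \<rho> by (auto simp: W_def Z_def S_def \<delta>_def)
  qed
  have vZ: "v Z = of_real ((B - t) / (B - t + \<delta>))"
  proof -
    have "v Z = of_real ((t - B) / (t - B - \<delta>))" unfolding v_def ZZ0 by simp
    also have "(t - B) / (t - B - \<delta>) = (B - t) / (B - t + \<delta>)"
      using tB \<delta> by (simp add: field_simps)
    finally show ?thesis .
  qed
  have "(B - t) / (B - t + \<delta>) \<le> (1/3)\<^sup>2" using t(2) tB \<delta> by (simp add: divide_le_eq power2_eq_square)
  then have "sqrt ((B - t) / (B - t + \<delta>)) \<le> 1/3" by (metis real_sqrt_le_iff real_sqrt_abs abs_of_nonneg divide_nonneg_nonneg zero_le_one zero_le_numeral)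
  moreover have "Re (csqrt (v Z)) = sqrt ((B - t) / (B - t + \<delta>))"
  proof -
    have "0 \<le> (B - t) / (B - t + \<delta>)" using tB \<delta> by simp
    then show ?thesis unfolding vZ by (simp only: of_real_sqrt[symmetric] Re_complex_of_real)
  qed
  ultimately have small: "1/6 \<le> 1/2 - Re (csqrt (v Z))" by (simp del: csqrt.simps)
  define C where "C = 6 * \<bar>s x * Re (T (X_inv Z))\<bar> + 6"
  have "C > 0" by (simp add: C_def)
  have "C * (1/6) \<le> C * (1/2 - Re (csqrt (v Z)))" using small \<open>C > 0\<close> by (intro mult_left_mono) auto
  also have "\<dots> \<le> s x * Re (T (X_inv Z))" by (rule bound[OF \<open>C > 0\<close> ZW])
  finally show False by (simp add: C_def)
qed

section \<open>The line through the corner cannot run to infinity\<close>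

lemma uniform_top: "\<exists>A. \<forall>x. \<bar>x\<bar> \<le> c \<longrightarrow> Re (\<Theta> (Complex x (k * \<bar>x\<bar> + e))) \<le> A"
  if e: "0 < e" "e \<le> h - \<bar>k\<bar> * c"
proof -
  have "continuous_on {-c..c} (\<lambda>x. Re (\<Theta> (Complex x (k * \<bar>x\<bar> + e))))"
  proof (intro continuous_intros continuous_on_compose2[OF cont_Theta] continuous_on_Complex)
    show "(\<lambda>x. Complex x (k * \<bar>x\<bar> + e)) ` {-c..c} \<subseteq> \<Omega>"
    proof
      fix z assume "z \<in> (\<lambda>x. Complex x (k * \<bar>x\<bar> + e)) ` {-c..c}"
      then obtain x where x: "\<bar>x\<bar> \<le> c" "z = Complex x (k * \<bar>x\<bar> + e)" by (auto simp: abs_le_iff)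
      have "k * \<bar>x\<bar> \<le> \<bar>k\<bar> * c"
        using x(1) by (intro mult_mono) auto
      then show "z \<in> \<Omega>" using x e by (intro box) auto
    qed
  qed
  then have "compact ((\<lambda>x. Re (\<Theta> (Complex x (k * \<bar>x\<bar> + e)))) ` {-c..c})"
    by (rule compact_continuous_image) simp
  then obtain A where "\<forall>y\<in>(\<lambda>x. Re (\<Theta> (Complex x (k * \<bar>x\<bar> + e)))) ` {-c..c}. y \<le> A"
    by (meson bounded_has_Sup(1) compact_imp_bounded bdd_above_def bounded_imp_bdd_above)
  then show ?thesis by (intro exI[of _ A]) (auto simp: abs_le_iff minus_le_iff)
qed

lemma tau_bound: "\<exists>A. \<forall>x. \<bar>x\<bar> \<le> c \<longrightarrow> \<tau> x \<le> A"
proof -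
  have "compact (\<tau> ` {-c..c})" by (rule compact_continuous_image[OF cont_tau]) simp
  then obtain A where "\<forall>y\<in>\<tau> ` {-c..c}. y \<le> A"
    by (meson compact_imp_bounded bdd_above_def bounded_imp_bdd_above)
  then show ?thesis by (intro exI[of _ A]) (auto simp: abs_le_iff minus_le_iff)
qed

definition "Yh Z = Y (X_inv Z)"
definition "Th Z = T (X_inv Z)"

lemma hol_hat: "Yh holomorphic_on P" "Th holomorphic_on P"
proof -
  have sub: "X_inv ` P \<subseteq> unit_disk" using X_inv_disk by blast
  show "Yh holomorphic_on P" "Th holomorphic_on P"
    using holomorphic_on_compose_gen[OF hol_X_inv holY sub] holomorphic_on_compose_gen[OF hol_X_inv holT sub]
    by (simp_all add: o_def Yh_def[abs_def] Th_def[abs_def])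
qed

lemma Im_Yh: "Z \<in> P \<Longrightarrow> Im (Yh Z) = Im (f (X_inv Z))"
  by (simp add: Yh_def f_def)

text \<open>In the coordinate \<open>Z\<close> the function \<open>X\<close> is the identity, so its
  derivative contributes the summand 1.\<close>

lemma deriv_hat:
  assumes Z: "Z \<in> P"
  shows "1 + (deriv Yh Z)\<^sup>2 = (deriv Th Z)\<^sup>2"
proof -
  let ?w = "X_inv Z"
  have dX: "(X_inv has_field_derivative deriv X_inv Z) (at Z)"
    using holomorphic_derivI[OF hol_X_inv open_P Z] .
  have "(Yh has_field_derivative deriv Y ?w * deriv X_inv Z) (at Z)" "(Th has_field_derivative deriv T ?w * deriv X_inv Z) (at Z)"
    using DERIV_chain[OF f_holomorphic_derivs(2)[OF X_inv_disk[OF Z]] dX] DERIV_chain[OF f_holomorphic_derivs(3)[OF X_inv_disk[OF Z]] dX]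
    by (simp_all add: o_def Yh_def[abs_def] Th_def[abs_def])
  then have d: "deriv Yh Z = deriv Y ?w * deriv X_inv Z" "deriv Th Z = deriv T ?w * deriv X_inv Z"
    by (auto dest: DERIV_imp_deriv)
  have "((deriv X ?w)\<^sup>2 + (deriv Y ?w)\<^sup>2) * (deriv X_inv Z)\<^sup>2 = (deriv T ?w)\<^sup>2 * (deriv X_inv Z)\<^sup>2"
    by (simp only: conformal[OF X_inv_disk[OF Z]])
  moreover have "(deriv X ?w)\<^sup>2 * (deriv X_inv Z)\<^sup>2 = 1"
    by (metis deriv_X_inv[OF Z] power_mult_distrib power_one)
  ultimately show ?thesis unfolding d by (simp add: power_mult_distrib algebra_simps)
qed

text \<open>If the line \<open>Im Z = 0\<close> does not end either, then \<open>P\<close> contains a half-strip at whose end the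
  surface converges to the edge lines. A harmonic limit cannot have a kink, which excludes \<open>k \<noteq> 0\<close>;
  for \<open>k = 0\<close> the height has derivative close to a constant 1 or -1, against the signs.\<close>

lemma half_strip_impossible:
  assumes QP: "Q \<subseteq> P"
  shows False
proof -
  obtain A0 where A0: "\<And>x. \<bar>x\<bar> \<le> c \<Longrightarrow> \<tau> x \<le> A0" using tau_bound by blast
  have strip: "Z \<in> P" if "\<bar>Im Z\<bar> < c" "A0 < Re Z" for Z
    using A0[of "Im Z"] that QP by (force simp: Q_def)
  have lo: "k * \<bar>Im Z\<bar> < Im (Yh Z)" and box': "\<bar>Im (Yh Z)\<bar> \<le> h" if Z: "Z \<in> P" for Z
  proof -
    have "f (X_inv Z) \<in> G" "Re (f (X_inv Z)) = Im Z" using f_X_inv[OF Z] by auto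
    then have "k * \<bar>Im Z\<bar> < Im (Yh Z)" "Im (Yh Z) < h" "\<bar>Im Z\<bar> < c" using Im_Yh[OF Z] by (auto simp: G_def)
    then show "k * \<bar>Im Z\<bar> < Im (Yh Z)" "\<bar>Im (Yh Z)\<bar> \<le> h" using k_bound[of "Im Z"] by auto
  qed
  \<comment> \<open>Since \<open>Re \<Theta>\<close> decreases upwards, a preimage at height
    \<open>e'\<close> or more above the edge has \<open>Re Z\<close> at most its value at height
    exactly \<open>e'\<close>, which compactness bounds uniformly in the abscissa. Far to the right
    the surface is therefore uniformly close to the edges.\<close>
  have up: "\<exists>A\<ge>A0. \<forall>Z. \<bar>Im Z\<bar> < c \<longrightarrow> A < Re Z \<longrightarrow> Im (Yh Z) < k * \<bar>Im Z\<bar> + e" if e: "0 < e" for e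
  proof -
    define e' where "e' = min e (h - \<bar>k\<bar> * c)"
    have e': "0 < e'" "e' \<le> e" "e' \<le> h - \<bar>k\<bar> * c" using e hc by (auto simp: e'_def)
    obtain A where A: "\<And>x. \<bar>x\<bar> \<le> c \<Longrightarrow> Re (\<Theta> (Complex x (k * \<bar>x\<bar> + e'))) \<le> A"
      using uniform_top[OF e'(1,3)] by blast
    have "Im (Yh Z) < k * \<bar>Im Z\<bar> + e" if Z: "\<bar>Im Z\<bar> < c" "max A A0 < Re Z" for Z
    proof (rule ccontr)
      assume "\<not> ?thesis"
      then have ge: "k * \<bar>Im Z\<bar> + e' \<le> Im (Yh Z)" using e' by simp
      have ZP: "Z \<in> P" using strip Z by auto
      define z where "z = f (X_inv Z)"
      have z: "z \<in> G" "Re z = Im Z" "Im z = Im (Yh Z)" "\<Theta> z = Z"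
        using f_X_inv[OF ZP] Im_Yh[OF ZP] by (auto simp: z_def)
      have "Re Z \<le> Re (\<Theta> (Complex (Im Z) (k * \<bar>Im Z\<bar> + e')))"
      proof (cases "Im z = k * \<bar>Im Z\<bar> + e'")
        case True
        then have "z = Complex (Im Z) (k * \<bar>Im Z\<bar> + e')" using z by (simp add: complex_eq_iff)
        then show ?thesis using z by simp
      next
        case False
        have "Re (\<Theta> (Complex (Re z) (Im z))) < Re (\<Theta> (Complex (Re z) (k * \<bar>Re z\<bar> + e')))"
          by (rule Theta_decreasing) (use False ge z e' in \<open>auto simp: G_def intro!: box\<close>)
        moreover have "Complex (Re z) (Im z) = z" by simp
        ultimately show ?thesis using z by (metis less_imp_le)
      qed
      also have "\<dots> \<le> A" using A[of "Im Z"] Z by simp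
      finally show False using Z by simp
    qed
    then show ?thesis by (intro exI[of _ "max A A0"]) auto
  qed
  have subP: "ball Z (c/2) \<subseteq> P" if "\<bar>Im Z\<bar> \<le> c/2" "A0 + c/2 \<le> Re Z" for Z
  proof
    fix V assume "V \<in> ball Z (c/2)"
    then have "\<bar>Re V - Re Z\<bar> < c/2" "\<bar>Im V - Im Z\<bar> < c/2"
      using abs_Re_le_cmod[of "V - Z"] abs_Im_le_cmod[of "V - Z"] by (auto simp: dist_norm norm_minus_commute)
    then show "V \<in> P" using that hc(2) by (intro strip) linarith+
  qed
  show False
  proof (cases "k = 0")
    case False
    \<comment> \<open>\<open>M1\<close> and \<open>M2\<close> bound the first two derivatives of
      \<open>Yh\<close> independently of \<open>Re Z\<close>. This is what allows the base point to
      move to infinity.\<close>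
    define M1 where "M1 = 18 * h / (c/2)"
    have d1: "cmod (deriv Yh Z) \<le> M1" if "\<bar>Im Z\<bar> \<le> c/2" "A0 + c/2 \<le> Re Z" for Z
      unfolding M1_def
    proof (rule norm_deriv_le_of_Im_bound)
      show "Yh holomorphic_on ball Z (c/2)" using hol_hat(1) subP[OF that] by (rule holomorphic_on_subset)
      show "\<bar>Im (Yh w)\<bar> \<le> h" if "w \<in> ball Z (c/2)" for w using box' subP[OF \<open>\<bar>Im Z\<bar> \<le> c/2\<close> \<open>A0 + c/2 \<le> Re Z\<close>] that by blast
    qed (use hc in auto)
    have hd: "deriv Yh holomorphic_on P" by (rule holomorphic_deriv[OF hol_hat(1) open_P])
    define M2 where "M2 = M1 / (c/4)"
    have d2: "cmod (deriv (deriv Yh) Z) \<le> M2" if Z: "\<bar>Im Z\<bar> \<le> c/4" "A0 + c \<le> Re Z" for Z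
    proof -
      have in1: "\<bar>Im V\<bar> \<le> c/2 \<and> A0 + c/2 \<le> Re V" if "dist Z V \<le> c/4" for V
        using that Z abs_Re_le_cmod[of "V - Z"] abs_Im_le_cmod[of "V - Z"] hc(2) by (auto simp: dist_norm norm_minus_commute)
      have sub: "cball Z (c/4) \<subseteq> P"
        using in1 strip hc(2) by (smt (verit) field_sum_of_halves mem_cball subsetI)
      have "cmod ((deriv ^^ 1) (deriv Yh) Z) \<le> fact 1 * M1 / (c/4) ^ 1"
      proof (rule Cauchy_inequality)
        show "deriv Yh holomorphic_on ball Z (c/4)" using hd sub ball_subset_cball by (meson holomorphic_on_subset)
        show "continuous_on (cball Z (c/4)) (deriv Yh)"
          using hd sub by (meson holomorphic_on_imp_continuous_on holomorphic_on_subset)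
        show "0 < c/4" using hc by simp
        show "cmod (deriv Yh V) \<le> M1" if "cmod (Z - V) = c/4" for V
          using d1 in1[of V] that by (simp add: dist_norm)
      qed
      then show ?thesis by (simp add: M2_def)
    qed
    \<comment> \<open>The second difference of \<open>Im Yh\<close> over \<open>- x\<close>,
      \<open>0\<close>, \<open>x\<close> is \<open>2 * k * x\<close> up to \<open>4 * e\<close> by
      closeness to the edges, and at most \<open>2 * M2 * x\<^sup>2\<close> in modulus by Taylor's
      formula. The base point \<open>t\<close> depends on \<open>e\<close>, the constant
      \<open>M2\<close> does not.\<close>
    have kink: "2 * \<bar>k\<bar> * x \<le> 2 * (M2 * x\<^sup>2) + 4 * e" if x: "0 < x" "x < c/4" and e: "0 < e" for x e
    proof -
      obtain A where A: "A \<ge> A0" "\<And>Z. \<bar>Im Z\<bar> < c \<Longrightarrow> A < Re Z \<Longrightarrow> Im (Yh Z) < k * \<bar>Im Z\<bar> + e"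
        using up[OF e] by blast
      define t where "t = A + c + 1"
      define S where "S = {Z. \<bar>Im Z\<bar> < c/4 \<and> A0 + c < Re Z}"
      have cS: "convex S"
      proof -
        have "S = {Z. Im Z < c/4} \<inter> {Z. - (c/4) < Im Z} \<inter> {Z. A0 + c < Re Z}" by (auto simp: S_def abs_less_iff)
        then show ?thesis
          by (simp only:) (intro convex_Int convex_halfspace_Im_lt convex_halfspace_Im_gt convex_halfspace_Re_gt)
      qed
      have SP: "S \<subseteq> P" using strip hc by (auto simp: S_def)
      have tay: "cmod (Yh Z - Yh (of_real t) - deriv Yh (of_real t) * (Z - of_real t)) \<le> M2 * (cmod (Z - of_real t))\<^sup>2"
        if "Z \<in> S" for Z
      proof -
        have "cmod (((deriv ^^ 0) Yh) Z - (\<Sum>i\<le>1. ((deriv ^^ i) Yh) (of_real t) * (Z - of_real t) ^ i / fact i))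
            \<le> M2 * cmod (Z - of_real t) ^ Suc 1 / fact 1"
        proof (rule complex_Taylor[OF cS])
          show "((deriv ^^ i) Yh has_field_derivative (deriv ^^ Suc i) Yh V) (at V within S)" if "V \<in> S" for i V
          proof -
            have "(deriv ^^ i) Yh holomorphic_on P" by (rule holomorphic_higher_deriv[OF hol_hat(1) open_P])
            from holomorphic_derivI[OF this open_P] SP that show ?thesis
              by (auto intro: has_field_derivative_at_within)
          qed
          show "cmod ((deriv ^^ Suc 1) Yh V) \<le> M2" if "V \<in> S" for V using d2[of V] that by (simp add: S_def)
          show "of_real t \<in> S" using A hc by (simp add: S_def t_def)
          show "Z \<in> S" by fact
        qed
        then show ?thesis by (simp add: diff_diff_eq power2_eq_square)
      qed
      let ?p = "Complex t x" and ?m = "Complex t (-x)" and ?o = "complex_of_real t"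
      have pS: "?p \<in> S" "?m \<in> S" using x A hc by (auto simp: S_def t_def)
      have diffs: "?p - ?o = \<i> * of_real x" "?m - ?o = - (\<i> * of_real x)" by (auto simp: complex_eq_iff)
      have nx: "cmod (\<i> * of_real x) = x" using x by (simp add: norm_mult)
      have "Yh ?p + Yh ?m - 2 * Yh ?o = (Yh ?p - Yh ?o - deriv Yh ?o * (?p - ?o)) + (Yh ?m - Yh ?o - deriv Yh ?o * (?m - ?o))"
        unfolding diffs by (simp add: algebra_simps)
      then have "cmod (Yh ?p + Yh ?m - 2 * Yh ?o) \<le>
          cmod (Yh ?p - Yh ?o - deriv Yh ?o * (?p - ?o)) + cmod (Yh ?m - Yh ?o - deriv Yh ?o * (?m - ?o))"
        by (metis norm_triangle_ineq)
      also have "\<dots> \<le> M2 * x\<^sup>2 + M2 * x\<^sup>2"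
        using tay[OF pS(1)] tay[OF pS(2)] nx unfolding diffs norm_minus_cancel by simp
      finally have 1: "\<bar>Im (Yh ?p) + Im (Yh ?m) - 2 * Im (Yh ?o)\<bar> \<le> 2 * (M2 * x\<^sup>2)"
        using abs_Im_le_cmod[of "Yh ?p + Yh ?m - 2 * Yh ?o"] by simp
      have "Im (Yh ?p) < k * x + e" "Im (Yh ?m) < k * x + e" "Im (Yh ?o) < e"
        using A(2)[of ?p] A(2)[of ?m] A(2)[of ?o] x hc by (auto simp: t_def)
      moreover have "k * x < Im (Yh ?p)" "k * x < Im (Yh ?m)" "0 < Im (Yh ?o)"
        using lo[of ?p] lo[of ?m] lo[of ?o] strip[of ?p] strip[of ?m] strip[of ?o] A(1) x hc by (auto simp: t_def)
      ultimately have "\<bar>2 * (k * x)\<bar> \<le> 2 * (M2 * x\<^sup>2) + 4 * e" using 1 e by linarith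
      then show ?thesis using x by (simp add: abs_mult mult.assoc)
    qed
    have kink2: "\<bar>k\<bar> \<le> M2 * x" if x: "0 < x" "x < c/4" for x
    proof -
      have "2 * \<bar>k\<bar> * x \<le> 2 * (M2 * x\<^sup>2)"
      proof (rule field_le_epsilon)
        fix e :: real assume "0 < e"
        then show "2 * \<bar>k\<bar> * x \<le> 2 * (M2 * x\<^sup>2) + e" using kink[OF x, of "e/4"] by simp
      qed
      then show ?thesis using x by (simp add: power2_eq_square mult_le_cancel_right flip: mult.assoc)
    qed
    have M2: "0 < M2" unfolding M2_def M1_def using hc by simp
    \<comment> \<open>With this \<open>x\<close> the inequality
      \<open>\<bar>k\<bar> \<le> M2 * x\<close> would bound \<open>\<bar>k\<bar>\<close> by half of
      itself.\<close>
    define x where "x = min (c/8) (\<bar>k\<bar> / (2 * M2))"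
    have "0 < x" "x < c/4" using hc M2 False by (auto simp: x_def)
    from kink2[OF this] have "\<bar>k\<bar> \<le> M2 * (\<bar>k\<bar> / (2 * M2))"
      using M2 by (smt (verit) mult_left_mono x_def)
    then show False using M2 False by (simp add: field_simps)
  next
    case True
    \<comment> \<open>Chosen so that the derivative estimate \<open>18 * e / (c/2)\<close> equals
      1/2; then \<open>1 + (deriv Yh Z)\<^sup>2\<close> is close enough to 1 to exclude the
      nonpositive real numbers.\<close>
    define e where "e = c / 72"
    have e: "0 < e" "18 * e / (c/2) = 1/2" using hc by (auto simp: e_def)
    obtain A where A: "A \<ge> A0" "\<And>Z. \<bar>Im Z\<bar> < c \<Longrightarrow> A < Re Z \<Longrightarrow> Im (Yh Z) < e"
      using up[OF e(1)] True by auto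
    define R where "R = {Z. \<bar>Im Z\<bar> < c/2 \<and> A + c < Re Z}"
    have RP: "R \<subseteq> P" using strip A(1) hc by (auto simp: R_def)
    have dY: "cmod (deriv Yh Z) \<le> 1/2" if Z: "Z \<in> R" for Z
    proof -
      have sub: "ball Z (c/2) \<subseteq> P" using Z A(1) hc by (intro subP) (auto simp: R_def)
      have "cmod (deriv Yh Z) \<le> 18 * e / (c/2)"
      proof (rule norm_deriv_le_of_Im_bound)
        show "Yh holomorphic_on ball Z (c/2)" using hol_hat(1) sub by (rule holomorphic_on_subset)
        fix w assume w: "w \<in> ball Z (c/2)"
        then have "\<bar>Re w - Re Z\<bar> < c/2" "\<bar>Im w - Im Z\<bar> < c/2"
          using abs_Re_le_cmod[of "w - Z"] abs_Im_le_cmod[of "w - Z"] by (auto simp: dist_norm norm_minus_commute)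
        moreover have "\<bar>Im Z\<bar> < c/2" "A + c < Re Z" using Z by (auto simp: R_def)
        ultimately have "Im (Yh w) < e" using hc(2) by (intro A(2)) linarith+
        moreover have "0 < Im (Yh w)" using lo[of w] w sub True by auto
        ultimately show "\<bar>Im (Yh w)\<bar> \<le> e" by simp
      qed (use hc e in auto)
      then show ?thesis using e by simp
    qed
    \<comment> \<open>A purely imaginary derivative of \<open>Th\<close> would have a nonpositive
      square, whereas that square is 1 plus a number of modulus at most 1/4.\<close>
    have nz: "Re (deriv Th Z) \<noteq> 0" if Z: "Z \<in> R" for Z
    proof
      assume "Re (deriv Th Z) = 0"
      then have "(deriv Th Z)\<^sup>2 = - of_real ((Im (deriv Th Z))\<^sup>2)" by (simp add: complex_eq_iff power2_eq_square)
      then have "1 + (Im (deriv Th Z))\<^sup>2 = - Re ((deriv Yh Z)\<^sup>2)"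
        using deriv_hat[of Z] RP Z by (simp add: complex_eq_iff subset_iff)
      also have "\<dots> \<le> cmod ((deriv Yh Z)\<^sup>2)" using abs_Re_le_cmod[of "(deriv Yh Z)\<^sup>2"] by linarith
      also have "\<dots> \<le> (1/2)\<^sup>2" unfolding norm_power by (intro power_mono dY Z) simp
      also have "(1/2)\<^sup>2 = (1/4::real)" by (simp add: power2_eq_square)
      finally show False using zero_le_power2[of "Im (deriv Th Z)"] by linarith
    qed
    have "connected R"
    proof -
      have "R = {Z. Im Z < c/2} \<inter> {Z. - (c/2) < Im Z} \<inter> {Z. A + c < Re Z}" by (auto simp: R_def abs_less_iff)
      then show ?thesis by (metis convex_connected convex_Int convex_halfspace_Im_lt convex_halfspace_Im_gt convex_halfspace_Re_gt)
    qed
    moreover have hdT: "deriv Th holomorphic_on P" by (rule holomorphic_deriv[OF hol_hat(2) open_P])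
    then have "continuous_on R (\<lambda>Z. Re (deriv Th Z))"
      using RP by (intro continuous_intros) (meson holomorphic_on_imp_continuous_on holomorphic_on_subset)
    ultimately have "connected ((\<lambda>Z. Re (deriv Th Z)) ` R)" by (rule connected_continuous_image[rotated])
    then have sgn: "(\<forall>Z\<in>R. Re (deriv Th Z) > 0) \<or> (\<forall>Z\<in>R. Re (deriv Th Z) < 0)"
      using nz unfolding connected_iff_interval by (smt (verit) imageE imageI)
    let ?x = "c/4"
    define \<eta> where "\<eta> y t = Re (Th (Complex t y))" for y t :: real
    have der: "(\<eta> y has_real_derivative Re (deriv Th (Complex t y))) (at t)" if "\<bar>y\<bar> < c/2" "A + c < t" for y t
    proof -
      have "Complex t y \<in> P" using that RP by (auto simp: R_def)
      from holomorphic_derivI[OF hol_hat(2) open_P this]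
      have d: "(Th has_derivative (*) (deriv Th (Complex t y))) (at (Complex t y))" by (simp add: has_field_derivative_def)
      have "((\<lambda>t. of_real t + \<i> * of_real y) has_derivative (\<lambda>u. of_real u)) (at t)" by (auto intro!: derivative_eq_intros)
      then have "((\<lambda>t. Complex t y) has_derivative (\<lambda>u. of_real u)) (at t)" by (simp add: Complex_eq)
      from diff_chain_at[OF this d] have "((\<lambda>t. Re (Th (Complex t y))) has_derivative (\<lambda>u. Re (deriv Th (Complex t y) * of_real u))) (at t)"
        by (intro has_derivative_Re) (simp add: o_def)
      then show ?thesis by (simp add: has_field_derivative_def \<eta>_def[abs_def] mult_commute_abs)
    qed
    have div: "\<exists>t1>A + c. \<forall>t>t1. M \<le> s y * \<eta> y t" if y: "y \<noteq> 0" "\<bar>y\<bar> < c/2" for y M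
    proof -
      let ?p = "Complex y (k * \<bar>y\<bar>)"
      have ab: "\<bar>y\<bar> \<le> c" using y hc by simp
      have "cmod ?p < r" using k_bound[OF ab] ab by (intro box_norm) auto
      from edge[OF y(1) this] have "eventually (\<lambda>z. M \<le> s y * Re (T (g z))) (at ?p within \<Omega>)"
        unfolding filterlim_at_top s_def by blast
      then obtain d where d: "d > 0" "\<And>z. z \<in> \<Omega> \<Longrightarrow> z \<noteq> ?p \<Longrightarrow> dist z ?p < d \<Longrightarrow> M \<le> s y * Re (T (g z))"
        unfolding eventually_at by blast
      obtain A' where A': "A' \<ge> A0" "\<And>Z. \<bar>Im Z\<bar> < c \<Longrightarrow> A' < Re Z \<Longrightarrow> Im (Yh Z) < d"
        using up[OF d(1)] True by auto
      have "M \<le> s y * \<eta> y t" if t: "max A' (A + c) + 1 < t" for t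
      proof -
        let ?Z = "Complex t y"
        have ZP: "?Z \<in> P" using t A'(1) y hc by (intro strip) auto
        define z where "z = f (X_inv ?Z)"
        have z: "z \<in> \<Omega>" "Re z = y" "Im z = Im (Yh ?Z)" "g z = X_inv ?Z"
          using f_X_inv[OF ZP] Im_Yh[OF ZP] G_subset by (auto simp: z_def)
        have "0 < Im z" "Im z < d" using lo[OF ZP] True A'(2)[of ?Z] z t y hc by auto
        moreover have "z - ?p = \<i> * of_real (Im z)" using z True by (simp add: complex_eq_iff)
        ultimately have "dist z ?p < d" "z \<noteq> ?p" using True by (auto simp: dist_norm norm_mult)
        from d(2)[OF z(1) this(2,1)] show ?thesis using z by (simp add: \<eta>_def Th_def)
      qed
      moreover have "A + c < max A' (A + c) + 1" by simp
      ultimately show ?thesis by blast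
    qed
    have s12: "s ?x = s1" "s (- ?x) = s2" using hc by (auto simp: s_def)
    \<comment> \<open>The signed height is unbounded along the line, so it cannot be decreasing. But
      \<open>Re (deriv Th Z)\<close> has the same sign on both sides of the axis, while the signs of
      the two edges differ, so one of the two sides violates this.\<close>
    have contra: False if y: "y \<noteq> 0" "\<bar>y\<bar> < c/2" and mono: "\<And>t. A + c < t \<Longrightarrow> s y * Re (deriv Th (Complex t y)) < 0" for y
    proof -
      define t0 where "t0 = A + c + 1"
      obtain t1 where t1: "t1 > A + c" "\<And>t. t > t1 \<Longrightarrow> s y * \<eta> y t0 + 1 \<le> s y * \<eta> y t" using div[OF y] by blast
      define t2 where "t2 = max t0 t1 + 1"
      have "s y * \<eta> y t2 < s y * \<eta> y t0"
      proof (rule DERIV_neg_imp_decreasing[where f = "\<lambda>t. s y * \<eta> y t"])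
        show "t0 < t2" by (simp add: t2_def)
        fix t assume t: "t0 \<le> t" "t \<le> t2"
        then have "A + c < t" by (simp add: t0_def)
        then show "\<exists>m. DERIV (\<lambda>t. s y * \<eta> y t) t :> m \<and> m < 0"
          using mono DERIV_cmult[OF der[OF y(2)]] by blast
      qed
      moreover have "t1 < t2" by (simp add: t2_def)
      ultimately show False using t1(2)[of t2] by linarith
    qed
    have RR: "Complex t y \<in> R" if "\<bar>y\<bar> < c/2" "A + c < t" for t y using that by (simp add: R_def)
    have "s1 \<noteq> s2" using signs(3) True by blast
    then have "s1 = 1 \<and> s2 = -1 \<or> s1 = -1 \<and> s2 = 1" using signs(1,2) by auto
    then show False using sgn contra[of ?x] contra[of "- ?x"] RR[of ?x] RR[of "- ?x"] hc s12 by fastforce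
  qed
qed

text \<open>A half-disk of \<open>P\<close> adjacent to the missing half-line is carried by \<open>X_inv\<close> to a region adjacent to
  the unit circle; reflecting \<open>- \<i> log X_inv\<close> shows that this region fills a neighbourhood in the unit
  disk of a point of the circle.\<close>

lemma boundary_arc:
  obtains a0 \<delta> where "cmod a0 = 1" "0 < \<delta>"
    "\<And>a. cmod a = 1 \<Longrightarrow> dist a a0 < \<delta> \<Longrightarrow> (f \<longlongrightarrow> 0) (at a within unit_disk)"
proof -
  obtain p where p: "p \<in> Q" "p \<notin> P" using half_strip_impossible by blast
  define b where "b = Re p"
  have pb: "p = of_real b" "Im p = 0" using Q_off_real[OF p(1)] p(2) by (auto simp: b_def complex_eq_iff)
  obtain R0 where R0: "R0 > 0" "ball p R0 \<subseteq> Q" using open_Q p(1) open_contains_ball by blast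
  define R where "R = R0 / 2"
  \<comment> \<open>The disk of radius \<open>R\<close> about \<open>m\<close> touches
    \<open>p\<close> from the right. Its real points lie beyond \<open>p\<close> and so outside
    \<open>P\<close>, while its other points are in \<open>Q\<close> off the axis and so in
    \<open>P\<close>.\<close>
  define m where "m = b + R"
  have R: "R > 0" using R0 by (simp add: R_def)
  have subQ: "ball (of_real m) R \<subseteq> Q"
  proof
    fix Z :: complex assume "Z \<in> ball (of_real m) R"
    moreover have "dist p Z \<le> dist p (of_real m) + dist (of_real m) Z" by (rule dist_triangle)
    moreover have "dist p (of_real m) = R" using R by (simp add: pb m_def dist_norm)
    ultimately have "dist p Z < R0" by (simp add: R_def)
    then show "Z \<in> Q" using R0 by auto
  qed
  have subP: "upper_half_ball m R \<subseteq> P"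
    using subQ Q_off_real by (force simp: upper_half_ball_def)
  have realQ: "of_real u \<in> Q" "of_real u \<notin> P" if u: "\<bar>u - m\<bar> < R" for u
  proof -
    show "of_real u \<in> Q" using subQ u by (auto simp: dist_of_real dist_real_def abs_minus_commute)
    show "of_real u \<notin> P"
    proof
      assume "of_real u \<in> P"
      moreover have "b \<le> u" using u by (auto simp: m_def)
      moreover have "\<tau> 0 < b" using p(1) pb by (simp add: Q_def)
      ultimately have "of_real b \<in> P" using P_initial[of "of_real u" "of_real b"] by simp
      then show False using p pb by simp
    qed
  qed
  have fto0: "\<exists>d>0. \<forall>Z\<in>P. dist Z (of_real u) < d \<longrightarrow> cmod (f (X_inv Z)) < e" if "\<bar>u - m\<bar> < R" "0 < e" for u e
    using boundary_limit[OF realQ[OF that(1)] that(2)] by (simp add: Complex_eq)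
  have O0: "0 \<notin> \<Omega>" using not_edge[of 0] hc by (simp add: Complex_eq)
  \<comment> \<open>The image under \<open>f\<close> of a smaller closed disk is compact and misses
    0, which is not in \<Omega>; as \<open>f (X_inv Z)\<close> tends to 0, the point
    \<open>X_inv Z\<close> must leave that disk.\<close>
  have modto1: "\<exists>d>0. \<forall>Z\<in>P. dist Z (of_real u) < d \<longrightarrow> \<rho> < cmod (X_inv Z)" if u: "\<bar>u - m\<bar> < R" and \<rho>: "\<rho> < 1" for u \<rho>
  proof -
    have sub: "cball 0 \<rho> \<subseteq> unit_disk" using \<rho> by auto
    have "compact (f ` cball 0 \<rho>)" by (rule compact_continuous_image[OF continuous_on_subset[OF cont_f sub]]) simp
    then have "closed (f ` cball 0 \<rho>)" by (rule compact_imp_closed)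
    moreover have "0 \<notin> f ` cball 0 \<rho>" using O0 sub f_image by blast
    ultimately obtain e where e: "e > 0" "\<And>y. y \<in> f ` cball 0 \<rho> \<Longrightarrow> e \<le> dist 0 y" using separate_point_closed by metis
    obtain d where d: "d > 0" "\<forall>Z\<in>P. dist Z (of_real u) < d \<longrightarrow> cmod (f (X_inv Z)) < e" using fto0[OF u e(1)] by blast
    have "\<rho> < cmod (X_inv Z)" if "Z \<in> P" "dist Z (of_real u) < d" for Z
      using d(2) e(2)[of "f (X_inv Z)"] that by (force simp: not_less)
    then show ?thesis using d(1) by blast
  qed
  obtain e0 where e0: "e0 > 0" "\<forall>Z\<in>P. dist Z (of_real m) < e0 \<longrightarrow> 1/2 < cmod (X_inv Z)"
    using modto1[of m "1/2"] R by auto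
  define e1 where "e1 = min e0 R"
  have e1: "0 < e1" "e1 \<le> e0" "e1 \<le> R" using e0 R by (auto simp: e1_def)
  let ?V = "upper_half_ball m e1"
  have VR: "?V \<subseteq> upper_half_ball m R" using e1 by (auto simp: upper_half_ball_def)
  then have VP: "?V \<subseteq> P" using subP by blast
  have nz: "X_inv Z \<noteq> 0" if "Z \<in> ?V" for Z
    using e0(2) VP that e1 by (force simp: upper_half_ball_def dist_commute)
  obtain L where L: "L holomorphic_on ?V" "\<And>Z. Z \<in> ?V \<Longrightarrow> X_inv Z = exp (L Z)"
  proof (rule contractible_imp_holomorphic_log[of X_inv ?V])
    show "X_inv holomorphic_on ?V" using hol_X_inv VP by (rule holomorphic_on_subset)
    show "contractible ?V" by (rule convex_imp_contractible[OF convex_upper_half_ball])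
  qed (use nz in auto)
  have ReL: "Re (L Z) = ln (cmod (X_inv Z))" if "Z \<in> ?V" for Z using L(2)[OF that] by simp
  have ReLneg: "Re (L Z) < 0" if "Z \<in> ?V" for Z
  proof -
    have "X_inv Z \<in> unit_disk" using X_inv_disk VP that by blast
    then show ?thesis using ReL[OF that] nz[OF that] by simp
  qed
  obtain K where K: "K holomorphic_on ball (of_real m) e1" "\<And>w. w \<in> ?V \<Longrightarrow> K w = - \<i> * L w"
    "\<And>w. w \<in> ball (of_real m) e1 \<Longrightarrow> K (cnj w) = cnj (K w)"
  proof (rule Schwarz_reflection_Im[of "\<lambda>w. - \<i> * L w" m e1])
    show "(\<lambda>w. - \<i> * L w) holomorphic_on ?V" by (intro holomorphic_intros L)
    fix u e :: real assume u: "\<bar>u - m\<bar> < e1" and e: "0 < e"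
    have "\<bar>u - m\<bar> < R" using u e1 by simp
    from modto1[OF this, of "exp (-e)"] e obtain d where d: "d > 0"
      "\<forall>Z\<in>P. dist Z (of_real u) < d \<longrightarrow> exp (-e) < cmod (X_inv Z)" by auto
    have "\<bar>Im (- \<i> * L w)\<bar> \<le> e" if w: "w \<in> ?V" "dist w (of_real u) < d" for w
    proof -
      have "exp (-e) < cmod (X_inv w)" using d(2) VP w by blast
      then have "- e < Re (L w)" unfolding ReL[OF w(1)] by (metis exp_gt_zero ln_exp ln_less_cancel_iff order_less_trans)
      then show ?thesis using ReLneg[OF w(1)] by simp
    qed
    then show "\<exists>d>0. \<forall>w\<in>?V. dist w (of_real u) < d \<longrightarrow> \<bar>Im (- \<i> * L w)\<bar> \<le> e" using d(1) by blast
  qed (use e1 in auto)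
  let ?B = "ball (of_real m :: complex) e1" let ?B' = "ball (of_real m :: complex) (e1/2)"
  have expK: "exp (\<i> * K Z) = X_inv Z" if "Z \<in> ?V" for Z using K(2)[OF that] L(2)[OF that] by simp
  have ImK: "0 < Im (K Z)" if "Z \<in> ?V" for Z using K(2)[OF that] ReLneg[OF that] by simp
  have cnjB: "cnj w \<in> ?B" if "w \<in> ?B" for w
  proof -
    have "dist (of_real m) (cnj w) = dist (of_real m) w"
      by (metis complex_cnj_complex_of_real complex_cnj_diff complex_mod_cnj dist_norm)
    then show ?thesis using that by simp
  qed
  \<comment> \<open>By symmetry \<open>K\<close> is real on the axis and has negative imaginary part
    below it. So a preimage under \<open>K\<close> of a point of the upper half-plane is a point of
    \<open>?V\<close>, where \<open>K\<close> still describes \<open>X_inv\<close>.\<close>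
  have Kpos: "0 < Im Z" if "Z \<in> ?B" "0 < Im (K Z)" for Z
  proof (rule ccontr)
    assume "\<not> 0 < Im Z"
    then consider "Im Z = 0" | "Im Z < 0" by linarith
    then show False
    proof cases
      case 1
      then have "cnj Z = Z" by (simp add: complex_eq_iff)
      then have "Im (K Z) = 0" using K(3)[OF that(1)] by (metis complex_cnj_cancel_iff cnj.simps(2) neg_equal_zero)
      then show False using that by simp
    next
      case 2
      then have "cnj Z \<in> ?V" using cnjB[OF that(1)] by (simp add: upper_half_ball_def)
      from ImK[OF this] show False using K(3)[OF that(1)] that(2) by simp
    qed
  qed
  have mm: "of_real m \<in> ?B'" using e1 by simp
  have "\<not> K constant_on ?B"
  proof
    assume "K constant_on ?B"
    then obtain y where y: "\<And>Z. Z \<in> ?B \<Longrightarrow> K Z = y" by (auto simp: constant_on_def)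
    let ?Z1 = "Complex m (e1/2)" let ?Z2 = "Complex m (e1/3)"
    have Z: "?Z1 \<in> ?V" "?Z2 \<in> ?V" using e1 by (auto simp: upper_half_ball_def dist_norm cmod_def)
    then have "X_inv ?Z1 = X_inv ?Z2" using expK y by (metis (no_types, lifting) mem_Collect_eq upper_half_ball_def)
    then have "?Z1 = ?Z2" using X_inv(2) VP Z by (metis subsetD)
    then show False using e1 by simp
  qed
  \<comment> \<open>Reflection has made \<open>m\<close> an interior point, so the image is a full
    neighbourhood of \<open>K m\<close>. In the unit disk nothing near the corresponding boundary
    point is left out.\<close>
  then have "open (K ` ?B')"
    by (rule open_mapping_thm[OF K(1) open_ball connected_ball open_ball, rotated]) (use e1 in auto)
  then obtain \<delta> where \<delta>: "\<delta> > 0" "ball (K (of_real m)) \<delta> \<subseteq> K ` ?B'"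
    using mm open_contains_ball by blast
  define \<eta> where "\<eta> = K (of_real m)"
  have eta: "Im \<eta> = 0"
  proof -
    have "K (cnj (of_real m)) = cnj \<eta>" unfolding \<eta>_def by (rule K(3)) (use e1 in simp)
    then have "\<eta> = cnj \<eta>" by (simp add: \<eta>_def)
    then show ?thesis by (simp add: complex_eq_iff)
  qed
  define a0 where "a0 = exp (\<i> * \<eta>)"
  have a0: "cmod a0 = 1" using eta by (simp add: a0_def norm_exp_eq_Re)
  then have a0n: "a0 \<noteq> 0" by auto
  \<comment> \<open>The branch of \<open>- \<i>\<close> times the logarithm with value \<eta> at
    \<open>a0\<close>; dividing by \<open>a0\<close> keeps the argument of \<open>Ln\<close> near 1,
    away from its cut.\<close>
  define \<mu> where "\<mu> w = \<eta> - \<i> * Ln (w / a0)" for w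
  have "isCont (\<lambda>w. Ln (w / a0)) a0"
    by (intro continuous_intros) (use a0n in auto)
  then obtain d1 where d1: "d1 > 0" "\<And>w. dist w a0 < d1 \<Longrightarrow> dist (Ln (w / a0)) (Ln (a0 / a0)) < \<delta>"
    using \<delta>(1) unfolding continuous_at_eps_delta by blast
  define d2 where "d2 = min d1 (1/2)"
  have d2: "d2 > 0" "d2 \<le> d1" "d2 \<le> 1/2" using d1 by (auto simp: d2_def)
  have near: "w \<noteq> 0" "w / a0 \<notin> \<real>\<^sub>\<le>\<^sub>0" "dist \<eta> (\<mu> w) < \<delta>" "exp (\<i> * \<mu> w) = w" "Im (\<mu> w) = - ln (cmod w)"
    if w: "dist w a0 < d2" for w
  proof -
    have *: "cmod (w / a0 - 1) < 1/2"
    proof -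
      have "cmod (w / a0 - 1) = cmod ((w - a0) / a0)" using a0n by (simp add: field_simps)
      then show ?thesis using w d2 a0 by (simp add: norm_divide dist_norm)
    qed
    then show w0: "w \<noteq> 0" by auto
    have "1/2 < Re (w / a0)" using * abs_Re_le_cmod[of "w/a0 - 1"] by simp
    then show "w / a0 \<notin> \<real>\<^sub>\<le>\<^sub>0" by (auto simp: complex_nonpos_Reals_iff)
    show "dist \<eta> (\<mu> w) < \<delta>" using d1(2)[of w] w d2 a0n by (simp add: \<mu>_def dist_norm norm_mult)
    have "exp (\<i> * \<mu> w) = a0 * exp (Ln (w / a0))" by (simp add: \<mu>_def a0_def exp_add[symmetric] algebra_simps)
    then show "exp (\<i> * \<mu> w) = w" using w0 a0n by simp
    show "Im (\<mu> w) = - ln (cmod w)" using eta w0 a0n a0 by (simp add: \<mu>_def norm_divide)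
  qed
  show thesis
  proof (rule that[OF a0 d2(1)])
    fix a assume a: "cmod a = 1" "dist a a0 < d2"
    show "(f \<longlongrightarrow> 0) (at a within unit_disk)"
    proof (rule tendstoI)
      fix e :: real assume e: "0 < e"
      \<comment> \<open>This set is compact, because \<open>f (X_inv Z)\<close> tends to 0 at the
        real axis and so \<open>S\<close> cannot accumulate there. On it \<open>Im (K Z)\<close> is
        positive, while \<open>\<mu> a\<close> is real, so points \<open>w\<close> near
        \<open>a\<close> come only from points \<open>Z\<close> outside \<open>S\<close>.\<close>
      define S where "S = {Z \<in> cball (of_real m) (e1/2). 0 < Im Z \<and> e \<le> cmod (f (X_inv Z))}"
      have SV: "S \<subseteq> ?V" using e1 by (auto simp: S_def upper_half_ball_def)
      have "closed S"
      proof (unfold closed_sequential_limits, intro allI impI, elim conjE)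
        fix z l assume zS: "\<forall>n. z n \<in> S" and zl: "z \<longlonglongrightarrow> l"
        have zin: "\<And>n. z n \<in> S" using zS by blast
        have lc: "l \<in> cball (of_real m) (e1/2)"
          by (rule closed_sequentially[OF closed_cball _ zl]) (use zin in \<open>auto simp: S_def\<close>)
        have "0 \<le> Im l"
        proof (rule LIMSEQ_le_const[OF tendsto_Im[OF zl]])
          show "\<exists>N. \<forall>n\<ge>N. 0 \<le> Im (z n)" using zin by (auto simp: S_def less_imp_le)
        qed
        moreover have "Im l \<noteq> 0"
        proof
          assume "Im l = 0"
          then have lr: "l = of_real (Re l)" by (simp add: complex_eq_iff)
          have "\<bar>Re l - m\<bar> < R"
            using lc e1 abs_Re_le_cmod[of "l - of_real m"] by (simp add: dist_norm norm_minus_commute)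
          from fto0[OF this e] obtain d where d: "d > 0" "\<forall>Z\<in>P. dist Z l < d \<longrightarrow> cmod (f (X_inv Z)) < e" using lr by auto
          have "eventually (\<lambda>n. dist (z n) l < d) sequentially" using zl d(1) by (rule tendstoD)
          then obtain n where n: "dist (z n) l < d" by (auto simp: eventually_sequentially)
          have "z n \<in> P" using zin SV VP by blast
          then show False using d(2) n zin[of n] by (force simp: S_def)
        qed
        ultimately have il: "0 < Im l" by simp
        then have lP: "l \<in> P" using lc e1 VP by (auto simp: upper_half_ball_def)
        have "isCont X_inv l" using hol_X_inv open_P lP by (meson continuous_on_eq_continuous_at holomorphic_on_imp_continuous_on)
        moreover have "isCont f (X_inv l)" using cont_f X_inv_disk[OF lP] continuous_on_eq_continuous_at[OF open_ball] by blast
        ultimately have "(\<lambda>n. cmod (f (X_inv (z n)))) \<longlonglongrightarrow> cmod (f (X_inv l))"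
          by (intro tendsto_norm isCont_tendsto_compose[of _ f] isCont_tendsto_compose[of _ X_inv] zl)
        then have "e \<le> cmod (f (X_inv l))" by (rule LIMSEQ_le_const) (use zin in \<open>auto simp: S_def\<close>)
        then show "l \<in> S" using lc il by (simp add: S_def)
      qed
      moreover have "bounded S"
        by (rule bounded_subset[OF bounded_cball[of "of_real m" "e1/2"]]) (auto simp: S_def)
      ultimately have "compact S" by (simp add: compact_eq_bounded_closed)
      moreover have "continuous_on S K"
        using K(1) SV by (intro holomorphic_on_imp_continuous_on holomorphic_on_subset[OF K(1)]) (auto simp: upper_half_ball_def)
      ultimately have "closed (K ` S)" by (intro compact_imp_closed compact_continuous_image)
      moreover have "\<mu> a \<notin> K ` S" using ImK SV near(5)[OF a(2)] a(1) by (force simp: subset_iff)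
      ultimately obtain d3 where d3: "d3 > 0" "\<And>y. y \<in> K ` S \<Longrightarrow> d3 \<le> dist (\<mu> a) y" using separate_point_closed by metis
      have "isCont \<mu> a" unfolding \<mu>_def by (intro continuous_intros) (use near(2)[OF a(2)] a0n in auto)
      then obtain d4 where d4: "d4 > 0" "\<And>w. dist w a < d4 \<Longrightarrow> dist (\<mu> w) (\<mu> a) < d3"
        using d3(1) unfolding continuous_at_eps_delta by blast
      have "dist (f w) 0 < e" if w: "w \<in> unit_disk" "dist w a < min d4 (d2 - dist a a0)" for w
      proof -
        have wa: "dist w a0 < d2" using w dist_triangle[of w a0 a] by simp
        have "\<mu> w \<in> ball \<eta> \<delta>" using near(3)[OF wa] by simp
        then obtain Z where Z: "Z \<in> ?B'" "K Z = \<mu> w" using \<delta>(2) unfolding \<eta>_def by (metis imageE subsetD)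
        have "0 < Im (K Z)" using near(1,5)[OF wa] w Z by simp
        moreover have "Z \<in> ?B" using Z(1) e1 by simp
        ultimately have iZ: "0 < Im Z" by (rule Kpos[rotated])
        then have ZV: "Z \<in> ?V" using Z e1 by (auto simp: upper_half_ball_def)
        have "Z \<notin> S" using d3(2)[of "K Z"] d4(2)[of w] w Z by (force simp: dist_commute)
        then have "cmod (f (X_inv Z)) < e" using Z iZ by (auto simp: S_def)
        then show ?thesis using expK[OF ZV] near(4)[OF wa] Z by simp
      qed
      then show "eventually (\<lambda>w. dist (f w) 0 < e) (at a within unit_disk)"
        unfolding eventually_at using d4(1) a(2) by (intro exI[of _ "min d4 (d2 - dist a a0)"]) auto
    qed
  qed
qed

end

section \<open>Holomorphic representation of the graph\<close>

lemma pd_eq: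
  assumes "(g has_derivative D) (at z)"
  shows "pdx g z = D 1" "pdy g z = D \<i>"
  using frechet_derivative_at[OF assms] by (simp_all add: pdx_def pdy_def)

lemma has_derivative_pd:
  fixes g :: "complex \<Rightarrow> 'a::real_normed_vector"
  assumes "g differentiable (at z)"
  shows "(g has_derivative (\<lambda>h. Re h *\<^sub>R pdx g z + Im h *\<^sub>R pdy g z)) (at z)"
proof -
  obtain D where D: "(g has_derivative D) (at z)" using assms by (auto simp: differentiable_def)
  have lin: "linear D" using D by (rule has_derivative_linear)
  have "D h = Re h *\<^sub>R D 1 + Im h *\<^sub>R D \<i>" for h
  proof -
    have "h = Re h *\<^sub>R 1 + Im h *\<^sub>R \<i>" by (simp add: complex_eq_iff)
    then have "D h = D (Re h *\<^sub>R 1 + Im h *\<^sub>R \<i>)" by simp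
    then show ?thesis by (simp only: linear_add[OF lin] linear_scale[OF lin])
  qed
  then have "D = (\<lambda>h. Re h *\<^sub>R pdx g z + Im h *\<^sub>R pdy g z)" unfolding pd_eq[OF D] by (rule ext)
  then show ?thesis using D by simp
qed

lemma DERIV_pdx:
  fixes g :: "complex \<Rightarrow> real"
  assumes "g differentiable (at (Complex x y))"
  shows "((\<lambda>x. g (Complex x y)) has_real_derivative pdx g (Complex x y)) (at x)"
    "((\<lambda>y. g (Complex x y)) has_real_derivative pdy g (Complex x y)) (at y)"
proof -
  have "((\<lambda>x. of_real x + \<i> * of_real y) has_derivative (\<lambda>u. of_real u)) (at x)"
    "((\<lambda>y. of_real x + \<i> * of_real y) has_derivative (\<lambda>u. \<i> * of_real u)) (at y)"
    by (auto intro!: derivative_eq_intros)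
  then have c: "((\<lambda>x. Complex x y) has_derivative (\<lambda>u. of_real u)) (at x)"
    "((\<lambda>y. Complex x y) has_derivative (\<lambda>u. \<i> * of_real u)) (at y)" by (simp_all add: Complex_eq)
  show "((\<lambda>x. g (Complex x y)) has_real_derivative pdx g (Complex x y)) (at x)"
    using diff_chain_at[OF c(1) has_derivative_pd[OF assms]]
    by (simp add: o_def has_field_derivative_def mult_commute_abs)
  show "((\<lambda>y. g (Complex x y)) has_real_derivative pdy g (Complex x y)) (at y)"
    using diff_chain_at[OF c(2) has_derivative_pd[OF assms]]
    by (simp add: o_def has_field_derivative_def mult_commute_abs)
qed

text \<open>The second difference of \<open>g\<close> over a small square is evaluated by the mean
  value theorem in both orders. It gives a value of each mixed derivative at some point of the
  square, and continuity brings both to \<open>z\<close>.\<close>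

lemma mixed_partials_real:
  fixes g :: "complex \<Rightarrow> real"
  assumes S: "open S" and g: "C2_on S g" and z: "z \<in> S"
  shows "pdy (pdx g) z = pdx (pdy g) z"
proof (rule ccontr)
  assume ne: "\<not> ?thesis"
  have dg: "g differentiable (at w)" "pdx g differentiable (at w)" "pdy g differentiable (at w)" if "w \<in> S" for w
    using g that by (auto simp: C2_on_def C1_on_def)
  have cont: "isCont (pdy (pdx g)) z" "isCont (pdx (pdy g)) z"
    using g z S by (auto simp: C2_on_def C1_on_def continuous_on_eq_continuous_at)
  define e where "e = dist (pdy (pdx g) z) (pdx (pdy g) z) / 2"
  have e: "e > 0" using ne by (simp add: e_def)
  obtain d1 where d1: "d1 > 0" "\<And>w. dist w z < d1 \<Longrightarrow> dist (pdy (pdx g) w) (pdy (pdx g) z) < e"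
    using cont(1) e unfolding continuous_at_eps_delta by blast
  obtain d2 where d2: "d2 > 0" "\<And>w. dist w z < d2 \<Longrightarrow> dist (pdx (pdy g) w) (pdx (pdy g) z) < e"
    using cont(2) e unfolding continuous_at_eps_delta by blast
  obtain d3 where d3: "d3 > 0" "ball z d3 \<subseteq> S" using S z open_contains_ball by blast
  define h where "h = Min {d1, d2, d3} / 3"
  have h: "0 < h" "3 * h \<le> d1" "3 * h \<le> d2" "3 * h \<le> d3" using d1 d2 d3 by (auto simp: h_def)
  define x y where "x = Re z" and "y = Im z"
  have near: "dist (Complex s t) z < 3 * h" if "x \<le> s" "s \<le> x + h" "y \<le> t" "t \<le> y + h" for s t
  proof -
    have "dist (Complex s t) z \<le> \<bar>s - x\<bar> + \<bar>t - y\<bar>"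
      using cmod_le[of "Complex s t - z"] by (simp add: dist_norm x_def y_def)
    then show ?thesis using that h(1) by linarith
  qed
  have inS: "Complex s t \<in> S" if "x \<le> s" "s \<le> x + h" "y \<le> t" "t \<le> y + h" for s t
    using near[OF that] d3(2) h by (auto simp: dist_commute)
  define \<Delta> where "\<Delta> = (g (Complex (x+h) (y+h)) - g (Complex (x+h) y)) - (g (Complex x (y+h)) - g (Complex x y))"
  have "\<exists>s>x. s < x + h \<and> (g (Complex (x+h) (y+h)) - g (Complex (x+h) y)) - (g (Complex x (y+h)) - g (Complex x y))
      = (x + h - x) * (pdx g (Complex s (y+h)) - pdx g (Complex s y))"
    by (rule MVT2) (use h in \<open>auto intro!: DERIV_diff DERIV_pdx dg inS\<close>)
  then obtain s where s: "x < s" "s < x + h" "\<Delta> = h * (pdx g (Complex s (y+h)) - pdx g (Complex s y))"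
    by (auto simp: \<Delta>_def)
  have "\<exists>t>y. t < y + h \<and> pdx g (Complex s (y+h)) - pdx g (Complex s y) = (y + h - y) * pdy (pdx g) (Complex s t)"
    by (rule MVT2) (use h s in \<open>auto intro!: DERIV_pdx dg inS\<close>)
  then obtain t where t: "y < t" "t < y + h" "\<Delta> = h * (h * pdy (pdx g) (Complex s t))" using s(3) by auto
  have "\<exists>t>y. t < y + h \<and> (g (Complex (x+h) (y+h)) - g (Complex x (y+h))) - (g (Complex (x+h) y) - g (Complex x y))
      = (y + h - y) * (pdy g (Complex (x+h) t) - pdy g (Complex x t))"
    by (rule MVT2) (use h in \<open>auto intro!: DERIV_diff DERIV_pdx dg inS\<close>)
  then obtain t' where t': "y < t'" "t' < y + h" "\<Delta> = h * (pdy g (Complex (x+h) t') - pdy g (Complex x t'))"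
    by (auto simp: \<Delta>_def)
  have "\<exists>s>x. s < x + h \<and> pdy g (Complex (x+h) t') - pdy g (Complex x t') = (x + h - x) * pdx (pdy g) (Complex s t')"
    by (rule MVT2) (use h t' in \<open>auto intro!: DERIV_pdx dg inS\<close>)
  then obtain s' where s': "x < s'" "s' < x + h" "\<Delta> = h * (h * pdx (pdy g) (Complex s' t'))" using t'(3) by auto
  have eq: "pdy (pdx g) (Complex s t) = pdx (pdy g) (Complex s' t')" using t(3) s'(3) h(1) by simp
  have "dist (pdy (pdx g) (Complex s t)) (pdy (pdx g) z) < e" using near[of s t] s t h by (intro d1(2)) simp
  moreover have "dist (pdx (pdy g) (Complex s' t')) (pdx (pdy g) z) < e" using near[of s' t'] s' t' h by (intro d2(2)) simp
  ultimately have "dist (pdy (pdx g) z) (pdx (pdy g) z) < 2 * e"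
    using eq dist_triangle3[of "pdy (pdx g) z" "pdx (pdy g) z" "pdy (pdx g) (Complex s t)"] by simp
  then show False by (simp add: e_def)
qed

text \<open>The function with real part \<open>pdy u\<close> and imaginary part \<open>pdx u\<close>
  satisfies the Cauchy-Riemann equations: one is the Laplace equation, the other the symmetry of the
  mixed derivatives. The imaginary part of its primitive has the same gradient as \<open>u\<close>,
  hence differs from \<open>u\<close> by a constant.\<close>

lemma harmonic_imp_Im_holomorphic:
  fixes u :: "complex \<Rightarrow> real"
  assumes S: "open S" "convex S" and u: "harmonic_on S u"
  obtains X where "X holomorphic_on S" "\<And>w. w \<in> S \<Longrightarrow> Im (X w) = u w"
    "\<And>w. w \<in> S \<Longrightarrow> deriv X w = Complex (pdy u w) (pdx u w)"
proof -
  have C2: "C2_on S u" using u by (simp add: harmonic_on_def)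
  define p where "p w = Complex (pdy u w) (pdx u w)" for w
  have dp: "(p has_field_derivative Complex (pdx (pdy u) w) (pdx (pdx u) w)) (at w)" if w: "w \<in> S" for w
  proof -
    have d: "pdx u differentiable (at w)" "pdy u differentiable (at w)" using C2 w by (auto simp: C2_on_def C1_on_def)
    have lap: "pdy (pdy u) w = - pdx (pdx u) w" using u w by (auto simp: harmonic_on_def)
    have "((\<lambda>w. of_real (pdy u w) + \<i> * of_real (pdx u w)) has_derivative
      (\<lambda>h. of_real (Re h *\<^sub>R pdx (pdy u) w + Im h *\<^sub>R pdy (pdy u) w) + \<i> * of_real (Re h *\<^sub>R pdx (pdx u) w + Im h *\<^sub>R pdy (pdx u) w))) (at w)"
      by (intro has_derivative_add has_derivative_mult_right has_derivative_of_real has_derivative_pd d)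
    moreover have "(\<lambda>h. of_real (Re h *\<^sub>R pdx (pdy u) w + Im h *\<^sub>R pdy (pdy u) w) + \<i> * of_real (Re h *\<^sub>R pdx (pdx u) w + Im h *\<^sub>R pdy (pdx u) w))
      = (*) (Complex (pdx (pdy u) w) (pdx (pdx u) w))"
      unfolding lap mixed_partials_real[OF S(1) C2 w] by (auto simp: fun_eq_iff complex_eq_iff)
    ultimately show ?thesis by (simp add: has_field_derivative_def p_def[abs_def] Complex_eq)
  qed
  then have "p holomorphic_on S" using S(1) by (auto simp: holomorphic_on_open)
  then obtain X0 where "\<forall>w\<in>S. (X0 has_field_derivative p w) (at w within S)"
  proof (rule holomorphic_convex_primitive'[OF S(2,1)])
    fix g assume "\<And>w. w \<in> S \<Longrightarrow> (g has_field_derivative p w) (at w within S)"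
    then show thesis by (intro that[of g]) simp
  qed
  then have X0: "\<And>w. w \<in> S \<Longrightarrow> (X0 has_field_derivative p w) (at w within S)" by simp
  have X0': "(X0 has_field_derivative p w) (at w)" if "w \<in> S" for w
    using X0[OF that] at_within_open[OF that S(1)] by simp
  have "\<exists>c. \<forall>w\<in>S. Im (X0 w) - u w = c"
  proof (rule has_derivative_zero_constant[OF S(2)])
    fix w assume w: "w \<in> S"
    have "u differentiable (at w)" using C2 w by (auto simp: C2_on_def C1_on_def)
    from has_derivative_pd[OF this] has_derivative_Im[OF X0'[OF w, unfolded has_field_derivative_def]]
    have "((\<lambda>w. Im (X0 w) - u w) has_derivative (\<lambda>h. Im (p w * h) - (Re h *\<^sub>R pdx u w + Im h *\<^sub>R pdy u w))) (at w)"
      by (rule has_derivative_diff[rotated])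
    then show "((\<lambda>w. Im (X0 w) - u w) has_derivative (\<lambda>h. 0)) (at w within S)"
      by (auto simp: p_def algebra_simps intro: has_derivative_at_withinI)
  qed
  then obtain c where c: "\<And>w. w \<in> S \<Longrightarrow> Im (X0 w) - u w = c" by blast
  have d: "((\<lambda>w. X0 w - \<i> * of_real c) has_field_derivative p w) (at w)" if "w \<in> S" for w
    using X0'[OF that] by (auto intro!: derivative_eq_intros)
  show thesis
  proof (rule that[of "\<lambda>w. X0 w - \<i> * of_real c"])
    show "(\<lambda>w. X0 w - \<i> * of_real c) holomorphic_on S" using d S(1) by (auto simp: holomorphic_on_open)
    show "deriv (\<lambda>w. X0 w - \<i> * of_real c) w = Complex (pdy u w) (pdx u w)" if "w \<in> S" for w
      using DERIV_imp_deriv[OF d[OF that]] by (simp add: p_def)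
    show "Im (X0 w - \<i> * of_real c) = u w" if "w \<in> S" for w using c[OF that] by simp
  qed
qed

section \<open>Linear maps applied to differentiable and harmonic functions\<close>

lemma pd_bounded_linear:
  assumes "bounded_linear L" "g differentiable (at z)"
  shows "pdx (\<lambda>w. L (g w)) z = L (pdx g z)" "pdy (\<lambda>w. L (g w)) z = L (pdy g z)"
    "(\<lambda>w. L (g w)) differentiable (at z)"
proof -
  have "((\<lambda>w. L (g w)) has_derivative (\<lambda>h. L (Re h *\<^sub>R pdx g z + Im h *\<^sub>R pdy g z))) (at z)"
    by (rule bounded_linear.has_derivative[OF assms(1) has_derivative_pd[OF assms(2)]])
  then show "pdx (\<lambda>w. L (g w)) z = L (pdx g z)" "pdy (\<lambda>w. L (g w)) z = L (pdy g z)"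
    "(\<lambda>w. L (g w)) differentiable (at z)"
    using pd_eq by (force simp: differentiable_def)+
qed

lemma pd_cong_open:
  assumes "open S" "z \<in> S" "\<And>w. w \<in> S \<Longrightarrow> g w = h w"
  shows "pdx g z = pdx h z" "pdy g z = pdy h z"
    "g differentiable (at z) \<longleftrightarrow> h differentiable (at z)"
proof -
  have *: "(g has_derivative D) (at z) \<longleftrightarrow> (h has_derivative D) (at z)" for D
    using assms by (metis has_derivative_transform_within_open)
  then show "pdx g z = pdx h z" "pdy g z = pdy h z" "g differentiable (at z) \<longleftrightarrow> h differentiable (at z)"
    by (simp_all add: pdx_def pdy_def frechet_derivative_def differentiable_def)
qed

lemma C1_on_cong:
  assumes S: "open S" and eq: "\<And>w. w \<in> S \<Longrightarrow> g w = h w"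
  shows "C1_on S g \<longleftrightarrow> C1_on S h"
proof -
  have e: "pdx g z = pdx h z" "pdy g z = pdy h z" "g differentiable (at z) \<longleftrightarrow> h differentiable (at z)"
    if "z \<in> S" for z
    using pd_cong_open[OF S that, of g h] eq by auto
  have "continuous_on S (pdx g) \<longleftrightarrow> continuous_on S (pdx h)" "continuous_on S (pdy g) \<longleftrightarrow> continuous_on S (pdy h)"
    by (rule continuous_on_cong[OF refl e(1)], assumption) (rule continuous_on_cong[OF refl e(2)], assumption)
  then show ?thesis using e(3) by (simp add: C1_on_def)
qed

lemma C1_on_bounded_linear:
  assumes S: "open S" and L: "bounded_linear L" and g: "C1_on S g"
  shows "C1_on S (\<lambda>w. L (g w))"
proof -
  have d: "g differentiable (at z)" if "z \<in> S" for z using g that by (simp add: C1_on_def)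
  have "continuous_on S (\<lambda>z. L (pdx g z))" "continuous_on S (\<lambda>z. L (pdy g z))"
    using g by (auto simp: C1_on_def intro: bounded_linear.continuous_on[OF L])
  moreover have "continuous_on S (pdx (\<lambda>w. L (g w))) \<longleftrightarrow> continuous_on S (\<lambda>z. L (pdx g z))"
    by (rule continuous_on_cong[OF refl pd_bounded_linear(1)[OF L d]])
  moreover have "continuous_on S (pdy (\<lambda>w. L (g w))) \<longleftrightarrow> continuous_on S (\<lambda>z. L (pdy g z))"
    by (rule continuous_on_cong[OF refl pd_bounded_linear(2)[OF L d]])
  ultimately show ?thesis using pd_bounded_linear(3)[OF L d] by (simp add: C1_on_def)
qed

lemma harmonic_on_bounded_linear:
  assumes S: "open S" and L: "bounded_linear L" and g: "harmonic_on S g"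
  shows "harmonic_on S (\<lambda>w. L (g w))"
proof -
  have C: "C1_on S g" "C1_on S (pdx g)" "C1_on S (pdy g)" using g by (auto simp: harmonic_on_def C2_on_def)
  have e: "pdx (\<lambda>w. L (g w)) z = L (pdx g z)" "pdy (\<lambda>w. L (g w)) z = L (pdy g z)" if "z \<in> S" for z
    using pd_bounded_linear[OF L] C(1) that by (auto simp: C1_on_def)
  have "C1_on S (pdx (\<lambda>w. L (g w)))" "C1_on S (pdy (\<lambda>w. L (g w)))"
    using C1_on_cong[OF S e(1)] C1_on_cong[OF S e(2)] C1_on_bounded_linear[OF S L] C by auto
  moreover have "pdx (pdx (\<lambda>w. L (g w))) z + pdy (pdy (\<lambda>w. L (g w))) z = 0" if z: "z \<in> S" for z
  proof -
    have "pdx (pdx (\<lambda>w. L (g w))) z = L (pdx (pdx g) z)" "pdy (pdy (\<lambda>w. L (g w))) z = L (pdy (pdy g) z)"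
      using pd_cong_open[OF S z e(1)] pd_cong_open[OF S z e(2)] pd_bounded_linear[OF L] C z by (auto simp: C1_on_def)
    moreover have "pdx (pdx g) z + pdy (pdy g) z = 0" using g z by (simp add: harmonic_on_def)
    ultimately show ?thesis by (metis linear_add linear_0 bounded_linear.linear[OF L])
  qed
  ultimately show ?thesis using C1_on_bounded_linear[OF S L C(1)] by (simp add: harmonic_on_def C2_on_def)
qed

text \<open>On the tangent plane of the graph of \<open>\<phi>\<close>, spanned by the orthogonal vectors \<open>A = (a, P a\<^sub>1 + Q a\<^sub>2)\<close> and
  \<open>B\<close> of equal length, the rotation by a right angle is the cross product with the unit normal. Comparing third
  coordinates turns the dual differential into the Cauchy-Riemann equations.\<close>

lemma dual_Cauchy_Riemann:
  fixes a1 a2 b1 b2 P Q :: real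
  defines "tu \<equiv> P * a1 + Q * a2" and "tv \<equiv> P * b1 + Q * b2" and "W \<equiv> sqrt (1 + (P\<^sup>2 + Q\<^sup>2))"
  assumes eq: "a1\<^sup>2 + a2\<^sup>2 + tu\<^sup>2 = b1\<^sup>2 + b2\<^sup>2 + tv\<^sup>2" and orth: "a1 * b1 + a2 * b2 + tu * tv = 0"
    and J: "0 < a1 * b2 - a2 * b1"
  shows "- (Q / W) * a1 + (P / W) * a2 = - tv" "- (Q / W) * b1 + (P / W) * b2 = tu"
proof -
  define j where "j = a1 * b2 - a2 * b1"
  define l where "l = a1\<^sup>2 + a2\<^sup>2 + tu\<^sup>2"
  have pos: "0 < 1 + (P\<^sup>2 + Q\<^sup>2)" by (intro add_pos_nonneg) auto
  have W: "0 < W" "W\<^sup>2 = 1 + (P\<^sup>2 + Q\<^sup>2)" using pos by (simp_all add: W_def)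
  \<comment> \<open>Lagrange's identity for the cross product \<open>j * (- P, - Q, 1)\<close> of
    \<open>A\<close> and \<open>B\<close>. With equal lengths and orthogonality it makes the common
    squared length equal to \<open>j * W\<close>.\<close>
  have "(a1\<^sup>2 + a2\<^sup>2 + tu\<^sup>2) * (b1\<^sup>2 + b2\<^sup>2 + tv\<^sup>2) - (a1 * b1 + a2 * b2 + tu * tv)\<^sup>2 = j\<^sup>2 * (1 + (P\<^sup>2 + Q\<^sup>2))"
    unfolding tu_def tv_def j_def by algebra
  then have "l\<^sup>2 = (j * W)\<^sup>2" using eq orth W by (simp add: l_def power_mult_distrib power2_eq_square)
  moreover have "0 \<le> l" by (simp add: l_def)
  moreover have "0 \<le> j * W" using J W by (simp add: j_def)
  ultimately have l: "l = j * W" by (rule power2_eq_imp_eq)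
  have j: "j \<noteq> 0" using J by (simp add: j_def)
  \<comment> \<open>Up to sign, the third coordinate of the triple product of \<open>A\<close>,
    \<open>A\<close> and \<open>B\<close>, expanded in two ways.\<close>
  have "j * (Q * a1 - P * a2) = tv * (a1\<^sup>2 + a2\<^sup>2 + tu\<^sup>2) - tu * (a1 * b1 + a2 * b2 + tu * tv)"
    unfolding tu_def tv_def j_def by algebra
  then have "j * (Q * a1 - P * a2) = j * (tv * W)" using orth l by (simp add: l_def mult.commute mult.left_commute)
  then have "Q * a1 - P * a2 = tv * W" using j by simp
  then show "- (Q / W) * a1 + (P / W) * a2 = - tv" using W by (simp add: field_simps)
  have "j * (Q * b1 - P * b2) = tv * (a1 * b1 + a2 * b2 + tu * tv) - tu * (b1\<^sup>2 + b2\<^sup>2 + tv\<^sup>2)"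
    unfolding tu_def tv_def j_def by algebra
  then have "j * (Q * b1 - P * b2) = j * (- tu * W)" using orth l eq by (simp add: l_def mult.commute mult.left_commute)
  then have "Q * b1 - P * b2 = - tu * W" using j by (metis mult_cancel_left)
  then show "- (Q / W) * b1 + (P / W) * b2 = tu" using W by (simp add: field_simps)
qed

text \<open>The duality makes \<open>\<phi> (f w)\<close> and \<open>\<psi> (f w)\<close> conjugate,
  so the derivative of their holomorphic combination is \<open>tu - \<i> * tv\<close>. The
  derivatives of \<open>X1\<close> and \<open>X2\<close> carry an additional factor
  \<open>\<i>\<close>, because the coordinates are imaginary parts; this factor moves the third
  square of the isothermality condition to the other side.\<close>

lemma Weierstrass_data:
  assumes min: "minimal_surface_solution \<Omega> \<phi>" and dual: "dual_solution \<Omega> \<phi> \<psi>"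
    and f: "corresponding_harmonic_map \<Omega> \<phi> f"
  obtains X1 X2 where "X1 holomorphic_on unit_disk" "X2 holomorphic_on unit_disk"
    "(\<lambda>w. Complex (\<phi> (f w)) (\<psi> (f w))) holomorphic_on unit_disk"
    "\<And>w. w \<in> unit_disk \<Longrightarrow> Im (X1 w) = Re (f w)" "\<And>w. w \<in> unit_disk \<Longrightarrow> Im (X2 w) = Im (f w)"
    "\<And>w. w \<in> unit_disk \<Longrightarrow> (deriv X1 w)\<^sup>2 + (deriv X2 w)\<^sup>2 = (deriv (\<lambda>w. Complex (\<phi> (f w)) (\<psi> (f w))) w)\<^sup>2"
    "\<And>w. w \<in> unit_disk \<Longrightarrow> 0 < Im (deriv X1 w * cnj (deriv X2 w))"
proof -
  let ?T = "\<lambda>w. Complex (\<phi> (f w)) (\<psi> (f w))"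
  have harm: "harmonic_on unit_disk f" and bij: "bij_betw f unit_disk \<Omega>"
    and jac: "\<And>w. w \<in> unit_disk \<Longrightarrow> Re (pdx f w) * Im (pdy f w) - Im (pdx f w) * Re (pdy f w) > 0"
    and iso: "isothermal_param unit_disk (\<lambda>w. (f w, \<phi> (f w)))"
    using f by (auto simp: corresponding_harmonic_map_def)
  obtain X1 where X1: "X1 holomorphic_on unit_disk" "\<And>w. w \<in> unit_disk \<Longrightarrow> Im (X1 w) = Re (f w)"
    "\<And>w. w \<in> unit_disk \<Longrightarrow> deriv X1 w = Complex (pdy (\<lambda>w. Re (f w)) w) (pdx (\<lambda>w. Re (f w)) w)"
    using harmonic_imp_Im_holomorphic[OF open_ball convex_ball harmonic_on_bounded_linear[OF open_ball bounded_linear_Re harm]] by metis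
  obtain X2 where X2: "X2 holomorphic_on unit_disk" "\<And>w. w \<in> unit_disk \<Longrightarrow> Im (X2 w) = Im (f w)"
    "\<And>w. w \<in> unit_disk \<Longrightarrow> deriv X2 w = Complex (pdy (\<lambda>w. Im (f w)) w) (pdx (\<lambda>w. Im (f w)) w)"
    using harmonic_imp_Im_holomorphic[OF open_ball convex_ball harmonic_on_bounded_linear[OF open_ball bounded_linear_Im harm]] by metis
  have df: "f differentiable (at w)" if "w \<in> unit_disk" for w
    using harm that by (auto simp: harmonic_on_def C2_on_def C1_on_def)
  have d1: "deriv X1 w = Complex (Re (pdy f w)) (Re (pdx f w))" "deriv X2 w = Complex (Im (pdy f w)) (Im (pdx f w))"
    if "w \<in> unit_disk" for w
    using X1(3)[OF that] X2(3)[OF that] pd_bounded_linear[OF bounded_linear_Re df[OF that]]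
      pd_bounded_linear[OF bounded_linear_Im df[OF that]] by simp_all
  have T: "(?T has_field_derivative Complex tu (- tv)) (at w) \<and>
      (Re (pdx f w))\<^sup>2 + (Im (pdx f w))\<^sup>2 + tu\<^sup>2 = (Re (pdy f w))\<^sup>2 + (Im (pdy f w))\<^sup>2 + tv\<^sup>2 \<and>
      Re (pdx f w) * Re (pdy f w) + Im (pdx f w) * Im (pdy f w) + tu * tv = 0"
    if w: "w \<in> unit_disk" and tu: "tu = pdx \<phi> (f w) * Re (pdx f w) + pdy \<phi> (f w) * Im (pdx f w)"
      and tv: "tv = pdx \<phi> (f w) * Re (pdy f w) + pdy \<phi> (f w) * Im (pdy f w)" for w tu tv
  proof -
    define P Q a b where "P = pdx \<phi> (f w)" and "Q = pdy \<phi> (f w)" and "a = pdx f w" and "b = pdy f w"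
    have fw: "f w \<in> \<Omega>" using bij w by (auto simp: bij_betw_def)
    have dphi: "\<phi> differentiable (at (f w))" using min fw by (auto simp: minimal_surface_solution_def C2_on_def C1_on_def)
    have Df: "(f has_derivative (\<lambda>h. Re h *\<^sub>R a + Im h *\<^sub>R b)) (at w)"
      unfolding a_def b_def by (rule has_derivative_pd[OF df[OF w]])
    from diff_chain_at[OF Df has_derivative_pd[OF dphi]]
    have "((\<lambda>w. \<phi> (f w)) has_derivative (\<lambda>h. Re (Re h *\<^sub>R a + Im h *\<^sub>R b) * P + Im (Re h *\<^sub>R a + Im h *\<^sub>R b) * Q)) (at w)"
      by (simp add: o_def P_def Q_def)
    also have "(\<lambda>h. Re (Re h *\<^sub>R a + Im h *\<^sub>R b) * P + Im (Re h *\<^sub>R a + Im h *\<^sub>R b) * Q) = (\<lambda>h. Re h * tu + Im h * tv)"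
      by (simp add: fun_eq_iff tu tv a_def b_def P_def Q_def algebra_simps)
    finally have Dt: "((\<lambda>w. \<phi> (f w)) has_derivative (\<lambda>h. Re h * tu + Im h * tv)) (at w)" .
    have "((\<lambda>w. (f w, \<phi> (f w))) has_derivative (\<lambda>h. (Re h *\<^sub>R a + Im h *\<^sub>R b, Re h * tu + Im h * tv))) (at w)"
      by (rule has_derivative_Pair[OF Df Dt])
    from pd_eq[OF this] have pd: "pdx (\<lambda>w. (f w, \<phi> (f w))) w = (a, tu)" "pdy (\<lambda>w. (f w, \<phi> (f w))) w = (b, tv)" by simp_all
    have "(a, tu) \<bullet> (a, tu) = (b, tv) \<bullet> (b, tv) \<and> (a, tu) \<bullet> (b, tv) = 0"
      using iso w unfolding isothermal_param_def pd[symmetric] by blast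
    then have i: "(Re a)\<^sup>2 + (Im a)\<^sup>2 + tu\<^sup>2 = (Re b)\<^sup>2 + (Im b)\<^sup>2 + tv\<^sup>2"
      "Re a * Re b + Im a * Im b + tu * tv = 0"
      by (auto simp: inner_complex_def power2_eq_square)
    have J: "0 < Re a * Im b - Im a * Re b" using jac[OF w] by (simp add: a_def b_def)
    define W where "W = sqrt (1 + (P\<^sup>2 + Q\<^sup>2))"
    have CR: "- (Q / W) * Re a + (P / W) * Im a = - tv" "- (Q / W) * Re b + (P / W) * Im b = tu"
      using dual_Cauchy_Riemann[of "Re a" "Im a" P Q "Re b" "Im b"] i J
      by (simp_all add: tu tv W_def P_def Q_def a_def b_def)
    have "(\<psi> has_derivative (\<lambda>h. - (Q / W) * Re h + (P / W) * Im h)) (at (f w))"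
      using dual fw by (simp add: dual_solution_def W_def P_def Q_def grad_sq_def)
    from diff_chain_at[OF Df this]
    have "((\<lambda>w. \<psi> (f w)) has_derivative (\<lambda>h. - (Q / W) * Re (Re h *\<^sub>R a + Im h *\<^sub>R b) + (P / W) * Im (Re h *\<^sub>R a + Im h *\<^sub>R b))) (at w)"
      by (simp add: o_def)
    also have "(\<lambda>h. - (Q / W) * Re (Re h *\<^sub>R a + Im h *\<^sub>R b) + (P / W) * Im (Re h *\<^sub>R a + Im h *\<^sub>R b))
      = (\<lambda>h. Re h * (- (Q / W) * Re a + (P / W) * Im a) + Im h * (- (Q / W) * Re b + (P / W) * Im b))"
      by (simp add: fun_eq_iff algebra_simps)
    finally have Dv: "((\<lambda>w. \<psi> (f w)) has_derivative (\<lambda>h. Re h * (- tv) + Im h * tu)) (at w)" unfolding CR .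
    have "((\<lambda>w. of_real (\<phi> (f w)) + \<i> * of_real (\<psi> (f w))) has_derivative
        (\<lambda>h. of_real (Re h * tu + Im h * tv) + \<i> * of_real (Re h * (- tv) + Im h * tu))) (at w)"
      by (intro has_derivative_add has_derivative_mult_right has_derivative_of_real Dt Dv)
    also have "(\<lambda>h. of_real (Re h * tu + Im h * tv) + \<i> * of_real (Re h * (- tv) + Im h * tu)) = (*) (Complex tu (- tv))"
      by (auto simp: fun_eq_iff complex_eq_iff)
    finally have "(?T has_field_derivative Complex tu (- tv)) (at w)" by (simp add: has_field_derivative_def Complex_eq)
    then show ?thesis using i by (simp add: a_def b_def)
  qed
  show thesis
  proof (rule that[OF X1(1) X2(1)])
    show "?T holomorphic_on unit_disk"
      unfolding holomorphic_on_open[OF open_ball] using T[OF _ refl refl] by blast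
    fix w assume w: "w \<in> unit_disk"
    show "Im (X1 w) = Re (f w)" "Im (X2 w) = Im (f w)" using X1(2)[OF w] X2(2)[OF w] .
    from T[OF w refl refl] obtain tu tv where t: "(?T has_field_derivative Complex tu (- tv)) (at w)"
      "(Re (pdx f w))\<^sup>2 + (Im (pdx f w))\<^sup>2 + tu\<^sup>2 = (Re (pdy f w))\<^sup>2 + (Im (pdy f w))\<^sup>2 + tv\<^sup>2"
      "Re (pdx f w) * Re (pdy f w) + Im (pdx f w) * Im (pdy f w) + tu * tv = 0" by blast
    show "(deriv X1 w)\<^sup>2 + (deriv X2 w)\<^sup>2 = (deriv ?T w)\<^sup>2"
      unfolding d1[OF w] DERIV_imp_deriv[OF t(1)] using t(2,3)
      by (simp add: complex_eq_iff power2_eq_square)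
    show "0 < Im (deriv X1 w * cnj (deriv X2 w))"
      unfolding d1[OF w] using jac[OF w] by (simp add: algebra_simps)
  qed
qed

text \<open>With \<open>t\<close> the angle from the vertical and \<open>a\<close> half the opening,
  \<open>cot a * sin \<bar>t\<bar> < cos t\<close> means \<open>0 < sin (a - \<bar>t\<bar>)\<close>
  after multiplication by \<open>sin a\<close>, which is positive for all openings below
  \<open>2 * pi\<close>. So reflex sectors obey the same formula.\<close>

lemma sector_iff:
  assumes \<alpha>: "0 < \<alpha>" "\<alpha> < 2 * pi"
  shows "(\<exists>\<rho> s. 0 < \<rho> \<and> y = of_real \<rho> * cis s \<and> pi/2 - \<alpha>/2 < s \<and> s < pi/2 + \<alpha>/2) \<longleftrightarrow>
    cot (\<alpha>/2) * \<bar>Re y\<bar> < Im y"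
proof -
  define a where "a = \<alpha> / 2"
  have a: "0 < a" "a < pi" using \<alpha> by (auto simp: a_def)
  have sa: "0 < sin a" using a by (rule sin_gt_zero)
  have key: "cot a * sin u < cos u \<longleftrightarrow> u < a" if u: "0 \<le> u" "u \<le> pi" for u
  proof -
    have "cot a * sin u < cos u \<longleftrightarrow> cos a * sin u < cos u * sin a"
      using sa by (simp add: cot_def pos_divide_less_eq)
    also have "\<dots> \<longleftrightarrow> 0 < sin (a - u)" by (simp add: sin_diff mult.commute)
    also have "\<dots> \<longleftrightarrow> u < a"
    proof (cases "u < a")
      case True
      then show ?thesis using a u by (auto intro!: sin_gt_zero)
    next
      case False
      then have "0 \<le> sin (u - a)" using a u by (intro sin_ge_zero) auto
      moreover have "sin (a - u) = - sin (u - a)" by (metis minus_diff_eq sin_minus)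
      ultimately show ?thesis using False by simp
    qed
    finally show ?thesis .
  qed
  have abs_sin: "\<bar>sin t\<bar> = sin \<bar>t\<bar>" if "\<bar>t\<bar> \<le> pi" for t :: real
  proof (cases "0 \<le> t")
    case True
    then show ?thesis using that sin_ge_zero[of t] by simp
  next
    case False
    then show ?thesis using that sin_ge_zero[of "- t"] by simp
  qed
  have main: "cot a * \<bar>Re y\<bar> < Im y \<longleftrightarrow> \<bar>t\<bar> < a"
    if "0 < \<rho>" "y = of_real \<rho> * cis (pi/2 - t)" "\<bar>t\<bar> \<le> pi" for \<rho> t
  proof -
    have "Re y = \<rho> * sin t" "Im y = \<rho> * cos t" using that(2) by (simp_all add: cos_diff sin_diff)
    then have "\<bar>Re y\<bar> = \<rho> * sin \<bar>t\<bar>" "Im y = \<rho> * cos \<bar>t\<bar>" using that abs_sin by (auto simp: abs_mult)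
    then have "cot a * \<bar>Re y\<bar> < Im y \<longleftrightarrow> \<rho> * (cot a * sin \<bar>t\<bar>) < \<rho> * cos \<bar>t\<bar>" by (simp add: mult.left_commute)
    also have "\<dots> \<longleftrightarrow> \<bar>t\<bar> < a" using that key[of "\<bar>t\<bar>"] by simp
    finally show ?thesis .
  qed
  show ?thesis unfolding a_def[symmetric]
  proof
    assume "\<exists>\<rho> s. 0 < \<rho> \<and> y = of_real \<rho> * cis s \<and> pi/2 - a < s \<and> s < pi/2 + a"
    then obtain \<rho> s where s: "0 < \<rho>" "y = of_real \<rho> * cis s" "pi/2 - a < s" "s < pi/2 + a" by blast
    have "\<bar>pi/2 - s\<bar> < a" using s by linarith
    then show "cot a * \<bar>Re y\<bar> < Im y" using main[of \<rho> "pi/2 - s"] s a by simp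
  next
    assume y: "cot a * \<bar>Re y\<bar> < Im y"
    then have y0: "y \<noteq> 0" by auto
    \<comment> \<open>The clockwise angle from the vertical. With this reference direction the jump
      of \<open>Arg\<close> lies on the downward half-line, opposite to the bisector.\<close>
    define t where "t = Arg (\<i> * cnj y)"
    have t: "\<bar>t\<bar> \<le> pi" using Arg_bounded[of "\<i> * cnj y"] unfolding t_def by linarith
    have "\<i> * cnj y = of_real (cmod y) * cis t" using Arg_eq[of "\<i> * cnj y"] y0 by (simp add: t_def norm_mult cis_conv_exp)
    then have "Im y = cmod y * cos t" "Re y = cmod y * sin t" by (auto simp: complex_eq_iff)
    then have ye: "y = of_real (cmod y) * cis (pi/2 - t)" by (simp add: complex_eq_iff cos_diff sin_diff)
    then have "\<bar>t\<bar> < a" using main[OF _ ye t] y y0 by simp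
    then have "pi/2 - a < pi/2 - t" "pi/2 - t < pi/2 + a" by linarith+
    then show "\<exists>\<rho> s. 0 < \<rho> \<and> y = of_real \<rho> * cis s \<and> pi/2 - a < s \<and> s < pi/2 + a"
      using ye y0 zero_less_norm_iff by blast
  qed
qed

text \<open>Reduction to the normalised corner. A rotation of the plane mixes \<open>X1\<close> and
  \<open>X2\<close> with the real coefficients of an orthogonal matrix of determinant 1, so
  holomorphy, the sum of the squared derivatives and the Jacobian persist, and the height is
  untouched.\<close>

lemma corner_boundary_arc:
  fixes X1 X2 :: "complex \<Rightarrow> complex"
  assumes hol: "X1 holomorphic_on unit_disk" "X2 holomorphic_on unit_disk"
    and holT: "(\<lambda>w. Complex (\<phi> (f w)) (\<psi> (f w))) holomorphic_on unit_disk"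
    and Im1: "\<And>w. w \<in> unit_disk \<Longrightarrow> Im (X1 w) = Re (f w)" and Im2: "\<And>w. w \<in> unit_disk \<Longrightarrow> Im (X2 w) = Im (f w)"
    and conf: "\<And>w. w \<in> unit_disk \<Longrightarrow> (deriv X1 w)\<^sup>2 + (deriv X2 w)\<^sup>2 = (deriv (\<lambda>w. Complex (\<phi> (f w)) (\<psi> (f w))) w)\<^sup>2"
    and jac: "\<And>w. w \<in> unit_disk \<Longrightarrow> 0 < Im (deriv X1 w * cnj (deriv X2 w))"
    and bij: "bij_betw f unit_disk \<Omega>"
    and z12: "z1 \<noteq> z0" "z2 \<noteq> z0" and angle: "interior_angle \<Omega> z0 z1 z2 \<alpha>"
    and edge1: "\<And>z. z \<in> open_segment z0 z1 \<Longrightarrow> filterlim (\<lambda>z. \<sigma>1 * \<phi> z) at_top (at z within \<Omega>)"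
    and edge2: "\<And>z. z \<in> open_segment z0 z2 \<Longrightarrow> filterlim (\<lambda>z. \<sigma>2 * \<phi> z) at_top (at z within \<Omega>)"
    and signs: "\<sigma>1 \<in> {1, -1}" "\<sigma>2 \<in> {1, -1}" "\<alpha> = pi \<Longrightarrow> \<sigma>1 \<noteq> \<sigma>2"
  obtains a0 \<delta> where "cmod a0 = 1" "0 < \<delta>"
    "\<And>a. cmod a = 1 \<Longrightarrow> dist a a0 < \<delta> \<Longrightarrow> (f \<longlongrightarrow> z0) (at a within unit_disk)"
proof -
  from angle obtain r0 \<theta> \<theta>1 \<theta>2 where \<alpha>: "0 < \<alpha>" "\<alpha> < 2 * pi" and r0: "0 < r0"
    and th: "\<theta>1 = \<theta> \<and> \<theta>2 = \<theta> + \<alpha> \<or> \<theta>1 = \<theta> + \<alpha> \<and> \<theta>2 = \<theta>"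
    and z1: "z1 = z0 + of_real (dist z0 z1) * cis \<theta>1" and z2: "z2 = z0 + of_real (dist z0 z2) * cis \<theta>2"
    and sec: "\<Omega> \<inter> ball z0 r0 = {z0 + of_real \<rho> * cis s | \<rho> s. 0 < \<rho> \<and> \<rho> < r0 \<and> \<theta> < s \<and> s < \<theta> + \<alpha>}"
    unfolding interior_angle_def by (elim conjE exE) (rule that)
  \<comment> \<open>The bisector has direction \<open>\<theta> + \<alpha>/2\<close>; rotation by
    \<open>- b\<close> turns it to \<open>pi/2\<close>.\<close>
  define b where "b = \<theta> + \<alpha>/2 - pi/2"
  define e where "e = cis (-b)"
  have ne: "cmod e = 1" by (simp add: e_def)
  have e0: "e \<noteq> 0" by (simp add: e_def)
  have ec: "cnj e = cis b" "e * cis b = 1" "cis b * e = 1" by (simp_all add: e_def cis_cnj cis_mult)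
  define k where "k = cot (\<alpha>/2)"
  define r where "r = min r0 (min (dist z0 z1) (dist z0 z2))"
  have r: "0 < r" "r \<le> r0" "r \<le> dist z0 z1" "r \<le> dist z0 z2" using r0 z12 by (auto simp: r_def)
  define \<Omega>0 where "\<Omega>0 = (\<lambda>z. (z - z0) * e) ` \<Omega>"
  have mem0: "y \<in> \<Omega>0 \<longleftrightarrow> z0 + y * cis b \<in> \<Omega>" for y
  proof
    assume "y \<in> \<Omega>0"
    then obtain z where z: "z \<in> \<Omega>" "y = (z - z0) * e" by (auto simp: \<Omega>0_def)
    then have "z0 + y * cis b = z" by (simp add: mult.assoc ec)
    then show "z0 + y * cis b \<in> \<Omega>" using z by simp
  next
    assume "z0 + y * cis b \<in> \<Omega>"
    moreover have "y = (z0 + y * cis b - z0) * e" by (simp add: mult.assoc ec)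
    ultimately show "y \<in> \<Omega>0" unfolding \<Omega>0_def by blast
  qed
  define X Y where "X = (\<lambda>w. of_real (Re e) * (X1 w - \<i> * of_real (Re z0)) - of_real (Im e) * (X2 w - \<i> * of_real (Im z0)))"
    and "Y = (\<lambda>w. of_real (Im e) * (X1 w - \<i> * of_real (Re z0)) + of_real (Re e) * (X2 w - \<i> * of_real (Im z0)))"
  let ?T = "\<lambda>w. Complex (\<phi> (f w)) (\<psi> (f w))"
  let ?f = "\<lambda>w. Complex (Im (X w)) (Im (Y w))"
  have fe: "?f w = (f w - z0) * e" if "w \<in> unit_disk" for w
    using Im1[OF that] Im2[OF that] by (simp add: X_def Y_def complex_eq_iff algebra_simps)
  have dd: "deriv X w = of_real (Re e) * deriv X1 w - of_real (Im e) * deriv X2 w \<and>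
      deriv Y w = of_real (Im e) * deriv X1 w + of_real (Re e) * deriv X2 w" if w: "w \<in> unit_disk" for w
  proof -
    have "(X1 has_field_derivative deriv X1 w) (at w)" "(X2 has_field_derivative deriv X2 w) (at w)"
      using holomorphic_derivI[OF _ open_ball w] hol by auto
    then have "(X has_field_derivative of_real (Re e) * deriv X1 w - of_real (Im e) * deriv X2 w) (at w)"
      "(Y has_field_derivative of_real (Im e) * deriv X1 w + of_real (Re e) * deriv X2 w) (at w)"
      unfolding X_def Y_def by (auto intro!: derivative_eq_intros)
    then show ?thesis by (auto dest: DERIV_imp_deriv)
  qed
  have e2: "(Re e)\<^sup>2 + (Im e)\<^sup>2 = 1" using ne cmod_power2[of e] by simp
  have e2c: "(of_real (Re e))\<^sup>2 + (of_real (Im e))\<^sup>2 = (1::complex)" using e2 by (metis of_real_1 of_real_add of_real_power)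
  have bij0: "bij_betw ?f unit_disk \<Omega>0"
  proof -
    have "bij_betw (\<lambda>z. (z - z0) * e) \<Omega> \<Omega>0" unfolding \<Omega>0_def by (rule inj_on_imp_bij_betw) (auto intro!: inj_onI simp: e0)
    with bij have "bij_betw ((\<lambda>z. (z - z0) * e) \<circ> f) unit_disk \<Omega>0" by (rule bij_betw_trans)
    moreover have "bij_betw ?f unit_disk \<Omega>0 \<longleftrightarrow> bij_betw ((\<lambda>z. (z - z0) * e) \<circ> f) unit_disk \<Omega>0"
      by (rule bij_betw_cong) (simp only: fe comp_def)
    ultimately show ?thesis by simp
  qed
  define g where "g = inv_into unit_disk ?f"
  have g: "g y \<in> unit_disk" "f (g y) = z0 + y * cis b" if y: "y \<in> \<Omega>0" for y
  proof -
    have im: "y \<in> ?f ` unit_disk" using bij0 y by (simp add: bij_betw_def)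
    show 1: "g y \<in> unit_disk" unfolding g_def by (rule inv_into_into[OF im])
    have "?f (g y) = y" unfolding g_def by (rule f_inv_into_f[OF im])
    then have "(f (g y) - z0) * e = y" using fe[OF 1] by simp
    then show "f (g y) = z0 + y * cis b" using ec by (metis add_diff_cancel_left' diff_add_cancel add.commute mult.assoc mult.right_neutral)
  qed
  have edge: "filterlim (\<lambda>y. \<sigma> * Re (?T (g y))) at_top (at y0 within \<Omega>0)"
    if lim: "filterlim (\<lambda>z. \<sigma> * \<phi> z) at_top (at (z0 + y0 * cis b) within \<Omega>)" for \<sigma> y0
  proof -
    have "filterlim (\<lambda>y. z0 + y * cis b) (at (z0 + y0 * cis b) within \<Omega>) (at y0 within \<Omega>0)"
      unfolding filterlim_at
    proof
      show "eventually (\<lambda>y. z0 + y * cis b \<in> \<Omega> \<and> z0 + y * cis b \<noteq> z0 + y0 * cis b) (at y0 within \<Omega>0)"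
        unfolding eventually_at_filter using mem0 by simp
      show "((\<lambda>y. z0 + y * cis b) \<longlongrightarrow> z0 + y0 * cis b) (at y0 within \<Omega>0)" by (intro tendsto_intros)
    qed
    from filterlim_compose[OF lim this] have "filterlim (\<lambda>y. \<sigma> * \<phi> (z0 + y * cis b)) at_top (at y0 within \<Omega>0)" .
    moreover have "eventually (\<lambda>y. \<sigma> * \<phi> (z0 + y * cis b) = \<sigma> * Re (?T (g y))) (at y0 within \<Omega>0)"
      unfolding eventually_at_filter using g(2) by simp
    ultimately show ?thesis using filterlim_cong[OF refl refl] by fast
  qed
  \<comment> \<open>The edge of direction \<theta> is turned to \<open>pi/2 - \<alpha>/2\<close>,
    hence to the right side, whichever of the two segments it carries.\<close>
  define s1 s2 where "s1 = (if \<theta>1 = \<theta> then \<sigma>1 else \<sigma>2)" and "s2 = (if \<theta>1 = \<theta> then \<sigma>2 else \<sigma>1)"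
  have seg: "z0 + of_real \<rho> * cis \<theta>' \<in> open_segment z0 z'"
    if "z' = z0 + of_real (dist z0 z') * cis \<theta>'" "0 < \<rho>" "\<rho> < dist z0 z'" for \<rho> \<theta>' z'
  proof -
    have "z0 \<noteq> z'" using that(2,3) by auto
    have "z0 + of_real \<rho> * cis \<theta>' = (1 - \<rho> / dist z0 z') *\<^sub>R z0 + (\<rho> / dist z0 z') *\<^sub>R (z0 + of_real (dist z0 z') * cis \<theta>')"
      using that(2,3) \<open>z0 \<noteq> z'\<close> by (simp add: scaleR_conv_of_real algebra_simps)
    also have "\<dots> = (1 - \<rho> / dist z0 z') *\<^sub>R z0 + (\<rho> / dist z0 z') *\<^sub>R z'" using that(1) by simp
    finally have "z0 + of_real \<rho> * cis \<theta>' = (1 - \<rho> / dist z0 z') *\<^sub>R z0 + (\<rho> / dist z0 z') *\<^sub>R z'" .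
    then show ?thesis unfolding in_segment using that(2,3) \<open>z0 \<noteq> z'\<close> by (intro conjI exI[of _ "\<rho> / dist z0 z'"]) auto
  qed
  have "graph_corner X Y ?T \<Omega>0 k r s1 s2"
  proof (rule graph_corner.intro)
    show "X holomorphic_on unit_disk" "Y holomorphic_on unit_disk" unfolding X_def Y_def by (intro holomorphic_intros hol)+
    show "?T holomorphic_on unit_disk" by fact
    show "(deriv X w)\<^sup>2 + (deriv Y w)\<^sup>2 = (deriv ?T w)\<^sup>2" if w: "w \<in> unit_disk" for w
    proof -
      have "(deriv X w)\<^sup>2 + (deriv Y w)\<^sup>2 = ((of_real (Re e))\<^sup>2 + (of_real (Im e))\<^sup>2) * ((deriv X1 w)\<^sup>2 + (deriv X2 w)\<^sup>2)"
        unfolding conjunct1[OF dd[OF w]] conjunct2[OF dd[OF w]] by (simp add: power2_eq_square algebra_simps)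
      then show ?thesis using conf[OF w] by (simp only: e2c mult_1_left)
    qed
    show "0 < Im (deriv X w * cnj (deriv Y w))" if w: "w \<in> unit_disk" for w
    proof -
      have "Im (deriv X w * cnj (deriv Y w)) = ((Re e)\<^sup>2 + (Im e)\<^sup>2) * Im (deriv X1 w * cnj (deriv X2 w))"
        unfolding conjunct1[OF dd[OF w]] conjunct2[OF dd[OF w]] by (simp add: power2_eq_square algebra_simps)
      then show ?thesis using jac[OF w] e2 by simp
    qed
    show "bij_betw ?f unit_disk \<Omega>0" by fact
    show "0 < r" by fact
    show "\<Omega>0 \<inter> ball 0 r = {z \<in> ball 0 r. k * \<bar>Re z\<bar> < Im z}"
    proof -
      have "y \<in> \<Omega>0 \<longleftrightarrow> k * \<bar>Re y\<bar> < Im y" if y: "cmod y < r" for y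
      proof -
        have "z0 + y * cis b \<in> ball z0 r0" using y r by (simp add: dist_norm norm_mult)
        then have "y \<in> \<Omega>0 \<longleftrightarrow> (\<exists>\<rho> s. z0 + y * cis b = z0 + of_real \<rho> * cis s \<and> 0 < \<rho> \<and> \<rho> < r0 \<and> \<theta> < s \<and> s < \<theta> + \<alpha>)"
          using sec mem0[of y] by blast
        also have "\<dots> \<longleftrightarrow> (\<exists>\<rho> s. 0 < \<rho> \<and> y = of_real \<rho> * cis s \<and> pi/2 - \<alpha>/2 < s \<and> s < pi/2 + \<alpha>/2)"
        proof
          assume "\<exists>\<rho> s. z0 + y * cis b = z0 + of_real \<rho> * cis s \<and> 0 < \<rho> \<and> \<rho> < r0 \<and> \<theta> < s \<and> s < \<theta> + \<alpha>"
          then obtain \<rho> s where s: "y * cis b = of_real \<rho> * cis s" "0 < \<rho>" "\<theta> < s" "s < \<theta> + \<alpha>" by auto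
          have "y = y * cis b * e" by (simp add: mult.assoc ec)
          also have "\<dots> = of_real \<rho> * cis (s - b)" unfolding s(1) e_def by (simp add: mult.assoc cis_mult)
          finally show "\<exists>\<rho> s. 0 < \<rho> \<and> y = of_real \<rho> * cis s \<and> pi/2 - \<alpha>/2 < s \<and> s < pi/2 + \<alpha>/2"
            using s(2-4) by (intro exI[of _ \<rho>] exI[of _ "s - b"]) (simp add: b_def)
        next
          assume "\<exists>\<rho> s. 0 < \<rho> \<and> y = of_real \<rho> * cis s \<and> pi/2 - \<alpha>/2 < s \<and> s < pi/2 + \<alpha>/2"
          then obtain \<rho> s where s: "0 < \<rho>" "y = of_real \<rho> * cis s" "pi/2 - \<alpha>/2 < s" "s < pi/2 + \<alpha>/2" by blast
          have "\<rho> = cmod y" using s(1,2) by (simp add: norm_mult)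
          then show "\<exists>\<rho> s. z0 + y * cis b = z0 + of_real \<rho> * cis s \<and> 0 < \<rho> \<and> \<rho> < r0 \<and> \<theta> < s \<and> s < \<theta> + \<alpha>"
            using s y r by (intro exI[of _ \<rho>] exI[of _ "s + b"]) (simp add: b_def mult.assoc cis_mult)
        qed
        also have "\<dots> \<longleftrightarrow> k * \<bar>Re y\<bar> < Im y" unfolding k_def by (rule sector_iff[OF \<alpha>])
        finally show ?thesis .
      qed
      then show ?thesis by auto
    qed
    show "s1 \<in> {1, -1}" "s2 \<in> {1, -1}" using signs by (auto simp: s1_def s2_def)
    show "s1 \<noteq> s2" if "k = 0"
    proof -
      have "0 < sin (\<alpha>/2)" using \<alpha> by (intro sin_gt_zero) auto
      then have c: "cos (\<alpha>/2) = cos (pi/2)" using that by (simp add: k_def cot_def)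
      have "\<alpha>/2 = pi/2" by (rule cos_inj_pi[OF _ _ _ _ c]) (use \<alpha> in simp_all)
      then show ?thesis using signs(3) by (auto simp: s1_def s2_def)
    qed
    fix x :: real assume x: "x \<noteq> 0" "cmod (Complex x (k * \<bar>x\<bar>)) < r"
    let ?y = "Complex x (k * \<bar>x\<bar>)"
    \<comment> \<open>The distance from the corner to the edge point with abscissa
      \<open>x\<close>.\<close>
    define \<rho> where "\<rho> = \<bar>x\<bar> / sin (\<alpha>/2)"
    have sa: "0 < sin (\<alpha>/2)" using \<alpha> by (intro sin_gt_zero) auto
    have rho: "0 < \<rho>" using x sa by (simp add: \<rho>_def)
    have c1: "cos (pi/2 - \<alpha>/2) = sin (\<alpha>/2)" "sin (pi/2 - \<alpha>/2) = cos (\<alpha>/2)" by (simp_all add: cos_diff sin_diff)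
    have c2: "cos (pi/2 + \<alpha>/2) = - sin (\<alpha>/2)" "sin (pi/2 + \<alpha>/2) = cos (\<alpha>/2)" by (simp_all add: cos_add sin_add)
    have y1: "?y = of_real \<rho> * cis (pi/2 - \<alpha>/2)" if "0 < x"
      using that sa by (simp add: complex_eq_iff c1 \<rho>_def k_def cot_def)
    have y2: "?y = of_real \<rho> * cis (pi/2 + \<alpha>/2)" if "x < 0"
      using that sa by (simp add: complex_eq_iff c2 \<rho>_def k_def cot_def)
    have ny: "cmod ?y = \<rho>"
    proof (cases "0 < x")
      case True then show ?thesis using y1[OF True] rho by (simp only: norm_mult) simp
    next
      case False then show ?thesis using y2 x rho by (simp add: norm_mult)
    qed
    have rd: "\<rho> < dist z0 z1" "\<rho> < dist z0 z2" using x(2) ny r by auto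
    have zz: "z0 + ?y * cis b = z0 + of_real \<rho> * cis (if 0 < x then \<theta> else \<theta> + \<alpha>)"
    proof (cases "0 < x")
      case True
      show ?thesis unfolding y1[OF True] using True by (simp add: mult.assoc cis_mult b_def)
    next
      case False
      then have "x < 0" using x by simp
      show ?thesis unfolding y2[OF \<open>x < 0\<close>] using False by (simp add: mult.assoc cis_mult b_def add.commute)
    qed
    have "filterlim (\<lambda>z. (if 0 < x then s1 else s2) * \<phi> z) at_top (at (z0 + ?y * cis b) within \<Omega>)"
    proof (cases "\<theta>1 = \<theta>")
      case True
      then have "\<theta>2 = \<theta> + \<alpha>" using th \<alpha> by auto
      then show ?thesis unfolding zz s1_def s2_def
        using True edge1[OF seg[OF z1 rho rd(1)]] edge2[OF seg[OF z2 rho rd(2)]] by simp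
    next
      case False
      then have "\<theta>1 = \<theta> + \<alpha>" "\<theta>2 = \<theta>" using th by auto
      then show ?thesis unfolding zz s1_def s2_def
        using False edge1[OF seg[OF z1 rho rd(1)]] edge2[OF seg[OF z2 rho rd(2)]] by simp
    qed
    from edge[OF this] show "filterlim (\<lambda>z. (if 0 < x then s1 else s2) * Re (?T (inv_into unit_disk ?f z))) at_top (at ?y within \<Omega>0)"
      unfolding g_def .
  qed
  from graph_corner.boundary_arc[OF this] obtain a0 \<delta> where a: "cmod a0 = 1" "0 < \<delta>"
    "\<forall>a. cmod a = 1 \<longrightarrow> dist a a0 < \<delta> \<longrightarrow> (?f \<longlongrightarrow> 0) (at a within unit_disk)" by metis
  show thesis
  proof (rule that[OF a(1,2)])
    fix a assume "cmod a = 1" "dist a a0 < \<delta>"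
    then have "(?f \<longlongrightarrow> 0) (at a within unit_disk)" using a(3) by blast
    then have "((\<lambda>w. z0 + ?f w * cis b) \<longlongrightarrow> z0 + 0 * cis b) (at a within unit_disk)" by (intro tendsto_intros)
    moreover have "eventually (\<lambda>w. z0 + ?f w * cis b = f w) (at a within unit_disk)"
      unfolding eventually_at_filter
    proof (intro always_eventually allI impI)
      fix w assume "w \<in> unit_disk"
      show "z0 + ?f w * cis b = f w" unfolding fe[OF \<open>w \<in> unit_disk\<close>] by (simp add: mult.assoc ec)
    qed
    ultimately show "(f \<longlongrightarrow> z0) (at a within unit_disk)" by (simp add: tendsto_cong)
  qed
qed

section \<open>Extension across the arc\<close>

text \<open>The reciprocal of the Joukowski map \<open>(w + 1/w) / 2\<close>. It maps the upper
  half-disk conformally onto the half-plane with the diameter going into the interval from -1 to 1,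
  so a chosen interval of the boundary, and not all of it, becomes the diameter.\<close>

definition joukowski :: "complex \<Rightarrow> complex" where
  "joukowski w = 2 * w / (1 + w\<^sup>2)"

lemma one_plus_square_nz: "w \<in> unit_disk \<Longrightarrow> 1 + w\<^sup>2 \<noteq> 0"
proof
  assume w: "w \<in> unit_disk" "1 + w\<^sup>2 = 0"
  then have "w\<^sup>2 = -1" by (simp add: eq_neg_iff_add_eq_0 add.commute)
  then have "(cmod w)\<^sup>2 = 1" by (metis norm_minus_cancel norm_one norm_power)
  then have "cmod w = 1" by (simp add: power2_eq_1_iff) (smt (verit) norm_ge_zero)
  then show False using w by simp
qed

lemma joukowski_deriv:
  assumes "w \<in> unit_disk"
  shows "(joukowski has_field_derivative 2 * (1 - w\<^sup>2) / (1 + w\<^sup>2)\<^sup>2) (at w)"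
  unfolding joukowski_def
  by (rule derivative_eq_intros refl one_plus_square_nz[OF assms] | simp)+
    (use one_plus_square_nz[OF assms] in \<open>simp add: field_simps power2_eq_square\<close>)

lemma joukowski_Im:
  assumes "w \<in> unit_disk"
  shows "Im (joukowski w) = 2 * Im w * (1 - (cmod w)\<^sup>2) / (cmod (1 + w\<^sup>2))\<^sup>2"
proof -
  have "joukowski w = 2 * w * cnj (1 + w\<^sup>2) / of_real ((cmod (1 + w\<^sup>2))\<^sup>2)"
  proof -
    define m where "m = 1 + w\<^sup>2"
    have "m \<noteq> 0" using one_plus_square_nz[OF assms] by (simp add: m_def)
    then have "2 * w / m = 2 * w * cnj m / (m * cnj m)" by simp
    then show ?thesis unfolding joukowski_def complex_norm_square m_def .
  qed
  also have "2 * w * cnj (1 + w\<^sup>2) = 2 * (w + of_real ((cmod w)\<^sup>2) * cnj w)"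
    unfolding complex_norm_square by (simp add: power2_eq_square algebra_simps)
  finally have "Im (joukowski w) = Im (2 * (w + of_real ((cmod w)\<^sup>2) * cnj w)) / (cmod (1 + w\<^sup>2))\<^sup>2"
    by (simp only: Im_divide_of_real)
  then show ?thesis by (simp add: algebra_simps)
qed

lemma upper_half_disk_eq: "upper_half_disk = upper_half_ball 0 1"
  by (simp add: upper_half_disk_def upper_half_ball_def)

lemma joukowski_pos: "w \<in> unit_disk \<Longrightarrow> 0 < Im (joukowski w) \<longleftrightarrow> 0 < Im w"
proof -
  assume w: "w \<in> unit_disk"
  have "(cmod w)\<^sup>2 < 1" using w by (simp add: power_less_one_iff)
  then have "0 < (1 - (cmod w)\<^sup>2) / (cmod (1 + w\<^sup>2))\<^sup>2" using one_plus_square_nz[OF w] by simp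
  moreover have "Im (joukowski w) = Im w * (2 * ((1 - (cmod w)\<^sup>2) / (cmod (1 + w\<^sup>2))\<^sup>2))"
    unfolding joukowski_Im[OF w] by simp
  moreover have "0 < c \<Longrightarrow> 0 < x * (2 * c) \<longleftrightarrow> 0 < x" for x c :: real by (simp add: zero_less_mult_iff)
  ultimately show ?thesis by metis
qed

text \<open>The preimages of \<zeta> are the roots \<open>p\<close> and \<open>q\<close> of
  \<open>\<zeta> * x\<^sup>2 - 2 * x + \<zeta>\<close>, whose product is 1. Either one is inside the
  unit circle or both are on it; in the second case \<open>\<zeta> * Re p = 1\<close>, which is
  impossible for nonreal \<zeta>.\<close>

lemma joukowski_bij: "bij_betw joukowski upper_half_disk {\<zeta>. 0 < Im \<zeta>}"
  unfolding bij_betw_def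
proof
  show "inj_on joukowski upper_half_disk"
  proof (rule inj_onI)
    fix w v assume wv: "w \<in> upper_half_disk" "v \<in> upper_half_disk" "joukowski w = joukowski v"
    then have d: "w \<in> unit_disk" "v \<in> unit_disk" by (auto simp: upper_half_disk_def)
    have "w * (1 + v\<^sup>2) = v * (1 + w\<^sup>2)"
      using wv(3) one_plus_square_nz[OF d(1)] one_plus_square_nz[OF d(2)] by (simp add: joukowski_def frac_eq_eq)
    then have "(w - v) * (1 - w * v) = 0" by (simp add: power2_eq_square algebra_simps)
    moreover have "cmod (w * v) < 1" using d by (simp add: norm_mult) (metis mult_strict_mono' norm_ge_zero mult_1)
    then have "1 - w * v \<noteq> 0" by auto
    ultimately show "w = v" by simp
  qed
  show "joukowski ` upper_half_disk = {\<zeta>. 0 < Im \<zeta>}"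
  proof
    show "joukowski ` upper_half_disk \<subseteq> {\<zeta>. 0 < Im \<zeta>}" using joukowski_pos by (auto simp: upper_half_disk_def)
    show "{\<zeta>. 0 < Im \<zeta>} \<subseteq> joukowski ` upper_half_disk"
    proof
      fix \<zeta> assume "\<zeta> \<in> {\<zeta>. 0 < Im \<zeta>}"
      then have z: "0 < Im \<zeta>" "\<zeta> \<noteq> 0" by auto
      define D where "D = csqrt (1 - \<zeta>\<^sup>2)"
      define p q where "p = (1 + D) / \<zeta>" and "q = (1 - D) / \<zeta>"
      have D: "D\<^sup>2 = 1 - \<zeta>\<^sup>2" by (simp add: D_def)
      have pq: "p * q = 1"
      proof -
        have "p * q = (1 - D\<^sup>2) / \<zeta>\<^sup>2" by (simp add: p_def q_def power2_eq_square algebra_simps)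
        then show ?thesis using z by (simp add: D)
      qed
      have root: "\<zeta> * (1 + x\<^sup>2) = 2 * x" if "x = p \<or> x = q" for x
      proof -
        have "(\<zeta> * x - 1)\<^sup>2 = D\<^sup>2" using that z by (auto simp: p_def q_def power2_eq_square)
        then have "\<zeta> * (\<zeta> * x\<^sup>2 - 2 * x + \<zeta>) = 0" unfolding D by (simp add: power2_eq_square algebra_simps)
        then have "\<zeta> * x\<^sup>2 - 2 * x + \<zeta> = 0" using z(2) by (metis mult_eq_0_iff)
        then show ?thesis by algebra
      qed
      have "\<exists>x. (x = p \<or> x = q) \<and> cmod x < 1"
      proof (rule ccontr)
        assume "\<not> ?thesis"
        then have "1 \<le> cmod p" "1 \<le> cmod q" by auto
        moreover have "cmod p * cmod q = 1" using pq by (metis norm_mult norm_one)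
        ultimately have "cmod p = 1"
          by (metis dual_order.antisym mult.commute mult_1 mult_left_mono norm_ge_zero)
        then have "p * cnj p = 1" using complex_norm_square[of p] by simp
        then have "\<zeta> * (1 + p\<^sup>2) * cnj p = 2" using root[of p] by (simp add: mult.assoc)
        moreover have "(1 + p\<^sup>2) * cnj p = cnj p + p * (p * cnj p)" by (simp add: power2_eq_square algebra_simps)
        ultimately have "\<zeta> * of_real (2 * Re p) = 2" using \<open>p * cnj p = 1\<close>
          by (simp add: mult.assoc complex_add_cnj add.commute)
        then have "\<zeta> * of_real (Re p) = 1" by simp
        then have "Im (\<zeta> * of_real (Re p)) = 0" "Re p \<noteq> 0" by auto
        then show False using z by simp
      qed
      then obtain x where x: "\<zeta> * (1 + x\<^sup>2) = 2 * x" "x \<in> unit_disk" using root by auto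
      then have "joukowski x = \<zeta>" using one_plus_square_nz[OF x(2)] by (simp add: joukowski_def field_simps)
      moreover have "0 < Im x" using joukowski_pos[OF x(2)] calculation z by simp
      ultimately show "\<zeta> \<in> joukowski ` upper_half_disk" using x(2) by (auto simp: upper_half_disk_def)
    qed
  qed
qed

lemma joukowski_real:
  assumes "\<bar>u\<bar> < 1"
  shows "\<exists>v. joukowski (of_real u) = of_real v \<and> \<bar>v\<bar> < 1"
proof -
  have pos: "0 < 1 + u\<^sup>2" by (simp add: add_pos_nonneg)
  have "0 < (1 - \<bar>u\<bar>)\<^sup>2" using assms by simp
  then have "2 * \<bar>u\<bar> < 1 + u\<^sup>2" by (simp add: power2_eq_square algebra_simps)
  then have "\<bar>2 * u / (1 + u\<^sup>2)\<bar> < 1" using pos by (simp add: abs_mult)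
  moreover have "joukowski (of_real u) = of_real (2 * u / (1 + u\<^sup>2))" by (simp add: joukowski_def)
  ultimately show ?thesis by blast
qed

text \<open>Cayley transform of the half-plane onto the disk, normalised to send 0 to the boundary
  point \<open>a\<close>.\<close>

definition cayley :: "complex \<Rightarrow> complex \<Rightarrow> complex" where
  "cayley a \<zeta> = a * ((1 + \<i> * \<zeta>) / (1 - \<i> * \<zeta>))"

lemma cayley_denominator: "0 \<le> Im \<zeta> \<Longrightarrow> 1 - \<i> * \<zeta> \<noteq> 0"
  by (auto simp: complex_eq_iff)

lemma cayley_holomorphic: "0 \<le> Im \<zeta> \<Longrightarrow> cayley a field_differentiable (at \<zeta>)"
  unfolding cayley_def using cayley_denominator by (intro derivative_intros) auto

lemma cayley_real: "cmod a = 1 \<Longrightarrow> cmod (cayley a (of_real u)) = 1"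
proof -
  have "cnj (1 - \<i> * of_real u) = 1 + \<i> * of_real u" by simp
  then have "cmod (1 + \<i> * of_real u) = cmod (1 - \<i> * of_real u)" by (metis complex_mod_cnj)
  moreover have "1 - \<i> * of_real u \<noteq> 0" by (rule cayley_denominator) simp
  ultimately show "cmod a = 1 \<Longrightarrow> ?thesis" by (simp add: cayley_def norm_mult norm_divide)
qed

lemma cayley_bij:
  assumes a: "cmod a = 1"
  shows "bij_betw (cayley a) {\<zeta>. 0 < Im \<zeta>} unit_disk"
proof (rule bij_betwI[where g = "\<lambda>w. - \<i> * (w / a - 1) / (w / a + 1)"])
  have a0: "a \<noteq> 0" using a by auto
  show "cayley a \<in> {\<zeta>. 0 < Im \<zeta>} \<rightarrow> unit_disk"
  proof
    fix \<zeta> assume "\<zeta> \<in> {\<zeta>. 0 < Im \<zeta>}"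
    then have z: "0 < Im \<zeta>" by simp
    have "(cmod (1 + \<i> * \<zeta>))\<^sup>2 < (cmod (1 - \<i> * \<zeta>))\<^sup>2"
      unfolding cmod_power2 using z by (simp add: power2_eq_square algebra_simps)
    then have "cmod (1 + \<i> * \<zeta>) < cmod (1 - \<i> * \<zeta>)" by (rule power_less_imp_less_base) simp
    moreover have "1 - \<i> * \<zeta> \<noteq> 0" using z by (intro cayley_denominator) simp
    ultimately show "cayley a \<zeta> \<in> unit_disk" using a by (simp add: cayley_def norm_mult norm_divide)
  qed
  have nz: "v + 1 \<noteq> 0" if "cmod v < 1" for v :: complex
    using that by (metis add_eq_0_iff2 norm_minus_cancel norm_one order_less_irrefl)
  show "(\<lambda>w. - \<i> * (w / a - 1) / (w / a + 1)) \<in> unit_disk \<rightarrow> {\<zeta>. 0 < Im \<zeta>}"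
  proof
    fix w :: complex assume w: "w \<in> unit_disk"
    define v where "v = w / a"
    have v: "cmod v < 1" using w a by (simp add: v_def norm_divide)
    have "- \<i> * (v - 1) / (v + 1) = - \<i> * ((v - 1) * cnj (v + 1)) / of_real ((cmod (v + 1))\<^sup>2)"
    proof -
      have "x / m = x * cnj m / (m * cnj m)" if "m \<noteq> 0" for x m :: complex using that by simp
      from this[OF nz[OF v], of "- \<i> * (v - 1)"] show ?thesis unfolding complex_norm_square by (simp only: mult.assoc)
    qed
    then have "Im (- \<i> * (v - 1) / (v + 1)) = Im (- \<i> * ((v - 1) * cnj (v + 1))) / (cmod (v + 1))\<^sup>2"
      by (simp only: Im_divide_of_real)
    also have "Im (- \<i> * ((v - 1) * cnj (v + 1))) = 1 - (cmod v)\<^sup>2"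
      unfolding cmod_power2 by (simp add: power2_eq_square algebra_simps)
    also have "(1 - (cmod v)\<^sup>2) / (cmod (v + 1))\<^sup>2 > 0"
      using v nz[OF v] by (simp add: power_less_one_iff)
    finally show "- \<i> * (w / a - 1) / (w / a + 1) \<in> {\<zeta>. 0 < Im \<zeta>}" by (simp add: v_def)
  qed
  show "- \<i> * (cayley a \<zeta> / a - 1) / (cayley a \<zeta> / a + 1) = \<zeta>" if "\<zeta> \<in> {\<zeta>. 0 < Im \<zeta>}" for \<zeta>
  proof -
    have d: "1 - \<i> * \<zeta> \<noteq> 0" using that by (intro cayley_denominator) simp
    have v: "cayley a \<zeta> / a = (1 + \<i> * \<zeta>) / (1 - \<i> * \<zeta>)" using a0 by (simp add: cayley_def)
    have "(1 + \<i> * \<zeta>) / (1 - \<i> * \<zeta>) - 1 = 2 * \<i> * \<zeta> / (1 - \<i> * \<zeta>)" "(1 + \<i> * \<zeta>) / (1 - \<i> * \<zeta>) + 1 = 2 / (1 - \<i> * \<zeta>)"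
      using d by (simp_all add: field_simps)
    then show ?thesis unfolding v using d by simp
  qed
  show "cayley a (- \<i> * (w / a - 1) / (w / a + 1)) = w" if "w \<in> unit_disk" for w
  proof -
    define v where "v = w / a"
    have v: "v + 1 \<noteq> 0" using nz[of v] that a by (simp add: v_def norm_divide)
    have "1 + \<i> * (- \<i> * (v - 1) / (v + 1)) = 2 * v / (v + 1)" "1 - \<i> * (- \<i> * (v - 1) / (v + 1)) = 2 / (v + 1)"
      using v by (simp_all add: field_simps)
    then have "cayley a (- \<i> * (v - 1) / (v + 1)) = a * v" unfolding cayley_def using v by simp
    then show ?thesis using a0 by (simp add: v_def)
  qed
qed

lemma deriv_symmetric:
  assumes K: "K holomorphic_on S" "open S" "w \<in> S" and sym: "\<And>w. w \<in> S \<Longrightarrow> cnj w \<in> S \<and> K (cnj w) = cnj (K w)"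
  shows "deriv K (cnj w) = cnj (deriv K w)"
proof -
  have "(K has_field_derivative deriv K w) (at w)" by (rule holomorphic_derivI[OF K])
  then have "((cnj \<circ> K \<circ> cnj) has_field_derivative cnj (deriv K w)) (at (cnj w))"
    using has_field_derivative_cnj_cnj[of K "deriv K w" "cnj w"] by simp
  then have "(K has_field_derivative cnj (deriv K w)) (at (cnj w))"
  proof (rule has_field_derivative_transform_within_open[OF _ K(2)])
    show "cnj w \<in> S" using sym K(3) by blast
    show "(cnj \<circ> K \<circ> cnj) v = K v" if "v \<in> S" for v using sym[OF that] by simp
  qed
  then show ?thesis by (rule DERIV_imp_deriv)
qed

text \<open>Across an arc on which \<open>f\<close> is constant, \<open>X\<^sub>1\<close> and \<open>X\<^sub>2\<close> extend by reflection with real derivatives, so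
  \<open>T'\<close>, being a square root of the nonnegative \<open>X\<^sub>1'\<^sup>2 + X\<^sub>2'\<^sup>2\<close>, is real there too and \<open>Im T\<close> is constant.\<close>

lemma Im_limit_of_real_square:
  assumes g: "g holomorphic_on ball (of_real s) e" "0 < e"
    and sym: "\<And>u. \<bar>u - s\<bar> < e \<Longrightarrow> Im (g (of_real u)) = 0"
    and pos: "\<And>z. z \<in> ball (of_real s) e \<Longrightarrow> 0 < Re (g z)"
    and T: "T holomorphic_on upper_half_ball s e" "\<And>z. z \<in> upper_half_ball s e \<Longrightarrow> (deriv T z)\<^sup>2 = g z"
  obtains q where "\<And>u \<epsilon>. \<bar>u - s\<bar> < e \<Longrightarrow> 0 < \<epsilon> \<Longrightarrow>
     \<exists>d>0. \<forall>z\<in>upper_half_ball s e. dist z (of_real u) < d \<longrightarrow> \<bar>Im (T z) - q\<bar> \<le> \<epsilon>"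
    "\<And>e'. e' < e \<Longrightarrow> \<exists>M. \<forall>z\<in>upper_half_ball s e'. cmod (T z) \<le> M"
proof -
  let ?B = "ball (of_real s) e :: complex set" and ?V = "upper_half_ball s e"
  have VB: "?V \<subseteq> ?B" by (auto simp: upper_half_ball_def)
  have slit: "g z \<notin> \<real>\<^sub>\<le>\<^sub>0" if "z \<in> ?B" for z using pos[OF that] by (auto simp: complex_nonpos_Reals_iff)
  have hs: "(\<lambda>z. csqrt (g z)) holomorphic_on ?B" by (intro holomorphic_intros g slit)
  obtain p where "\<forall>z\<in>?B. (p has_field_derivative csqrt (g z)) (at z within ?B)"
  proof (rule holomorphic_convex_primitive'[OF convex_ball open_ball hs])
    fix p assume "\<And>x. x \<in> ?B \<Longrightarrow> (p has_field_derivative csqrt (g x)) (at x within ?B)"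
    then show thesis by (intro that[of p]) simp
  qed
  then have p: "(p has_field_derivative csqrt (g z)) (at z)" if "z \<in> ?B" for z
    using that at_within_open[OF that open_ball] by metis
  have nz: "Re (deriv T z) \<noteq> 0" if z: "z \<in> ?V" for z
  proof
    assume "Re (deriv T z) = 0"
    then have "Re ((deriv T z)\<^sup>2) \<le> 0" by (simp add: power2_eq_square)
    then show False using T(2)[OF z] pos[of z] VB z by auto
  qed
  have "continuous_on ?V (\<lambda>z. Re (deriv T z))"
    by (intro continuous_on_Re holomorphic_on_imp_continuous_on holomorphic_deriv T(1) open_upper_half_ball)
  then have "connected ((\<lambda>z. Re (deriv T z)) ` ?V)"
    by (rule connected_continuous_image) (rule convex_connected[OF convex_upper_half_ball])
  then have sgn: "(\<forall>z\<in>?V. Re (deriv T z) > 0) \<or> (\<forall>z\<in>?V. Re (deriv T z) < 0)"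
    using nz unfolding connected_iff_interval by (smt (verit) imageE imageI)
  \<comment> \<open>The square of \<open>T'\<close> has positive real part, so \<open>Re T'\<close>
    has no zero on the connected half-disk. Hence \<open>T'\<close> is one fixed sign times the
    principal root of \<open>g\<close>, whose primitive \<open>p\<close> exists on the whole
    disk.\<close>
  obtain \<sigma> :: real where \<sigma>: "\<sigma> = 1 \<or> \<sigma> = -1" "\<And>z. z \<in> ?V \<Longrightarrow> 0 < \<sigma> * Re (deriv T z)"
    using sgn by (metis mult_1 mult_minus1 neg_0_less_iff_less)
  have dT: "csqrt (g z) = of_real \<sigma> * deriv T z" if "z \<in> ?V" for z
    using T(2)[OF that] \<sigma>(2)[OF that] \<sigma>(1) by (intro csqrt_unique) (auto simp: power_mult_distrib)
  have "\<exists>c. \<forall>z\<in>?V. of_real \<sigma> * T z - p z = c"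
  proof (rule has_field_derivative_zero_constant[OF convex_upper_half_ball])
    fix z assume z: "z \<in> ?V"
    have "((\<lambda>z. of_real \<sigma> * T z - p z) has_field_derivative of_real \<sigma> * deriv T z - csqrt (g z)) (at z)"
      using z VB by (intro DERIV_diff DERIV_cmult p holomorphic_derivI[OF T(1) open_upper_half_ball]) auto
    then show "((\<lambda>z. of_real \<sigma> * T z - p z) has_field_derivative 0) (at z within ?V)"
      unfolding dT[OF z] by (simp add: has_field_derivative_at_within)
  qed
  then obtain c where c: "\<And>z. z \<in> ?V \<Longrightarrow> of_real \<sigma> * T z = p z + c" by (metis diff_eq_eq add.commute)
  \<comment> \<open>On the axis \<open>g\<close> is positive, so its root is real and
    \<open>Im p\<close> has derivative 0 along the axis.\<close>
  have "\<exists>b. \<forall>u\<in>{s-e<..<s+e}. Im (p (of_real u)) = b"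
  proof (rule has_field_derivative_zero_constant)
    fix u assume u: "u \<in> {s-e<..<s+e}"
    then have uB: "of_real u \<in> ?B" by (auto simp: dist_of_real dist_real_def abs_less_iff)
    have "((\<lambda>u. p (of_real u)) has_vector_derivative csqrt (g (of_real u))) (at u)"
      using has_vector_derivative_real_field[OF p[OF uB]] by (simp add: o_def)
    then have "((\<lambda>u. Im (p (of_real u))) has_field_derivative Im (csqrt (g (of_real u)))) (at u)"
      by (rule has_field_derivative_Im)
    moreover have "Im (csqrt (g (of_real u))) = 0"
    proof -
      have "\<bar>u - s\<bar> < e" using u by (auto simp: abs_less_iff)
      then have "g (of_real u) = of_real (Re (g (of_real u)))" using sym by (simp add: complex_eq_iff)
      then show ?thesis using pos[OF uB] by (metis csqrt_of_real_nonneg Im_complex_of_real less_imp_le)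
    qed
    ultimately show "((\<lambda>u. Im (p (of_real u))) has_field_derivative 0) (at u within {s-e<..<s+e})"
      by (simp add: has_field_derivative_at_within del: csqrt.simps)
  qed simp
  then obtain b where b: "\<And>u. \<bar>u - s\<bar> < e \<Longrightarrow> Im (p (of_real u)) = b" by (auto simp: abs_less_iff)
  show thesis
  proof (rule that[of "\<sigma> * (b + Im c)"])
    fix u \<epsilon> :: real assume u: "\<bar>u - s\<bar> < e" and \<epsilon>: "0 < \<epsilon>"
    have uB: "of_real u \<in> ?B" using u by (simp add: dist_of_real dist_real_def abs_minus_commute)
    have "isCont p (of_real u)" using p[OF uB] by (rule DERIV_isCont)
    then obtain d where d: "d > 0" "\<And>z. dist z (of_real u) < d \<Longrightarrow> dist (p z) (p (of_real u)) < \<epsilon>"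
      using \<epsilon> unfolding continuous_at_eps_delta by blast
    have "\<bar>Im (T z) - \<sigma> * (b + Im c)\<bar> \<le> \<epsilon>" if z: "z \<in> ?V" "dist z (of_real u) < d" for z
    proof -
      have "\<sigma> * Im (T z) = Im (p z) + Im c" using arg_cong[OF c[OF z(1)], of Im] by simp
      then have "Im (T z) = \<sigma> * (Im (p z) + Im c)" using \<sigma>(1) by auto
      then have "\<bar>Im (T z) - \<sigma> * (b + Im c)\<bar> = \<bar>Im (p z) - Im (p (of_real u))\<bar>"
        using \<sigma>(1) b[OF u] by (auto simp: abs_minus_commute)
      also have "\<dots> \<le> cmod (p z - p (of_real u))" using abs_Im_le_cmod[of "p z - p (of_real u)"] by simp
      finally show ?thesis using d(2)[OF z(2)] by (simp add: dist_norm)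
    qed
    then show "\<exists>d>0. \<forall>z\<in>?V. dist z (of_real u) < d \<longrightarrow> \<bar>Im (T z) - \<sigma> * (b + Im c)\<bar> \<le> \<epsilon>" using d(1) by blast
  next
    fix e' assume e': "e' < e"
    have "continuous_on (cball (of_real s) e') p"
    proof (rule continuous_at_imp_continuous_on, rule ballI)
      fix x :: complex assume "x \<in> cball (of_real s) e'"
      then have "x \<in> ?B" using e' by simp
      then show "isCont p x" using p DERIV_isCont by blast
    qed
    then have "bounded (p ` cball (of_real s) e')" by (intro compact_imp_bounded compact_continuous_image) auto
    then obtain M where M: "\<forall>x\<in>cball (of_real s) e'. cmod (p x) \<le> M"
      unfolding bounded_iff by blast
    have "cmod (T z) \<le> M + cmod c" if z: "z \<in> upper_half_ball s e'" for z
    proof -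
      have "z \<in> ?V" "z \<in> cball (of_real s) e'" using z e' by (auto simp: upper_half_ball_def)
      then have "cmod (of_real \<sigma> * T z) \<le> M + cmod c"
        using c[of z] bspec[OF M, of z] norm_triangle_ineq[of "p z" c] by simp
      then show ?thesis using \<sigma>(1) by (auto simp: norm_mult)
    qed
    then show "\<exists>M. \<forall>z\<in>upper_half_ball s e'. cmod (T z) \<le> M" by blast
  qed
qed

text \<open>Two conformal changes of parameter are needed. The Cayley transform straightens the arc,
  and reflecting the two horizontal functions there shows that the square of \<open>T'\<close>,
  called \<open>g\<close>, is real analytic and nonnegative on the axis. Only afterwards can an
  interval be chosen on which \<open>g\<close> is positive; a second map makes this interval the
  diameter, and then all three functions are reflected.\<close>

lemma extension_across_arc:
  fixes X1 X2 T :: "complex \<Rightarrow> complex"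
  assumes hol: "X1 holomorphic_on unit_disk" "X2 holomorphic_on unit_disk" "T holomorphic_on unit_disk"
    and Im1: "\<And>w. w \<in> unit_disk \<Longrightarrow> Im (X1 w) = Re (f w)" and Im2: "\<And>w. w \<in> unit_disk \<Longrightarrow> Im (X2 w) = Im (f w)"
    and conf: "\<And>w. w \<in> unit_disk \<Longrightarrow> (deriv X1 w)\<^sup>2 + (deriv X2 w)\<^sup>2 = (deriv T w)\<^sup>2"
    and jac: "\<And>w. w \<in> unit_disk \<Longrightarrow> 0 < Im (deriv X1 w * cnj (deriv X2 w))"
    and nonconst: "\<not> T constant_on unit_disk"
    and a0: "cmod a0 = 1" and \<delta>: "0 < \<delta>"
    and arc: "\<And>a. cmod a = 1 \<Longrightarrow> dist a a0 < \<delta> \<Longrightarrow> (f \<longlongrightarrow> z0) (at a within unit_disk)"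
  obtains \<kappa> K1 K2 K3 q where "\<kappa> holomorphic_on upper_half_disk" "bij_betw \<kappa> upper_half_disk unit_disk"
    "K1 holomorphic_on unit_disk" "K2 holomorphic_on unit_disk" "K3 holomorphic_on unit_disk"
    "\<And>w. w \<in> upper_half_disk \<Longrightarrow> f (\<kappa> w) = z0 + Complex (Im (K1 w)) (Im (K2 w))"
    "\<And>w. w \<in> upper_half_disk \<Longrightarrow> T (\<kappa> w) = K3 w + \<i> * of_real q"
    "\<And>w. w \<in> unit_disk \<Longrightarrow> K1 (cnj w) = cnj (K1 w)" "\<And>w. w \<in> unit_disk \<Longrightarrow> K2 (cnj w) = cnj (K2 w)"
    "\<And>w. w \<in> unit_disk \<Longrightarrow> K3 (cnj w) = cnj (K3 w)"
    "\<And>w. w \<in> unit_disk \<Longrightarrow> (deriv K1 w)\<^sup>2 + (deriv K2 w)\<^sup>2 = (deriv K3 w)\<^sup>2"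
    "\<And>w. w \<in> upper_half_disk \<Longrightarrow> 0 < Im (deriv K1 w * cnj (deriv K2 w))"
    "\<And>w. w \<in> real_diameter \<Longrightarrow> deriv K3 w \<noteq> 0" "bounded (K3 ` real_diameter)"
proof -
  let ?H = "{\<zeta>. 0 < Im \<zeta>}"
  define L where "L = cayley a0"
  have openH: "open ?H" by (rule open_halfspace_Im_gt)
  have dL: "L field_differentiable (at \<zeta>)" if "0 \<le> Im \<zeta>" for \<zeta> using cayley_holomorphic[OF that] by (simp add: L_def)
  have holL: "L holomorphic_on ?H" using dL by (auto simp: holomorphic_on_def intro: field_differentiable_at_within)
  have Lbij: "bij_betw L ?H unit_disk" using cayley_bij[OF a0] by (simp add: L_def)
  have Lin: "L \<zeta> \<in> unit_disk" if "0 < Im \<zeta>" for \<zeta> using Lbij that by (auto simp: bij_betw_def)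
  have L0: "L 0 = a0" by (simp add: L_def cayley_def)
  obtain \<epsilon> where \<epsilon>: "\<epsilon> > 0" "\<And>\<zeta>. dist \<zeta> 0 < \<epsilon> \<Longrightarrow> dist (L \<zeta>) a0 < \<delta>"
  proof -
    have "isCont L 0" using field_differentiable_imp_continuous_at[OF dL[of 0]] by simp
    then show thesis using \<delta> that L0 unfolding continuous_at_eps_delta by metis
  qed
  have flim: "\<exists>d>0. \<forall>\<zeta>. 0 < Im \<zeta> \<longrightarrow> dist \<zeta> (of_real u) < d \<longrightarrow> cmod (f (L \<zeta>) - z0) < e"
    if u: "\<bar>u\<bar> < \<epsilon>" and e: "0 < e" for u e
  proof -
    have "dist (L (of_real u)) a0 < \<delta>" using u by (intro \<epsilon>(2)) simp
    moreover have n1: "cmod (L (of_real u)) = 1" using cayley_real[OF a0] by (simp add: L_def)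
    ultimately have "(f \<longlongrightarrow> z0) (at (L (of_real u)) within unit_disk)" by (intro arc)
    then obtain d1 where d1: "d1 > 0"
      "\<And>w. w \<in> unit_disk \<Longrightarrow> w \<noteq> L (of_real u) \<Longrightarrow> dist w (L (of_real u)) < d1 \<Longrightarrow> dist (f w) z0 < e"
      using e unfolding Lim_within by (metis zero_less_dist_iff)
    have "isCont L (of_real u)" using field_differentiable_imp_continuous_at[OF dL[of "of_real u"]] by simp
    then obtain d where d: "d > 0" "\<And>\<zeta>. dist \<zeta> (of_real u) < d \<Longrightarrow> dist (L \<zeta>) (L (of_real u)) < d1"
      using d1(1) unfolding continuous_at_eps_delta by blast
    have "cmod (f (L \<zeta>) - z0) < e" if "0 < Im \<zeta>" "dist \<zeta> (of_real u) < d" for \<zeta>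
    proof -
      have "L \<zeta> \<noteq> L (of_real u)" using Lin[OF that(1)] n1 by auto
      then show ?thesis using d1(2)[OF Lin[OF that(1)]] d(2)[OF that(2)] by (simp add: dist_norm)
    qed
    then show ?thesis using d(1) by blast
  qed
  have comp: "(\<lambda>\<zeta>. S (L \<zeta>)) holomorphic_on ?H" if "S holomorphic_on unit_disk" for S
  proof -
    have "(S \<circ> L) holomorphic_on ?H" by (rule holomorphic_on_compose_gen[OF holL that]) (use Lin in auto)
    then show ?thesis by (simp add: o_def)
  qed
  define A1 A2 where "A1 \<zeta> = X1 (L \<zeta>) - \<i> * of_real (Re z0)" and "A2 \<zeta> = X2 (L \<zeta>) - \<i> * of_real (Im z0)" for \<zeta>
  have hA: "A1 holomorphic_on ?H" "A2 holomorphic_on ?H"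
    unfolding A1_def A2_def by (intro holomorphic_intros comp hol)+
  have ImA: "Im (A1 \<zeta>) = Re (f (L \<zeta>) - z0)" "Im (A2 \<zeta>) = Im (f (L \<zeta>) - z0)" if "0 < Im \<zeta>" for \<zeta>
    using Im1[OF Lin[OF that]] Im2[OF Lin[OF that]] by (simp_all add: A1_def A2_def)
  have VH: "upper_half_ball c s \<subseteq> ?H" for c s by (auto simp: upper_half_ball_def)
  have bdA: "\<exists>d>0. \<forall>\<zeta>\<in>upper_half_ball 0 \<epsilon>. dist \<zeta> (of_real u) < d \<longrightarrow> \<bar>Im (A1 \<zeta>)\<bar> \<le> e \<and> \<bar>Im (A2 \<zeta>)\<bar> \<le> e"
    if u: "\<bar>u\<bar> < \<epsilon>" and e: "0 < e" for u e
  proof -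
    obtain d where d: "d > 0" "\<And>\<zeta>. 0 < Im \<zeta> \<Longrightarrow> dist \<zeta> (of_real u) < d \<Longrightarrow> cmod (f (L \<zeta>) - z0) < e"
      using flim[OF u e] by blast
    have "\<bar>Im (A1 \<zeta>)\<bar> \<le> e \<and> \<bar>Im (A2 \<zeta>)\<bar> \<le> e" if "\<zeta> \<in> upper_half_ball 0 \<epsilon>" "dist \<zeta> (of_real u) < d" for \<zeta>
    proof -
      have i: "0 < Im \<zeta>" using that by (simp add: upper_half_ball_def)
      show ?thesis using d(2)[OF i that(2)] abs_Re_le_cmod[of "f (L \<zeta>) - z0"] abs_Im_le_cmod[of "f (L \<zeta>) - z0"]
        unfolding ImA[OF i] by simp
    qed
    then show ?thesis using d(1) by blast
  qed
  have bdA1: "\<exists>d>0. \<forall>\<zeta>\<in>upper_half_ball 0 \<epsilon>. dist \<zeta> (of_real u) < d \<longrightarrow> \<bar>Im (A1 \<zeta>)\<bar> \<le> e"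
   and bdA2: "\<exists>d>0. \<forall>\<zeta>\<in>upper_half_ball 0 \<epsilon>. dist \<zeta> (of_real u) < d \<longrightarrow> \<bar>Im (A2 \<zeta>)\<bar> \<le> e"
    if "\<bar>u - 0\<bar> < \<epsilon>" "0 < e" for u e
    using bdA[of u e] that by (simp_all, blast+)
  let ?B = "ball 0 \<epsilon> :: complex set"
  obtain B1 where B1: "B1 holomorphic_on ?B" "\<And>w. w \<in> upper_half_ball 0 \<epsilon> \<Longrightarrow> B1 w = A1 w"
    "\<And>w. w \<in> ?B \<Longrightarrow> B1 (cnj w) = cnj (B1 w)"
    using Schwarz_reflection_Im[OF holomorphic_on_subset[OF hA(1) VH] \<epsilon>(1) bdA1] by (metis of_real_0)
  obtain B2 where B2: "B2 holomorphic_on ?B" "\<And>w. w \<in> upper_half_ball 0 \<epsilon> \<Longrightarrow> B2 w = A2 w"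
    "\<And>w. w \<in> ?B \<Longrightarrow> B2 (cnj w) = cnj (B2 w)"
    using Schwarz_reflection_Im[OF holomorphic_on_subset[OF hA(2) VH] \<epsilon>(1) bdA2] by (metis of_real_0)
  define g where "g \<zeta> = (deriv B1 \<zeta>)\<^sup>2 + (deriv B2 \<zeta>)\<^sup>2" for \<zeta>
  have hg: "g holomorphic_on ?B" unfolding g_def by (intro holomorphic_intros holomorphic_deriv B1 B2 open_ball)
  have dB: "deriv B1 \<zeta> = deriv X1 (L \<zeta>) * deriv L \<zeta>" "deriv B2 \<zeta> = deriv X2 (L \<zeta>) * deriv L \<zeta>"
      "deriv (\<lambda>\<zeta>. T (L \<zeta>)) \<zeta> = deriv T (L \<zeta>) * deriv L \<zeta>"
    if z: "\<zeta> \<in> upper_half_ball 0 \<epsilon>" for \<zeta>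
  proof -
    have i: "0 < Im \<zeta>" using z by (simp add: upper_half_ball_def)
    have l: "(L has_field_derivative deriv L \<zeta>) (at \<zeta>)" by (rule holomorphic_derivI[OF holL openH]) (use i in simp)
    have d: "((\<lambda>\<zeta>. S (L \<zeta>)) has_field_derivative deriv S (L \<zeta>) * deriv L \<zeta>) (at \<zeta>)" if "S holomorphic_on unit_disk" for S
      using DERIV_chain[OF holomorphic_derivI[OF that open_ball Lin[OF i]] l] by (simp add: o_def)
    have "(A1 has_field_derivative deriv X1 (L \<zeta>) * deriv L \<zeta>) (at \<zeta>)" "(A2 has_field_derivative deriv X2 (L \<zeta>) * deriv L \<zeta>) (at \<zeta>)"
      using DERIV_diff[OF d[OF hol(1)] DERIV_const] DERIV_diff[OF d[OF hol(2)] DERIV_const]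
      by (simp_all add: A1_def[abs_def] A2_def[abs_def])
    then have "(B1 has_field_derivative deriv X1 (L \<zeta>) * deriv L \<zeta>) (at \<zeta>)" "(B2 has_field_derivative deriv X2 (L \<zeta>) * deriv L \<zeta>) (at \<zeta>)"
      using has_field_derivative_transform_within_open[OF _ open_upper_half_ball z] B1(2) B2(2) by metis+
    then show "deriv B1 \<zeta> = deriv X1 (L \<zeta>) * deriv L \<zeta>" "deriv B2 \<zeta> = deriv X2 (L \<zeta>) * deriv L \<zeta>"
      "deriv (\<lambda>\<zeta>. T (L \<zeta>)) \<zeta> = deriv T (L \<zeta>) * deriv L \<zeta>"
      using DERIV_imp_deriv d[OF hol(3)] by blast+
  qed
  have sq: "(a * l)\<^sup>2 + (b * l)\<^sup>2 = (c * l)\<^sup>2" if "a\<^sup>2 + b\<^sup>2 = c\<^sup>2" for a b c l :: complex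
    using that by (metis distrib_right power_mult_distrib)
  have gT: "(deriv (\<lambda>\<zeta>. T (L \<zeta>)) \<zeta>)\<^sup>2 = g \<zeta>" if z: "\<zeta> \<in> upper_half_ball 0 \<epsilon>" for \<zeta>
  proof -
    have "L \<zeta> \<in> unit_disk" using z by (intro Lin) (simp add: upper_half_ball_def)
    from sq[OF conf[OF this]] show ?thesis unfolding g_def dB[OF z] by simp
  qed
  have symB: "cnj w \<in> ?B" if "w \<in> ?B" for w using that by simp
  have greal: "Im (g (of_real u)) = 0" if u: "\<bar>u\<bar> < \<epsilon>" for u
  proof -
    have uB: "of_real u \<in> ?B" using u by simp
    have "deriv B1 (of_real u) = cnj (deriv B1 (of_real u))" "deriv B2 (of_real u) = cnj (deriv B2 (of_real u))"
      using deriv_symmetric[OF B1(1) open_ball uB] deriv_symmetric[OF B2(1) open_ball uB] B1(3) B2(3) symB by simp_all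
    then show ?thesis by (simp add: g_def complex_eq_iff power2_eq_square)
  qed
  \<comment> \<open>If \<open>g\<close> vanished along the axis it would vanish identically, and
    \<open>T\<close> would be constant on the whole disk.\<close>
  obtain s where s: "\<bar>s\<bar> < \<epsilon>" "g (of_real s) \<noteq> 0"
  proof (rule ccontr)
    assume "\<not> thesis"
    then have z: "g (of_real u) = 0" if "\<bar>u\<bar> < \<epsilon>" for u using that \<open>\<And>s. \<bar>s\<bar> < \<epsilon> \<Longrightarrow> g (of_real s) \<noteq> 0 \<Longrightarrow> thesis\<close> by blast
    have lp: "0 islimpt complex_of_real ` {-\<epsilon><..<\<epsilon>}"
      unfolding islimpt_approachable
    proof (intro allI impI)
      fix e :: real assume "0 < e"
      define t where "t = min e \<epsilon> / 2"
      have t: "0 < t" "t < e" "t < \<epsilon>" using \<open>0 < e\<close> \<epsilon>(1) by (auto simp: t_def)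
      show "\<exists>x'\<in>complex_of_real ` {-\<epsilon><..<\<epsilon>}. x' \<noteq> 0 \<and> dist x' 0 < e"
      proof (intro bexI conjI)
        show "complex_of_real t \<in> complex_of_real ` {-\<epsilon><..<\<epsilon>}" using t by (intro imageI) simp
      qed (use t in auto)
    qed
    have g0: "g w = 0" if "w \<in> ?B" for w
      by (rule analytic_continuation[OF hg open_ball connected_ball _ _ lp _ that]) (use \<epsilon>(1) z in \<open>auto simp: abs_less_iff\<close>)
    let ?W = "L ` upper_half_ball 0 \<epsilon>"
    have "deriv T w = 0" if wW: "w \<in> ?W" for w
    proof -
      obtain \<zeta> where z: "\<zeta> \<in> upper_half_ball 0 \<epsilon>" "w = L \<zeta>" using wW by blast
      have "(deriv T (L \<zeta>) * deriv L \<zeta>)\<^sup>2 = 0" using gT[OF z(1)] g0[of \<zeta>] dB(3)[OF z(1)] z by (simp add: upper_half_ball_def)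
      moreover have "deriv L \<zeta> \<noteq> 0"
        by (rule holomorphic_injective_imp_regular[OF holL openH]) (use Lbij VH z in \<open>auto simp: bij_betw_def\<close>)
      ultimately show ?thesis using z by simp
    qed
    moreover have "open ?W"
      by (rule open_mapping_thm3[OF holomorphic_on_subset[OF holL VH] open_upper_half_ball])
        (use Lbij VH in \<open>auto simp: bij_betw_def intro: inj_on_subset\<close>)
    moreover have "?W \<noteq> {}"
    proof -
      have "Complex 0 (\<epsilon>/2) \<in> upper_half_ball 0 \<epsilon>" using \<epsilon>(1) by (simp add: upper_half_ball_def cmod_def)
      then show ?thesis by blast
    qed
    moreover have "?W \<subseteq> unit_disk" using Lin VH by blast
    ultimately have T0: "deriv T w = 0" if "w \<in> unit_disk" for w
      using analytic_continuation_open[of ?W unit_disk "deriv T" "\<lambda>_. 0" w]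
        holomorphic_deriv[OF hol(3) open_ball] that by simp
    have "\<exists>c. \<forall>w\<in>unit_disk. T w = c"
    proof (rule has_field_derivative_zero_constant[OF convex_ball])
      fix w assume w: "w \<in> unit_disk"
      from holomorphic_derivI[OF hol(3) open_ball w] show "(T has_field_derivative 0) (at w within unit_disk)"
        unfolding T0[OF w] by (rule has_field_derivative_at_within)
    qed
    then show False using nonconst by (auto simp: constant_on_def)
  qed
  have gs: "0 < Re (g (of_real s))"
  proof -
    have sB: "of_real s \<in> ?B" using s by simp
    have "deriv B1 (of_real s) = cnj (deriv B1 (of_real s))" "deriv B2 (of_real s) = cnj (deriv B2 (of_real s))"
      using deriv_symmetric[OF B1(1) open_ball sB] deriv_symmetric[OF B2(1) open_ball sB] B1(3) B2(3) symB by simp_all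
    then have "Re (g (of_real s)) \<ge> 0" by (simp add: g_def complex_eq_iff power2_eq_square)
    then show ?thesis using s(2) greal[OF s(1)] by (metis complex_eqI less_eq_real_def zero_complex.simps)
  qed
  obtain e where e: "0 < e" "ball (of_real s) e \<subseteq> ?B" "\<And>z. z \<in> ball (of_real s) e \<Longrightarrow> 0 < Re (g z)"
  proof -
    have "continuous_on ?B (\<lambda>z. Re (g z))" by (intro continuous_on_Re holomorphic_on_imp_continuous_on hg)
    then have "open ((\<lambda>z. Re (g z)) -` {0<..} \<inter> ?B)" by (metis continuous_on_open_vimage open_ball open_greaterThan)
    moreover have "of_real s \<in> (\<lambda>z. Re (g z)) -` {0<..} \<inter> ?B" using gs s by simp
    ultimately obtain e where "e > 0" "ball (of_real s) e \<subseteq> (\<lambda>z. Re (g z)) -` {0<..} \<inter> ?B"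
      using open_contains_ball by blast
    then show thesis by (intro that[of e]) auto
  qed
  have near_s: "\<bar>u\<bar> < \<epsilon>" if "\<bar>u - s\<bar> < e" for u
  proof -
    have "complex_of_real u \<in> ball (of_real s) e" using that by (simp add: dist_of_real dist_real_def abs_minus_commute)
    then have "complex_of_real u \<in> ?B" using e(2) by blast
    then show ?thesis by simp
  qed
  have Vsub: "upper_half_ball s e \<subseteq> upper_half_ball 0 \<epsilon>" using e(2) by (auto simp: upper_half_ball_def)
  obtain q where q: "\<And>u \<eta>. \<bar>u - s\<bar> < e \<Longrightarrow> 0 < \<eta> \<Longrightarrow>
     \<exists>d>0. \<forall>z\<in>upper_half_ball s e. dist z (of_real u) < d \<longrightarrow> \<bar>Im (T (L z)) - q\<bar> \<le> \<eta>"
    and Tbd: "\<And>e'. e' < e \<Longrightarrow> \<exists>M. \<forall>z\<in>upper_half_ball s e'. cmod (T (L z)) \<le> M"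
  proof (rule Im_limit_of_real_square[of g s e "\<lambda>\<zeta>. T (L \<zeta>)"])
    show "g holomorphic_on ball (of_real s) e" using hg e(2) by (rule holomorphic_on_subset)
    show "(\<lambda>\<zeta>. T (L \<zeta>)) holomorphic_on upper_half_ball s e" using comp[OF hol(3)] VH by (rule holomorphic_on_subset)
    show "(deriv (\<lambda>\<zeta>. T (L \<zeta>)) z)\<^sup>2 = g z" if "z \<in> upper_half_ball s e" for z using gT Vsub that by blast
  qed (use e greal near_s in auto)
  \<comment> \<open>On the smaller half-disk \<open>T\<close> is bounded. This makes
    \<open>K3\<close> bounded on the diameter and the vertical segment finite.\<close>
  define e2 where "e2 = e / 2"
  have e2: "0 < e2" "e2 < e" using e(1) by (auto simp: e2_def)
  obtain M where M: "\<And>z. z \<in> upper_half_ball s e2 \<Longrightarrow> cmod (T (L z)) \<le> M" using Tbd[OF e2(2)] by blast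
  define \<mu> where "\<mu> w = of_real s + of_real e2 * joukowski w" for w
  define \<kappa> where "\<kappa> w = L (\<mu> w)" for w
  have dmu: "(\<mu> has_field_derivative of_real e2 * (2 * (1 - w\<^sup>2) / (1 + w\<^sup>2)\<^sup>2)) (at w)" if "w \<in> unit_disk" for w
    unfolding \<mu>_def using DERIV_add[OF DERIV_const DERIV_cmult[OF joukowski_deriv[OF that]]] by simp
  have mu_pos: "0 < Im (\<mu> w) \<longleftrightarrow> 0 < Im w" if "w \<in> unit_disk" for w
    using joukowski_pos[OF that] e2(1) by (simp add: \<mu>_def zero_less_mult_iff)
  have hmu: "\<mu> holomorphic_on unit_disk" using dmu by (meson holomorphic_on_open open_ball)
  have mu_bij: "bij_betw \<mu> upper_half_disk ?H"
  proof -
    have "bij_betw (\<lambda>\<zeta>. of_real s + of_real e2 * \<zeta>) ?H ?H"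
      by (rule bij_betwI[where g = "\<lambda>\<zeta>. (\<zeta> - of_real s) / of_real e2"]) (use e2(1) in auto)
    from bij_betw_trans[OF joukowski_bij this] show ?thesis by (simp add: o_def \<mu>_def[abs_def])
  qed
  have uhd: "upper_half_disk \<subseteq> unit_disk" "open upper_half_disk"
    by (auto simp: upper_half_disk_eq open_upper_half_ball) (auto simp: upper_half_ball_def)
  have kbij: "bij_betw \<kappa> upper_half_disk unit_disk"
    using bij_betw_trans[OF mu_bij Lbij] by (simp add: o_def \<kappa>_def[abs_def])
  have khol: "\<kappa> holomorphic_on upper_half_disk"
  proof -
    have "(L \<circ> \<mu>) holomorphic_on upper_half_disk"
      by (rule holomorphic_on_compose_gen[OF holomorphic_on_subset[OF hmu uhd(1)] holL]) (use mu_bij in \<open>auto simp: bij_betw_def\<close>)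
    then show ?thesis by (simp add: o_def \<kappa>_def[abs_def])
  qed
  have kin: "\<kappa> w \<in> unit_disk" if "w \<in> upper_half_disk" for w using kbij that by (auto simp: bij_betw_def)
  have kcomp: "(\<lambda>w. S (\<kappa> w)) holomorphic_on upper_half_ball 0 1" if "S holomorphic_on unit_disk" for S
  proof -
    have "(S \<circ> \<kappa>) holomorphic_on upper_half_disk"
      by (rule holomorphic_on_compose_gen[OF khol that]) (use kin in auto)
    then show ?thesis by (simp add: o_def upper_half_disk_eq)
  qed
  have mu_real: "\<exists>v. \<mu> (of_real u) = of_real v \<and> \<bar>v - s\<bar> < e2" if u: "\<bar>u\<bar> < 1" for u
  proof -
    obtain v where v: "joukowski (of_real u) = of_real v" "\<bar>v\<bar> < 1" using joukowski_real[OF u] by blast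
    have "\<mu> (of_real u) = of_real (s + e2 * v)" by (simp add: \<mu>_def v)
    moreover have "\<bar>(s + e2 * v) - s\<bar> < e2" using v e2(1) by (simp add: abs_mult)
    ultimately show ?thesis by blast
  qed
  have mu_cont: "\<exists>d>0. \<forall>w. dist w (of_real u) < d \<longrightarrow> dist (\<mu> w) (\<mu> (of_real u)) < \<eta>" if "\<bar>u\<bar> < 1" "0 < \<eta>" for u \<eta>
  proof -
    have "isCont \<mu> (of_real u)" using dmu[of "of_real u"] that by (intro DERIV_isCont) auto
    then show ?thesis using that(2) unfolding continuous_at_eps_delta by blast
  qed
  have kf: "\<exists>d>0. \<forall>w\<in>upper_half_ball 0 1. dist w (of_real u) < d \<longrightarrow> cmod (f (\<kappa> w) - z0) < \<eta>" if u: "\<bar>u\<bar> < 1" and \<eta>: "0 < \<eta>" for u \<eta>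
  proof -
    obtain v where v: "\<mu> (of_real u) = of_real v" "\<bar>v - s\<bar> < e" using mu_real[OF u] e2(2) by force
    obtain d1 where d1: "d1 > 0" "\<And>\<zeta>. 0 < Im \<zeta> \<Longrightarrow> dist \<zeta> (of_real v) < d1 \<Longrightarrow> cmod (f (L \<zeta>) - z0) < \<eta>"
      using flim[OF near_s[OF v(2)] \<eta>] by blast
    obtain d where d: "d > 0" "\<And>w. dist w (of_real u) < d \<Longrightarrow> dist (\<mu> w) (\<mu> (of_real u)) < d1"
      using mu_cont[OF u d1(1)] by blast
    have "cmod (f (\<kappa> w) - z0) < \<eta>" if "w \<in> upper_half_ball 0 1" "dist w (of_real u) < d" for w
      unfolding \<kappa>_def using that d1(2)[of "\<mu> w"] d(2)[of w] mu_pos[of w] v by (simp add: upper_half_ball_def)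
    then show ?thesis using d(1) by blast
  qed
  have kT: "\<exists>d>0. \<forall>w\<in>upper_half_ball 0 1. dist w (of_real u) < d \<longrightarrow> \<bar>Im (T (\<kappa> w)) - q\<bar> \<le> \<eta>" if u: "\<bar>u\<bar> < 1" and \<eta>: "0 < \<eta>" for u \<eta>
  proof -
    obtain v where v: "\<mu> (of_real u) = of_real v" "\<bar>v - s\<bar> < e" using mu_real[OF u] e2(2) by force
    obtain d1 where d1: "d1 > 0" "\<And>z. z \<in> upper_half_ball s e \<Longrightarrow> dist z (of_real v) < d1 \<Longrightarrow> \<bar>Im (T (L z)) - q\<bar> \<le> \<eta>"
      using q[OF v(2) \<eta>] by blast
    obtain d where d: "d > 0" "\<And>w. dist w (of_real u) < d \<Longrightarrow> dist (\<mu> w) (\<mu> (of_real u)) < min d1 (e - \<bar>v - s\<bar>)"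
      using mu_cont[OF u, of "min d1 (e - \<bar>v - s\<bar>)"] d1(1) v by auto
    have "\<bar>Im (T (\<kappa> w)) - q\<bar> \<le> \<eta>" if w: "w \<in> upper_half_ball 0 1" "dist w (of_real u) < d" for w
    proof -
      have dv: "dist (\<mu> w) (of_real v) < min d1 (e - \<bar>v - s\<bar>)" using d(2)[OF w(2)] v by simp
      have "dist (of_real s) (\<mu> w) \<le> dist (of_real s) (of_real v :: complex) + dist (\<mu> w) (of_real v)"
        by (rule dist_triangle2)
      also have "dist (of_real s) (of_real v :: complex) = \<bar>v - s\<bar>" by (simp add: dist_of_real dist_real_def abs_minus_commute)
      finally have "dist (of_real s) (\<mu> w) < e" using dv by simp
      then have "\<mu> w \<in> upper_half_ball s e" using w mu_pos[of w] by (simp add: upper_half_ball_def)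
      from d1(2)[OF this] show ?thesis using dv by (simp add: \<kappa>_def)
    qed
    then show ?thesis using d(1) by blast
  qed
  define C1 C2 C3 where "C1 w = X1 (\<kappa> w) - \<i> * of_real (Re z0)" and "C2 w = X2 (\<kappa> w) - \<i> * of_real (Im z0)"
    and "C3 w = T (\<kappa> w) - \<i> * of_real q" for w
  have hC: "C1 holomorphic_on upper_half_ball 0 1" "C2 holomorphic_on upper_half_ball 0 1" "C3 holomorphic_on upper_half_ball 0 1"
    unfolding C1_def C2_def C3_def by (intro holomorphic_intros kcomp hol)+
  have ImC: "Im (C1 w) = Re (f (\<kappa> w) - z0)" "Im (C2 w) = Im (f (\<kappa> w) - z0)" if "w \<in> upper_half_ball 0 1" for w
    using Im1[OF kin] Im2[OF kin] that by (simp_all add: C1_def C2_def upper_half_disk_eq)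
  have bdC1: "\<exists>d>0. \<forall>w\<in>upper_half_ball 0 1. dist w (of_real u) < d \<longrightarrow> \<bar>Im (C1 w)\<bar> \<le> \<eta>"
    and bdC2: "\<exists>d>0. \<forall>w\<in>upper_half_ball 0 1. dist w (of_real u) < d \<longrightarrow> \<bar>Im (C2 w)\<bar> \<le> \<eta>"
    and bdC3: "\<exists>d>0. \<forall>w\<in>upper_half_ball 0 1. dist w (of_real u) < d \<longrightarrow> \<bar>Im (C3 w)\<bar> \<le> \<eta>"
    if u: "\<bar>u - 0\<bar> < 1" and \<eta>: "0 < \<eta>" for u \<eta>
  proof -
    obtain d where d: "d > 0" "\<And>w. w \<in> upper_half_ball 0 1 \<Longrightarrow> dist w (of_real u) < d \<Longrightarrow> cmod (f (\<kappa> w) - z0) < \<eta>"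
      using kf[of u \<eta>] u \<eta> by auto
    have "\<bar>Im (C1 w)\<bar> \<le> \<eta>" "\<bar>Im (C2 w)\<bar> \<le> \<eta>" if "w \<in> upper_half_ball 0 1" "dist w (of_real u) < d" for w
      unfolding ImC[OF that(1)] using d(2)[OF that] abs_Re_le_cmod[of "f (\<kappa> w) - z0"] abs_Im_le_cmod[of "f (\<kappa> w) - z0"] by simp_all
    then show "\<exists>d>0. \<forall>w\<in>upper_half_ball 0 1. dist w (of_real u) < d \<longrightarrow> \<bar>Im (C1 w)\<bar> \<le> \<eta>"
      "\<exists>d>0. \<forall>w\<in>upper_half_ball 0 1. dist w (of_real u) < d \<longrightarrow> \<bar>Im (C2 w)\<bar> \<le> \<eta>" using d(1) by blast+
    show "\<exists>d>0. \<forall>w\<in>upper_half_ball 0 1. dist w (of_real u) < d \<longrightarrow> \<bar>Im (C3 w)\<bar> \<le> \<eta>"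
      using kT[of u \<eta>] u \<eta> by (simp add: C3_def)
  qed
  obtain K1 where K1: "K1 holomorphic_on unit_disk" "\<And>w. w \<in> upper_half_ball 0 1 \<Longrightarrow> K1 w = C1 w"
    "\<And>w. w \<in> unit_disk \<Longrightarrow> K1 (cnj w) = cnj (K1 w)"
    using Schwarz_reflection_Im[OF hC(1) zero_less_one bdC1] by (metis of_real_0)
  obtain K2 where K2: "K2 holomorphic_on unit_disk" "\<And>w. w \<in> upper_half_ball 0 1 \<Longrightarrow> K2 w = C2 w"
    "\<And>w. w \<in> unit_disk \<Longrightarrow> K2 (cnj w) = cnj (K2 w)"
    using Schwarz_reflection_Im[OF hC(2) zero_less_one bdC2] by (metis of_real_0)
  obtain K3 where K3: "K3 holomorphic_on unit_disk" "\<And>w. w \<in> upper_half_ball 0 1 \<Longrightarrow> K3 w = C3 w"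
    "\<And>w. w \<in> unit_disk \<Longrightarrow> K3 (cnj w) = cnj (K3 w)"
    using Schwarz_reflection_Im[OF hC(3) zero_less_one bdC3] by (metis of_real_0)
  have dK: "deriv K1 w = deriv X1 (\<kappa> w) * deriv \<kappa> w \<and> deriv K2 w = deriv X2 (\<kappa> w) * deriv \<kappa> w \<and>
      deriv K3 w = deriv T (\<kappa> w) * deriv \<kappa> w"
    if w: "w \<in> upper_half_ball 0 1" for w
  proof -
    have wu: "w \<in> upper_half_disk" using w by (simp add: upper_half_disk_eq)
    have l: "(\<kappa> has_field_derivative deriv \<kappa> w) (at w)" by (rule holomorphic_derivI[OF khol uhd(2) wu])
    have d: "((\<lambda>w. S (\<kappa> w) - c) has_field_derivative deriv S (\<kappa> w) * deriv \<kappa> w) (at w)" if "S holomorphic_on unit_disk" for S c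
      using DERIV_diff[OF DERIV_chain[OF holomorphic_derivI[OF that open_ball kin[OF wu]] l] DERIV_const] by (simp add: o_def)
    have tr: "deriv K w = D" if "(C has_field_derivative D) (at w)" "\<And>w. w \<in> upper_half_ball 0 1 \<Longrightarrow> K w = C w" for K C D
      by (rule DERIV_imp_deriv, rule has_field_derivative_transform_within_open[OF that(1) open_upper_half_ball w]) (simp add: that(2))
    show ?thesis
      using tr[OF d[OF hol(1)], of K1] tr[OF d[OF hol(2)], of K2] tr[OF d[OF hol(3)], of K3] K1(2) K2(2) K3(2)
      by (simp add: C1_def C2_def C3_def)
  qed
  have conf_up: "(deriv K1 w)\<^sup>2 + (deriv K2 w)\<^sup>2 = (deriv K3 w)\<^sup>2" if w: "w \<in> upper_half_ball 0 1" for w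
  proof -
    have "\<kappa> w \<in> unit_disk" using kin w by (simp add: upper_half_disk_eq)
    from sq[OF conf[OF this]] show ?thesis using dK[OF w] by simp
  qed
  have ne: "upper_half_ball 0 1 \<noteq> {}"
  proof -
    have "Complex 0 (1/2) \<in> upper_half_ball 0 1" by (simp add: upper_half_ball_def cmod_def power2_eq_square)
    then show ?thesis by blast
  qed
  have conf_all: "(deriv K1 w)\<^sup>2 + (deriv K2 w)\<^sup>2 = (deriv K3 w)\<^sup>2" if w: "w \<in> unit_disk" for w
  proof (rule analytic_continuation_open[OF open_upper_half_ball open_ball ne connected_ball, where z = w
        and f = "\<lambda>w. (deriv K1 w)\<^sup>2 + (deriv K2 w)\<^sup>2" and g = "\<lambda>w. (deriv K3 w)\<^sup>2"])
    show "(\<lambda>w. (deriv K1 w)\<^sup>2 + (deriv K2 w)\<^sup>2) holomorphic_on unit_disk" "(\<lambda>w. (deriv K3 w)\<^sup>2) holomorphic_on unit_disk"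
      by (intro holomorphic_intros holomorphic_deriv K1 K2 K3 open_ball)+
  qed (use conf_up w uhd in \<open>auto simp: upper_half_disk_eq\<close>)
  show thesis
  proof (rule that[OF khol kbij K1(1) K2(1) K3(1) _ _ K1(3) K2(3) K3(3) conf_all])
    fix w assume "w \<in> upper_half_disk"
    then have w: "w \<in> upper_half_ball 0 1" by (simp add: upper_half_disk_eq)
    show "f (\<kappa> w) = z0 + Complex (Im (K1 w)) (Im (K2 w))"
      unfolding K1(2)[OF w] K2(2)[OF w] ImC[OF w] by (simp add: complex_eq_iff)
    show "T (\<kappa> w) = K3 w + \<i> * of_real q" using K3(2)[OF w] by (simp add: C3_def)
    have "deriv \<kappa> w \<noteq> 0"
      by (rule holomorphic_injective_imp_regular[OF khol uhd(2)]) (use kbij \<open>w \<in> upper_half_disk\<close> in \<open>auto simp: bij_betw_def\<close>)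
    then have "0 < (cmod (deriv \<kappa> w))\<^sup>2" by simp
    moreover have "Im (deriv K1 w * cnj (deriv K2 w)) = Im (deriv X1 (\<kappa> w) * cnj (deriv X2 (\<kappa> w))) * (cmod (deriv \<kappa> w))\<^sup>2"
    proof -
      have "deriv K1 w * cnj (deriv K2 w) = deriv X1 (\<kappa> w) * cnj (deriv X2 (\<kappa> w)) * (deriv \<kappa> w * cnj (deriv \<kappa> w))"
        using dK[OF w] by simp
      also have "\<dots> = deriv X1 (\<kappa> w) * cnj (deriv X2 (\<kappa> w)) * of_real ((cmod (deriv \<kappa> w))\<^sup>2)"
        by (simp only: complex_norm_square)
      finally show ?thesis by simp
    qed
    ultimately show "0 < Im (deriv K1 w * cnj (deriv K2 w))"
      using jac[OF kin[OF \<open>w \<in> upper_half_disk\<close>]] by simp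
  next
    \<comment> \<open>By analytic continuation across the diameter, \<open>K1\<close> and
      \<open>K2\<close> are \<open>B1\<close> and \<open>B2\<close> composed with \<mu>. So the
      square of \<open>deriv K3 w\<close> is \<open>g (\<mu> w)\<close> times the square of
      \<open>deriv \<mu> w\<close>, and neither factor vanishes.\<close>
    fix w assume "w \<in> real_diameter"
    then obtain u where u: "w = of_real u" "\<bar>u\<bar> < 1" by (auto simp: real_diameter_def)
    obtain v where v: "\<mu> w = of_real v" "\<bar>v - s\<bar> < e" using mu_real[OF u(2)] u e2(2) by force
    have wd: "w \<in> unit_disk" using u by simp
    define N where "N = \<mu> -` ball (of_real s) e \<inter> unit_disk"
    have "open N" unfolding N_def using continuous_on_open_vimage[OF open_ball] holomorphic_on_imp_continuous_on[OF hmu] open_ball by blast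
    moreover have "w \<in> N" using v wd by (simp add: N_def dist_of_real dist_real_def abs_minus_commute)
    ultimately obtain d where d: "d > 0" "ball w d \<subseteq> N" using open_contains_ball by blast
    have hB: "(\<lambda>w. B (\<mu> w)) holomorphic_on ball w d" if "B holomorphic_on ?B" for B
    proof -
      have "(B \<circ> \<mu>) holomorphic_on ball w d"
        by (rule holomorphic_on_compose_gen[OF holomorphic_on_subset[OF hmu] that]) (use d e in \<open>auto simp: N_def\<close>)
      then show ?thesis by (simp add: o_def)
    qed
    have sub1: "ball w d \<subseteq> unit_disk" using d by (auto simp: N_def)
    let ?V = "upper_half_ball u d"
    have V: "?V \<subseteq> ball w d" "?V \<noteq> {}" "?V \<subseteq> upper_half_ball 0 1"
    proof -
      show "?V \<subseteq> ball w d" by (auto simp: upper_half_ball_def u)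
      then show "?V \<subseteq> upper_half_ball 0 1" using sub1 by (auto simp: upper_half_ball_def)
      have "Complex u (d/2) \<in> ?V" using d(1) by (simp add: upper_half_ball_def dist_norm cmod_def)
      then show "?V \<noteq> {}" by blast
    qed
    have muV: "\<mu> x \<in> upper_half_ball 0 \<epsilon>" if "x \<in> ?V" for x
    proof -
      have "x \<in> N" "0 < Im x" using V that d by (auto simp: upper_half_ball_def)
      then show ?thesis using e(2) mu_pos[of x] by (auto simp: N_def upper_half_ball_def)
    qed
    have agree: "K x = B (\<mu> x)" if "K holomorphic_on unit_disk" "B holomorphic_on ?B" "\<And>y. y \<in> ?V \<Longrightarrow> K y = B (\<mu> y)" "x \<in> ball w d" for K B x
      by (rule analytic_continuation_open[OF open_upper_half_ball open_ball V(2) connected_ball V(1)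
          holomorphic_on_subset[OF that(1) sub1] hB[OF that(2)] that(3) that(4)])
    have dKB: "deriv K w = deriv B (\<mu> w) * deriv \<mu> w"
      if h: "K holomorphic_on unit_disk" "B holomorphic_on ?B" "\<And>y. y \<in> ?V \<Longrightarrow> K y = B (\<mu> y)" for K B
    proof -
      have "\<mu> w \<in> ?B" using \<open>w \<in> N\<close> e(2) by (auto simp: N_def)
      then have "((\<lambda>w. B (\<mu> w)) has_field_derivative deriv B (\<mu> w) * deriv \<mu> w) (at w)"
        using DERIV_chain[OF holomorphic_derivI[OF h(2) open_ball] holomorphic_derivI[OF hmu open_ball wd]] by (simp add: o_def)
      then have "(K has_field_derivative deriv B (\<mu> w) * deriv \<mu> w) (at w)"
        by (rule has_field_derivative_transform_within_open[OF _ open_ball[of w d]]) (use d agree[OF h] in auto)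
      then show ?thesis by (rule DERIV_imp_deriv)
    qed
    have E1: "K1 y = B1 (\<mu> y)" if "y \<in> ?V" for y
      using K1(2)[of y] V(3) that B1(2)[OF muV[OF that]] by (auto simp: C1_def A1_def \<kappa>_def)
    have E2: "K2 y = B2 (\<mu> y)" if "y \<in> ?V" for y
      using K2(2)[of y] V(3) that B2(2)[OF muV[OF that]] by (auto simp: C2_def A2_def \<kappa>_def)
    have k12: "deriv K1 w = deriv B1 (\<mu> w) * deriv \<mu> w" "deriv K2 w = deriv B2 (\<mu> w) * deriv \<mu> w"
      by (rule dKB[OF K1(1) B1(1) E1], assumption) (rule dKB[OF K2(1) B2(1) E2], assumption)
    have "(deriv K3 w)\<^sup>2 = g (\<mu> w) * (deriv \<mu> w)\<^sup>2"
      using conf_all[OF wd] unfolding k12 g_def by (simp add: power_mult_distrib distrib_right)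
    moreover have "g (\<mu> w) \<noteq> 0" using e(3)[of "\<mu> w"] \<open>w \<in> N\<close> by (auto simp: N_def)
    moreover have "deriv \<mu> w \<noteq> 0"
    proof -
      have "(1 - u\<^sup>2) \<noteq> 0" using u(2) by (simp add: abs_square_less_1 less_imp_neq[symmetric])
      then have "1 - w\<^sup>2 \<noteq> 0" unfolding u(1) by (metis of_real_1 of_real_diff of_real_eq_0_iff of_real_power)
      then show ?thesis using DERIV_imp_deriv[OF dmu[OF wd]] one_plus_square_nz[OF wd] e2(1) by simp
    qed
    ultimately show "deriv K3 w \<noteq> 0" by auto
  next
    \<comment> \<open>The bound holds for \<open>K3\<close> at points just above \<open>w\<close>
      and passes to \<open>w\<close> by continuity.\<close>
    have "cmod (K3 w) \<le> M + \<bar>q\<bar>" if w: "w \<in> real_diameter" for w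
    proof (rule ccontr)
      assume big: "\<not> ?thesis"
      from w obtain u where u: "w = of_real u" "\<bar>u\<bar> < 1" by (auto simp: real_diameter_def)
      obtain v where v: "\<mu> w = of_real v" "\<bar>v - s\<bar> < e2" using mu_real[OF u(2)] u by blast
      have wd: "w \<in> unit_disk" using u by simp
      obtain d1 where d1: "d1 > 0" "\<And>x. dist x w < d1 \<Longrightarrow> dist (\<mu> x) (\<mu> w) < e2 - \<bar>v - s\<bar>"
        using mu_cont[OF u(2), of "e2 - \<bar>v - s\<bar>"] v u(1) by auto
      have "isCont K3 w" using K3(1) wd by (meson continuous_on_eq_continuous_at holomorphic_on_imp_continuous_on open_ball)
      then obtain d2 where d2: "d2 > 0" "\<And>x. dist x w < d2 \<Longrightarrow> dist (K3 x) (K3 w) < cmod (K3 w) - (M + \<bar>q\<bar>)"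
        using big unfolding continuous_at_eps_delta by (metis diff_gt_0_iff_gt not_le)
      obtain d3 where d3: "d3 > 0" "ball w d3 \<subseteq> unit_disk" using wd open_contains_ball open_ball by blast
      define \<eta> where "\<eta> = min d1 (min d2 d3) / 2"
      have eta: "0 < \<eta>" "\<eta> < d1" "\<eta> < d2" "\<eta> < d3" using d1 d2 d3 by (auto simp: \<eta>_def)
      define x where "x = Complex u \<eta>"
      have dx: "dist x w = \<eta>" using eta(1) by (simp add: x_def u dist_norm cmod_def)
      have xd: "x \<in> unit_disk" using d3(2) dx eta by (auto simp: dist_commute)
      have ix: "0 < Im x" using eta by (simp add: x_def)
      then have x: "x \<in> upper_half_ball 0 1" using xd by (simp add: upper_half_ball_def)
      have "dist (of_real s) (\<mu> x) \<le> dist (of_real s) (of_real v :: complex) + dist (\<mu> x) (of_real v)"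
        by (rule dist_triangle2)
      moreover have "dist (of_real s) (of_real v :: complex) = \<bar>v - s\<bar>" by (simp add: dist_of_real dist_real_def abs_minus_commute)
      ultimately have "dist (of_real s) (\<mu> x) < e2" using d1(2)[of x] dx eta v by simp
      then have "\<mu> x \<in> upper_half_ball s e2" using mu_pos[OF xd] ix by (simp add: upper_half_ball_def)
      from M[OF this] have "cmod (K3 x) \<le> M + \<bar>q\<bar>"
        using K3(2)[OF x] norm_triangle_ineq4[of "T (\<kappa> x)" "\<i> * of_real q"] by (simp add: C3_def \<kappa>_def norm_mult)
      moreover have "dist (K3 x) (K3 w) < cmod (K3 w) - (M + \<bar>q\<bar>)" using d2(2)[of x] dx eta by simp
      ultimately show False using norm_triangle_ineq2[of "K3 w" "K3 x"] by (simp add: dist_norm norm_minus_commute)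
    qed
    then show "bounded (K3 ` real_diameter)" unfolding bounded_iff by blast
  qed
qed

section \<open>Surfaces given by real parts\<close>

lemma C1_onI:
  assumes "\<And>w. w \<in> S \<Longrightarrow> (g has_derivative (\<lambda>h. Re h *\<^sub>R gx w + Im h *\<^sub>R gy w)) (at w)"
    and "continuous_on S gx" "continuous_on S gy"
  shows "C1_on S g"
proof -
  have e: "pdx g w = gx w" "pdy g w = gy w" if "w \<in> S" for w using pd_eq[OF assms(1)[OF that]] by simp_all
  have "continuous_on S (pdx g) \<longleftrightarrow> continuous_on S gx" by (rule continuous_on_cong[OF refl e(1)])
  moreover have "continuous_on S (pdy g) \<longleftrightarrow> continuous_on S gy" by (rule continuous_on_cong[OF refl e(2)])
  moreover have "g differentiable (at w)" if "w \<in> S" for w using assms(1)[OF that] by (rule differentiableI)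
  ultimately show ?thesis using assms(2,3) by (simp add: C1_on_def)
qed

lemma C1_onD:
  assumes "C1_on S g"
  shows "w \<in> S \<Longrightarrow> (g has_derivative (\<lambda>h. Re h *\<^sub>R pdx g w + Im h *\<^sub>R pdy g w)) (at w)"
    "continuous_on S (pdx g)" "continuous_on S (pdy g)"
  using assms by (auto simp: C1_on_def has_derivative_pd)

lemma C1_on_imp_continuous_on: "C1_on S g \<Longrightarrow> continuous_on S g"
  by (meson C1_onD(1) continuous_at_imp_continuous_on has_derivative_continuous)

lemma C1_on_const: "C1_on S (\<lambda>w. c)"
  by (rule C1_onI[where gx = "\<lambda>w. 0" and gy = "\<lambda>w. 0"]) auto

lemma C1_on_add:
  assumes "C1_on S g" "C1_on S h"
  shows "C1_on S (\<lambda>w. g w + h w)"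
proof (rule C1_onI[where gx = "\<lambda>w. pdx g w + pdx h w" and gy = "\<lambda>w. pdy g w + pdy h w"])
  show "((\<lambda>w. g w + h w) has_derivative (\<lambda>v. Re v *\<^sub>R (pdx g w + pdx h w) + Im v *\<^sub>R (pdy g w + pdy h w))) (at w)"
    if "w \<in> S" for w
    by (rule has_derivative_eq_rhs[OF has_derivative_add[OF C1_onD(1)[OF assms(1) that] C1_onD(1)[OF assms(2) that]]])
      (simp add: fun_eq_iff algebra_simps)
qed (intro continuous_intros C1_onD assms)+

lemma C1_on_mult:
  fixes g h :: "complex \<Rightarrow> real"
  assumes "C1_on S g" "C1_on S h"
  shows "C1_on S (\<lambda>w. g w * h w)"
proof (rule C1_onI[where gx = "\<lambda>w. g w * pdx h w + pdx g w * h w" and gy = "\<lambda>w. g w * pdy h w + pdy g w * h w"])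
  show "((\<lambda>w. g w * h w) has_derivative (\<lambda>v. Re v *\<^sub>R (g w * pdx h w + pdx g w * h w) + Im v *\<^sub>R (g w * pdy h w + pdy g w * h w))) (at w)"
    if "w \<in> S" for w
    by (rule has_derivative_eq_rhs[OF has_derivative_mult[OF C1_onD(1)[OF assms(1) that] C1_onD(1)[OF assms(2) that]]])
      (simp add: fun_eq_iff algebra_simps)
qed (intro continuous_intros C1_onD C1_on_imp_continuous_on assms)+

lemma C1_on_inverse:
  fixes g :: "complex \<Rightarrow> real"
  assumes "C1_on S g" "\<And>w. w \<in> S \<Longrightarrow> g w \<noteq> 0"
  shows "C1_on S (\<lambda>w. inverse (g w))"
proof (rule C1_onI[where gx = "\<lambda>w. - (inverse (g w) * pdx g w * inverse (g w))" and gy = "\<lambda>w. - (inverse (g w) * pdy g w * inverse (g w))"])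
  show "((\<lambda>w. inverse (g w)) has_derivative (\<lambda>v. Re v *\<^sub>R - (inverse (g w) * pdx g w * inverse (g w)) + Im v *\<^sub>R - (inverse (g w) * pdy g w * inverse (g w)))) (at w)"
    if "w \<in> S" for w
    by (rule has_derivative_eq_rhs[OF Deriv.has_derivative_inverse[OF assms(2)[OF that] C1_onD(1)[OF assms(1) that]]])
      (simp add: fun_eq_iff algebra_simps)
qed (use assms in \<open>intro continuous_intros C1_onD C1_on_imp_continuous_on assms; simp\<close>)+

text \<open>Common form of the four surfaces. It constrains \<open>S\<close> on the unit disk only,
  because an arbitrary conjugate of \<open>F\<close> is determined there and nowhere else.\<close>

definition real_part_surface ::
    "(complex \<Rightarrow> complex \<times> real) \<Rightarrow> (complex \<Rightarrow> complex) \<Rightarrow> (complex \<Rightarrow> complex) \<Rightarrow> (complex \<Rightarrow> complex) \<Rightarrow> bool" where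
  "real_part_surface S M1 M2 M3 \<longleftrightarrow>
     M1 holomorphic_on unit_disk \<and> M2 holomorphic_on unit_disk \<and> M3 holomorphic_on unit_disk \<and>
     (\<forall>w\<in>unit_disk. S w = (Complex (Re (M1 w)) (Re (M2 w)), Re (M3 w)))"

section \<open>Derivatives, harmonicity and conformality of real-part surfaces\<close>

context
  fixes S M1 M2 M3 assumes S: "real_part_surface S M1 M2 M3"
begin

lemma rps_derivs:
  assumes w: "w \<in> unit_disk"
  shows "(M1 has_field_derivative deriv M1 w) (at w)" "(M2 has_field_derivative deriv M2 w) (at w)"
    "(M3 has_field_derivative deriv M3 w) (at w)"
  using holomorphic_derivI[OF _ open_ball w] S by (auto simp: real_part_surface_def)

lemma rps_has_derivative:
  assumes w: "w \<in> unit_disk"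
  shows "(S has_derivative (\<lambda>h. (Complex (Re (deriv M1 w * h)) (Re (deriv M2 w * h)), Re (deriv M3 w * h)))) (at w)"
proof -
  note d = rps_derivs[OF w, unfolded has_field_derivative_def]
  have "((\<lambda>w. (of_real (Re (M1 w)) + \<i> * of_real (Re (M2 w)), Re (M3 w))) has_derivative
      (\<lambda>h. (of_real (Re (deriv M1 w * h)) + \<i> * of_real (Re (deriv M2 w * h)), Re (deriv M3 w * h)))) (at w)"
    by (intro has_derivative_Pair has_derivative_add has_derivative_mult_right has_derivative_of_real has_derivative_Re d)
  then have "((\<lambda>w. (Complex (Re (M1 w)) (Re (M2 w)), Re (M3 w))) has_derivative
      (\<lambda>h. (Complex (Re (deriv M1 w * h)) (Re (deriv M2 w * h)), Re (deriv M3 w * h)))) (at w)"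
    by (simp add: Complex_eq)
  then show ?thesis
    by (rule has_derivative_transform_within_open[OF _ open_ball w]) (use S in \<open>auto simp: real_part_surface_def\<close>)
qed

lemma rps_pd:
  assumes w: "w \<in> unit_disk"
  shows "pdx S w = (Complex (Re (deriv M1 w)) (Re (deriv M2 w)), Re (deriv M3 w))"
    "pdy S w = (Complex (- Im (deriv M1 w)) (- Im (deriv M2 w)), - Im (deriv M3 w))"
    "S differentiable (at w)"
  using pd_eq[OF rps_has_derivative[OF w]] rps_has_derivative[OF w] by (auto simp: differentiable_def)

lemma rps_pd_surface:
  "real_part_surface (pdx S) (deriv M1) (deriv M2) (deriv M3)"
  "real_part_surface (pdy S) (\<lambda>w. \<i> * deriv M1 w) (\<lambda>w. \<i> * deriv M2 w) (\<lambda>w. \<i> * deriv M3 w)"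
proof -
  have "deriv M1 holomorphic_on unit_disk" "deriv M2 holomorphic_on unit_disk" "deriv M3 holomorphic_on unit_disk"
    using S by (auto simp: real_part_surface_def intro!: holomorphic_deriv)
  then show "real_part_surface (pdx S) (deriv M1) (deriv M2) (deriv M3)"
    "real_part_surface (pdy S) (\<lambda>w. \<i> * deriv M1 w) (\<lambda>w. \<i> * deriv M2 w) (\<lambda>w. \<i> * deriv M3 w)"
    using rps_pd by (auto simp: real_part_surface_def intro!: holomorphic_intros)
qed

end

lemma rps_continuous: "real_part_surface S M1 M2 M3 \<Longrightarrow> continuous_on unit_disk S"
  by (meson rps_has_derivative continuous_at_imp_continuous_on has_derivative_continuous)

lemma rps_C1: "real_part_surface S M1 M2 M3 \<Longrightarrow> C1_on unit_disk S"
  unfolding C1_on_def using rps_continuous rps_pd_surface rps_pd(3) by blast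

lemma rps_harmonic:
  assumes S: "real_part_surface S M1 M2 M3"
  shows "harmonic_on unit_disk S"
proof -
  have "pdx (pdx S) w + pdy (pdy S) w = 0" if w: "w \<in> unit_disk" for w
  proof -
    have d: "deriv (\<lambda>w. \<i> * deriv M w) w = \<i> * deriv (deriv M) w" if "M holomorphic_on unit_disk" for M
      by (rule DERIV_imp_deriv, rule DERIV_cmult, rule holomorphic_derivI[OF holomorphic_deriv[OF that open_ball] open_ball w])
    have "M1 holomorphic_on unit_disk" "M2 holomorphic_on unit_disk" "M3 holomorphic_on unit_disk"
      using S by (auto simp: real_part_surface_def)
    then show ?thesis
      unfolding rps_pd(1)[OF rps_pd_surface(1)[OF S] w] rps_pd(2)[OF rps_pd_surface(2)[OF S] w]
      by (simp add: d complex_eq_iff zero_prod_def)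
  qed
  then show ?thesis
    using rps_C1[OF S] rps_C1[OF rps_pd_surface(1)[OF S]] rps_C1[OF rps_pd_surface(2)[OF S]]
    by (simp add: harmonic_on_def C2_on_def)
qed

text \<open>The radius is the distance to the unit circle. At \<open>p = 0\<close> the coordinate
  covers the whole disk, so that the folding singularity found there is the image of the entire
  diameter.\<close>

lemma translation_coordinate:
  assumes p: "p \<in> unit_disk"
  shows "complex_coordinate unit_disk p (ball 0 (1 - cmod p)) (\<lambda>w. p + w)"
proof -
  have "p + w \<in> unit_disk" if "w \<in> ball 0 (1 - cmod p)" for w
    using that norm_triangle_ineq[of p w] by simp
  then have "(\<lambda>w. p + w) ` ball 0 (1 - cmod p) \<subseteq> unit_disk" by blast
  moreover have "(\<lambda>w. p + w) holomorphic_on ball 0 (1 - cmod p)" by (intro holomorphic_intros)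
  ultimately show ?thesis using p unfolding complex_coordinate_def by (intro conjI) (auto simp: inj_on_def)
qed

lemma rps_translated:
  assumes S: "real_part_surface S M1 M2 M3" and w: "p + w \<in> unit_disk"
  shows "pdx (S \<circ> (\<lambda>w. p + w)) w = pdx S (p + w)" "pdy (S \<circ> (\<lambda>w. p + w)) w = pdy S (p + w)"
    "Phi1 (S \<circ> (\<lambda>w. p + w)) w = deriv M1 (p + w) / 2" "Phi2 (S \<circ> (\<lambda>w. p + w)) w = deriv M2 (p + w) / 2"
    "Phi3 (S \<circ> (\<lambda>w. p + w)) w = deriv M3 (p + w) / 2"
proof -
  have t: "((\<lambda>w. p + w) has_derivative (\<lambda>h. h)) (at w)" by (auto intro!: derivative_eq_intros)
  let ?D = "\<lambda>h. (Complex (Re (deriv M1 (p + w) * h)) (Re (deriv M2 (p + w) * h)), Re (deriv M3 (p + w) * h))"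
  have D: "(S \<circ> (\<lambda>w. p + w) has_derivative ?D) (at w)"
    using diff_chain_at[OF t rps_has_derivative[OF S w]] by (simp add: o_def)
  show "pdx (S \<circ> (\<lambda>w. p + w)) w = pdx S (p + w)" "pdy (S \<circ> (\<lambda>w. p + w)) w = pdy S (p + w)"
    using pd_eq[OF D] rps_pd[OF S w] by simp_all
  have 1: "((\<lambda>w. Re (fst ((S \<circ> (\<lambda>w. p + w)) w))) has_derivative (\<lambda>h. Re (fst (?D h)))) (at w)"
    by (intro has_derivative_Re has_derivative_fst D)
  have 2: "((\<lambda>w. Im (fst ((S \<circ> (\<lambda>w. p + w)) w))) has_derivative (\<lambda>h. Im (fst (?D h)))) (at w)"
    by (intro has_derivative_Im has_derivative_fst D)
  have 3: "((\<lambda>w. snd ((S \<circ> (\<lambda>w. p + w)) w)) has_derivative (\<lambda>h. snd (?D h))) (at w)"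
    by (intro has_derivative_snd D)
  show "Phi1 (S \<circ> (\<lambda>w. p + w)) w = deriv M1 (p + w) / 2" "Phi2 (S \<circ> (\<lambda>w. p + w)) w = deriv M2 (p + w) / 2"
    "Phi3 (S \<circ> (\<lambda>w. p + w)) w = deriv M3 (p + w) / 2"
    unfolding Phi1_def Phi2_def Phi3_def wirtinger_def pd_eq[OF 1] pd_eq[OF 2] pd_eq[OF 3]
    by (simp_all add: complex_eq_iff)
qed

lemma rps_not_constant:
  assumes S: "real_part_surface S M1 M2 M3" and w: "w \<in> unit_disk" and nz: "deriv M3 w \<noteq> 0"
  shows "\<not> S constant_on unit_disk"
proof
  assume "S constant_on unit_disk"
  then obtain c where c: "\<And>w. w \<in> unit_disk \<Longrightarrow> S w = c" by (auto simp: constant_on_def)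
  have "((\<lambda>w. c) has_derivative (\<lambda>h. 0)) (at w)" by simp
  then have "(S has_derivative (\<lambda>h. 0)) (at w)"
    by (rule has_derivative_transform_within_open[OF _ open_ball w]) (simp add: c)
  from pd_eq[OF this] rps_pd[OF S w] show False using nz by (auto simp: zero_prod_def complex_eq_iff)
qed

lemma rps_minimal:
  assumes S: "real_part_surface S M1 M2 M3" and nz: "\<exists>w\<in>unit_disk. deriv M3 w \<noteq> 0"
    and conf: "\<And>w. w \<in> unit_disk \<Longrightarrow> (deriv M1 w)\<^sup>2 + (deriv M2 w)\<^sup>2 + (deriv M3 w)\<^sup>2 = 0"
  shows "generalized_minimal_surface unit_disk S"
  unfolding generalized_minimal_surface_def
proof (intro conjI ballI rps_harmonic[OF S])
  show "\<not> S constant_on unit_disk" using nz rps_not_constant[OF S] by blast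
  fix p assume p: "p \<in> unit_disk"
  have "(Phi1 (S \<circ> (\<lambda>w. p + w)) w)\<^sup>2 + (Phi2 (S \<circ> (\<lambda>w. p + w)) w)\<^sup>2 + (Phi3 (S \<circ> (\<lambda>w. p + w)) w)\<^sup>2 = 0"
    if w: "w \<in> ball 0 (1 - cmod p)" for w
  proof -
    have pw: "p + w \<in> unit_disk" using w norm_triangle_ineq[of p w] by simp
    have "(deriv M1 (p + w) / 2)\<^sup>2 + (deriv M2 (p + w) / 2)\<^sup>2 + (deriv M3 (p + w) / 2)\<^sup>2
      = ((deriv M1 (p + w))\<^sup>2 + (deriv M2 (p + w))\<^sup>2 + (deriv M3 (p + w))\<^sup>2) / 4" by (simp add: power_divide)
    then show ?thesis unfolding rps_translated[OF S pw] conf[OF pw] by simp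
  qed
  then show "\<exists>V \<xi>. complex_coordinate unit_disk p V \<xi> \<and>
      (\<forall>w\<in>V. (Phi1 (S \<circ> \<xi>) w)\<^sup>2 + (Phi2 (S \<circ> \<xi>) w)\<^sup>2 + (Phi3 (S \<circ> \<xi>) w)\<^sup>2 = 0)"
    using translation_coordinate[OF p] by blast
qed

text \<open>The difference between the square of \<open>(cmod a)\<^sup>2 + (cmod b)\<^sup>2\<close>
  and that of \<open>cmod (a\<^sup>2 + b\<^sup>2)\<close> is four times the square of
  \<open>Im (a * cnj b)\<close>. So a generalized maximal surface degenerates only where the
  horizontal Jacobian vanishes.\<close>

lemma isotropic_norms:
  fixes a b c :: complex
  assumes "a\<^sup>2 + b\<^sup>2 = c\<^sup>2" "(cmod a)\<^sup>2 + (cmod b)\<^sup>2 = (cmod c)\<^sup>2"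
  shows "Im (a * cnj b) = 0"
proof -
  have "(cmod (a\<^sup>2 + b\<^sup>2))\<^sup>2 + 4 * (Im (a * cnj b))\<^sup>2 = ((cmod a)\<^sup>2 + (cmod b)\<^sup>2)\<^sup>2"
    unfolding cmod_power2 by (simp add: power2_eq_square algebra_simps)
  moreover have "(cmod (a\<^sup>2 + b\<^sup>2))\<^sup>2 = ((cmod c)\<^sup>2)\<^sup>2" using assms(1) by (simp add: norm_power)
  ultimately show ?thesis using assms(2) by simp
qed

lemma rps_maximal:
  assumes S: "real_part_surface S M1 M2 M3" and nz: "\<exists>w\<in>unit_disk. deriv M3 w \<noteq> 0"
    and conf: "\<And>w. w \<in> unit_disk \<Longrightarrow> (deriv M1 w)\<^sup>2 + (deriv M2 w)\<^sup>2 = (deriv M3 w)\<^sup>2"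
    and jac: "\<And>w. w \<in> upper_half_disk \<Longrightarrow> Im (deriv M1 w * cnj (deriv M2 w)) \<noteq> 0"
      "\<And>w. w \<in> upper_half_disk \<Longrightarrow> Im (deriv M1 (cnj w) * cnj (deriv M2 (cnj w))) \<noteq> 0"
  shows "generalized_maximal_surface unit_disk S"
  unfolding generalized_maximal_surface_def
proof (intro conjI ballI rps_harmonic[OF S])
  show "\<not> S constant_on unit_disk" using nz rps_not_constant[OF S] by blast
  fix p assume p: "p \<in> unit_disk"
  let ?V = "ball 0 (1 - cmod p) :: complex set"
  have pw: "p + w \<in> unit_disk" if "w \<in> ?V" for w using that norm_triangle_ineq[of p w] by simp
  have A: "(Phi1 (S \<circ> (\<lambda>w. p + w)) w)\<^sup>2 + (Phi2 (S \<circ> (\<lambda>w. p + w)) w)\<^sup>2 - (Phi3 (S \<circ> (\<lambda>w. p + w)) w)\<^sup>2 = 0"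
    if w: "w \<in> ?V" for w
  proof -
    have "(deriv M1 (p + w) / 2)\<^sup>2 + (deriv M2 (p + w) / 2)\<^sup>2 - (deriv M3 (p + w) / 2)\<^sup>2
      = ((deriv M1 (p + w))\<^sup>2 + (deriv M2 (p + w))\<^sup>2 - (deriv M3 (p + w))\<^sup>2) / 4" by (simp add: power_divide)
    then show ?thesis unfolding rps_translated[OF S pw[OF w]] conf[OF pw[OF w]] by simp
  qed
  \<comment> \<open>One nondegenerate point in the coordinate neighbourhood suffices, and off the
    real axis the Jacobian is nonzero.\<close>
  obtain v where v: "v \<in> ?V" "Im (p + v) \<noteq> 0"
  proof (cases "Im p = 0")
    case True
    define e where "e = (1 - cmod p) / 2"
    have e: "0 < e" "e < 1 - cmod p" using p by (auto simp: e_def field_simps)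
    show thesis using True e by (intro that[of "\<i> * of_real e"]) (simp_all add: norm_mult)
  next
    case False
    then show thesis using p by (intro that[of 0]) auto
  qed
  have J: "Im (deriv M1 (p + v) * cnj (deriv M2 (p + v))) \<noteq> 0"
  proof (cases "0 < Im (p + v)")
    case True
    then show ?thesis using pw[OF v(1)] by (intro jac(1)) (simp add: upper_half_disk_def)
  next
    case False
    then have "cnj (p + v) \<in> upper_half_disk" using pw[OF v(1)] v(2)
      by (simp add: upper_half_disk_def complex_mod_cnj del: complex_cnj_add)
    from jac(2)[OF this] show ?thesis by simp
  qed
  have "(cmod (Phi1 (S \<circ> (\<lambda>w. p + w)) v))\<^sup>2 + (cmod (Phi2 (S \<circ> (\<lambda>w. p + w)) v))\<^sup>2 - (cmod (Phi3 (S \<circ> (\<lambda>w. p + w)) v))\<^sup>2 \<noteq> 0"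
    using isotropic_norms[OF conf[OF pw[OF v(1)]]] J unfolding rps_translated[OF S pw[OF v(1)]]
    by (auto simp: norm_divide power_divide simp flip: add_divide_distrib diff_divide_distrib)
  then show "\<exists>V \<xi>. complex_coordinate unit_disk p V \<xi> \<and>
        (\<forall>w\<in>V. (Phi1 (S \<circ> \<xi>) w)\<^sup>2 + (Phi2 (S \<circ> \<xi>) w)\<^sup>2 - (Phi3 (S \<circ> \<xi>) w)\<^sup>2 = 0) \<and>
        (\<exists>w\<in>V. (cmod (Phi1 (S \<circ> \<xi>) w))\<^sup>2 + (cmod (Phi2 (S \<circ> \<xi>) w))\<^sup>2 - (cmod (Phi3 (S \<circ> \<xi>) w))\<^sup>2 \<noteq> 0)"
    using translation_coordinate[OF p] A v(1) by blast
qed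

lemma rps_real_curve:
  assumes S: "real_part_surface S M1 M2 M3" and u: "of_real u \<in> unit_disk"
  shows "((\<lambda>u. S (of_real u)) has_vector_derivative pdx S (of_real u)) (at u)"
proof -
  have "((\<lambda>u. complex_of_real u) has_derivative (\<lambda>t. of_real t)) (at u)" by (auto intro!: derivative_eq_intros)
  from diff_chain_at[OF this rps_has_derivative[OF S u]]
  have "((\<lambda>u. S (of_real u)) has_derivative (\<lambda>t. (Complex (Re (deriv M1 (of_real u) * of_real t))
      (Re (deriv M2 (of_real u) * of_real t)), Re (deriv M3 (of_real u) * of_real t)))) (at u)" by (simp add: o_def)
  then show ?thesis unfolding has_vector_derivative_def rps_pd(1)[OF S u]
    by (rule has_derivative_eq_rhs) (auto simp: fun_eq_iff complex_eq_iff)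
qed

text \<open>The surfaces are built from \<open>Im K1\<close>, \<open>Im K2\<close> and
  \<open>Re K3\<close> or \<open>Im K3\<close>, and the conjugates from the complementary parts.
  Real values of the three functions on the diameter are the source of every symmetry and
  singularity.\<close>

locale reflected_surface =
  fixes K1 K2 K3 :: "complex \<Rightarrow> complex"
  assumes hol: "K1 holomorphic_on unit_disk" "K2 holomorphic_on unit_disk" "K3 holomorphic_on unit_disk"
    and sym: "\<And>w. w \<in> unit_disk \<Longrightarrow> K1 (cnj w) = cnj (K1 w)" "\<And>w. w \<in> unit_disk \<Longrightarrow> K2 (cnj w) = cnj (K2 w)"
      "\<And>w. w \<in> unit_disk \<Longrightarrow> K3 (cnj w) = cnj (K3 w)"
    and conf: "\<And>w. w \<in> unit_disk \<Longrightarrow> (deriv K1 w)\<^sup>2 + (deriv K2 w)\<^sup>2 = (deriv K3 w)\<^sup>2"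
    and jac: "\<And>w. w \<in> upper_half_disk \<Longrightarrow> 0 < Im (deriv K1 w * cnj (deriv K2 w))"
    and regular: "\<And>w. w \<in> real_diameter \<Longrightarrow> deriv K3 w \<noteq> 0"
    and bdd: "bounded (K3 ` real_diameter)"
begin

lemma diameter: "w \<in> real_diameter \<longleftrightarrow> (\<exists>u. w = of_real u \<and> \<bar>u\<bar> < 1)"
  by (auto simp: real_diameter_def abs_less_iff)

lemma diameter_disk: "w \<in> real_diameter \<Longrightarrow> w \<in> unit_disk"
  by (auto simp: diameter)

lemma cnj_disk: "w \<in> unit_disk \<Longrightarrow> cnj w \<in> unit_disk" by simp

lemma deriv_sym:
  assumes w: "w \<in> unit_disk"
  shows "deriv K1 (cnj w) = cnj (deriv K1 w)" "deriv K2 (cnj w) = cnj (deriv K2 w)" "deriv K3 (cnj w) = cnj (deriv K3 w)"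
  by (rule deriv_symmetric[OF hol(1) open_ball w], simp add: sym)
    (rule deriv_symmetric[OF hol(2) open_ball w], simp add: sym, rule deriv_symmetric[OF hol(3) open_ball w], simp add: sym)

lemma hol_deriv: "deriv K1 holomorphic_on unit_disk" "deriv K2 holomorphic_on unit_disk" "deriv K3 holomorphic_on unit_disk"
  by (intro holomorphic_deriv hol open_ball)+

lemma real_values:
  assumes w: "w \<in> real_diameter"
  shows "Im (K1 w) = 0" "Im (K2 w) = 0" "Im (K3 w) = 0"
    "Im (deriv K1 w) = 0" "Im (deriv K2 w) = 0" "Im (deriv K3 w) = 0"
    "Im (deriv (deriv K1) w) = 0" "Im (deriv (deriv K2) w) = 0" "Im (deriv (deriv K3) w) = 0"
proof -
  have wd: "w \<in> unit_disk" and c: "cnj w = w" using w by (auto simp: diameter)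
  have i: "Im z = 0" if "z = cnj z" for z using that by (simp add: complex_eq_iff)
  show "Im (K1 w) = 0" "Im (K2 w) = 0" "Im (K3 w) = 0"
    using sym[OF wd] unfolding c by (blast intro: i)+
  show "Im (deriv K1 w) = 0" "Im (deriv K2 w) = 0" "Im (deriv K3 w) = 0"
    using deriv_sym[OF wd] unfolding c by (blast intro: i)+
  have "deriv (deriv K1) (cnj w) = cnj (deriv (deriv K1) w)"
    by (rule deriv_symmetric[OF hol_deriv(1) open_ball wd]) (use deriv_sym(1) in simp)
  moreover have "deriv (deriv K2) (cnj w) = cnj (deriv (deriv K2) w)"
    by (rule deriv_symmetric[OF hol_deriv(2) open_ball wd]) (use deriv_sym(2) in simp)
  moreover have "deriv (deriv K3) (cnj w) = cnj (deriv (deriv K3) w)"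
    by (rule deriv_symmetric[OF hol_deriv(3) open_ball wd]) (use deriv_sym(3) in simp)
  ultimately show "Im (deriv (deriv K1) w) = 0" "Im (deriv (deriv K2) w) = 0" "Im (deriv (deriv K3) w) = 0"
    unfolding c by (blast intro: i)+
qed

text \<open>All coordinates are real parts of \<open>c - d * K\<close>: \<open>d = \<i>\<close>
  yields \<open>Im K\<close>, \<open>d = 1\<close> yields \<open>- Re K\<close>, which is the
  conjugate of \<open>Im K\<close>, and \<open>d = -1\<close> yields \<open>Re K\<close>, each up to
  a constant.\<close>

lemma affine_deriv:
  assumes "K holomorphic_on unit_disk" "w \<in> unit_disk"
  shows "deriv (\<lambda>w. c - d * K w) w = - (d * deriv K w)"
proof (rule DERIV_imp_deriv)
  show "((\<lambda>w. c - d * K w) has_field_derivative - (d * deriv K w)) (at w)"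
    using DERIV_diff[OF DERIV_const DERIV_cmult[OF holomorphic_derivI[OF assms(1) open_ball assms(2)]]] by simp
qed

lemmas affine_derivs = affine_deriv[OF hol(1)] affine_deriv[OF hol(2)] affine_deriv[OF hol(3)]

lemma affine_surface:
  assumes "\<And>w. w \<in> unit_disk \<Longrightarrow> S w = (Complex (Re (c1 - d1 * K1 w)) (Re (c2 - d2 * K2 w)), Re (c3 - d3 * K3 w))"
  shows "real_part_surface S (\<lambda>w. c1 - d1 * K1 w) (\<lambda>w. c2 - d2 * K2 w) (\<lambda>w. c3 - d3 * K3 w)"
  using assms unfolding real_part_surface_def by (auto intro!: holomorphic_intros hol)

lemma zero_diameter: "0 \<in> real_diameter" by (auto simp: diameter intro: exI[of _ 0])

lemma nz_ex: "d \<noteq> 0 \<Longrightarrow> \<exists>w\<in>unit_disk. deriv (\<lambda>w. c - d * K3 w) w \<noteq> 0"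
  using affine_derivs(3)[of 0 c d] regular[OF zero_diameter] by (intro bexI[of _ 0]) auto

text \<open>The condition on \<open>d\<close> and \<open>d3\<close> turns the Lorentzian relation
  \<open>conf\<close> into the Euclidean one, by reversing the sign of the third square.\<close>

lemma affine_minimal:
  assumes S: "real_part_surface S (\<lambda>w. c1 - d * K1 w) (\<lambda>w. c2 - d * K2 w) (\<lambda>w. c3 - d3 * K3 w)"
    and d: "d\<^sup>2 = - d3\<^sup>2" "d \<noteq> 0"
  shows "generalized_minimal_surface unit_disk S"
proof (rule rps_minimal[OF S])
  show "\<exists>w\<in>unit_disk. deriv (\<lambda>w. c3 - d3 * K3 w) w \<noteq> 0" using d by (intro nz_ex) auto
  fix w assume w: "w \<in> unit_disk"
  have "d\<^sup>2 * ((deriv K1 w)\<^sup>2 + (deriv K2 w)\<^sup>2) = d\<^sup>2 * (deriv K3 w)\<^sup>2" by (simp only: conf[OF w])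
  then show "(deriv (\<lambda>w. c1 - d * K1 w) w)\<^sup>2 + (deriv (\<lambda>w. c2 - d * K2 w) w)\<^sup>2 + (deriv (\<lambda>w. c3 - d3 * K3 w) w)\<^sup>2 = 0"
    unfolding affine_derivs[OF w] by (simp add: power_mult_distrib d(1) distrib_left)
qed

lemma affine_maximal:
  assumes S: "real_part_surface S (\<lambda>w. c1 - d * K1 w) (\<lambda>w. c2 - d * K2 w) (\<lambda>w. c3 - d * K3 w)"
    and d: "cmod d = 1"
  shows "generalized_maximal_surface unit_disk S"
proof (rule rps_maximal[OF S])
  show "\<exists>w\<in>unit_disk. deriv (\<lambda>w. c3 - d * K3 w) w \<noteq> 0" using d by (intro nz_ex) auto
  show "(deriv (\<lambda>w. c1 - d * K1 w) w)\<^sup>2 + (deriv (\<lambda>w. c2 - d * K2 w) w)\<^sup>2 = (deriv (\<lambda>w. c3 - d * K3 w) w)\<^sup>2"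
    if w: "w \<in> unit_disk" for w
  proof -
    have "d\<^sup>2 * ((deriv K1 w)\<^sup>2 + (deriv K2 w)\<^sup>2) = d\<^sup>2 * (deriv K3 w)\<^sup>2" by (simp only: conf[OF w])
    then show ?thesis unfolding affine_derivs[OF w] by (simp add: power_mult_distrib distrib_left)
  qed
  have im: "Im (- (d * a) * cnj (- (d * b))) = Im (a * cnj b)" for a b
  proof -
    have "- (d * a) * cnj (- (d * b)) = a * cnj b * (d * cnj d)" by simp
    also have "d * cnj d = 1" using d complex_norm_square[of d] by simp
    finally show ?thesis by (simp only: mult_1_right)
  qed
  fix w assume w: "w \<in> upper_half_disk"
  then have wd: "w \<in> unit_disk" "cnj w \<in> unit_disk" by (auto simp: upper_half_disk_def)
  show "Im (deriv (\<lambda>w. c1 - d * K1 w) w * cnj (deriv (\<lambda>w. c2 - d * K2 w) w)) \<noteq> 0"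
    unfolding affine_derivs[OF wd(1)] im using jac[OF w] by simp
  show "Im (deriv (\<lambda>w. c1 - d * K1 w) (cnj w) * cnj (deriv (\<lambda>w. c2 - d * K2 w) (cnj w))) \<noteq> 0"
    unfolding affine_derivs[OF wd(2)] im deriv_sym[OF wd(1)] using jac[OF w] by simp
qed

lemma real_relation:
  assumes w: "w \<in> real_diameter"
  shows "(Re (deriv K1 w))\<^sup>2 + (Re (deriv K2 w))\<^sup>2 = (Re (deriv K3 w))\<^sup>2" "Re (deriv K3 w) \<noteq> 0"
    "Complex (Re (deriv K1 w)) (Re (deriv K2 w)) \<noteq> 0"
proof -
  show 1: "(Re (deriv K1 w))\<^sup>2 + (Re (deriv K2 w))\<^sup>2 = (Re (deriv K3 w))\<^sup>2"
    using arg_cong[OF conf[OF diameter_disk[OF w]], of Re] real_values[OF w] by (simp add: power2_eq_square)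
  show 2: "Re (deriv K3 w) \<noteq> 0" using regular[OF w] real_values(6)[OF w] by (metis complex_eqI zero_complex.simps)
  show "Complex (Re (deriv K1 w)) (Re (deriv K2 w)) \<noteq> 0"
    using 1 2 by (auto simp: complex_eq_iff)
qed

lemma lightlike_derivs:
  assumes w: "w \<in> real_diameter"
  shows "lightlike (Complex (Re (deriv K1 w)) (Re (deriv K2 w)), Re (deriv K3 w))"
    "lightlike (Complex (- Re (deriv K1 w)) (- Re (deriv K2 w)), - Re (deriv K3 w))"
  using real_relation[OF w] by (auto simp: lightlike_def lorentz_def inner_complex_def power2_eq_square zero_prod_def)

text \<open>With the factor \<open>\<i>\<close> the \<open>x\<close>-derivative of the surface is
  built from the imaginary parts of the derivatives, which vanish on the diameter, and the
  \<open>y\<close>-derivative from their real parts, which form a lightlike vector. The diameter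
  itself is the regular curve that shrinks to \<open>q\<close>.\<close>

lemma shrinking:
  assumes S: "real_part_surface S (\<lambda>w. c1 - \<i> * K1 w) (\<lambda>w. c2 - \<i> * K2 w) (\<lambda>w. c3 - \<i> * K3 w)"
    and q: "\<And>w. w \<in> real_diameter \<Longrightarrow> S w = q" and p: "p \<in> real_diameter"
  shows "shrinking_singularity unit_disk S p q"
proof -
  have A: "w \<in> lightlike_points unit_disk S" if w: "w \<in> real_diameter" for w
  proof -
    have "pdy S w = (Complex (Re (deriv K1 w)) (Re (deriv K2 w)), Re (deriv K3 w))"
      unfolding rps_pd(2)[OF S diameter_disk[OF w]] affine_derivs[OF diameter_disk[OF w]] by simp
    then show ?thesis using lightlike_derivs[OF w] diameter_disk[OF w] by (auto simp: lightlike_points_def)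
  qed
  let ?J = "{-1<..<1::real}"
  have im: "complex_of_real ` ?J = real_diameter" by (simp add: real_diameter_def)
  have "(complex_of_real has_vector_derivative 1) (at s within ?J)" for s
    using has_vector_derivative_of_real[OF DERIV_ident] by (simp only: of_real_1)
  then have "regular_curve ?J complex_of_real"
    unfolding regular_curve_def by (intro conjI exI[of _ "\<lambda>s. 1"]) (auto simp: is_interval_oo)
  moreover have "S ` real_diameter = {q}" using q zero_diameter by blast
  ultimately show ?thesis unfolding shrinking_singularity_def
    using A p im by (intro conjI exI[of _ unit_disk] exI[of _ ?J] exI[of _ complex_of_real]) (auto dest: diameter_disk)
qed

text \<open>With the factor 1 the roles are exchanged: on the diameter the
  \<open>y\<close>-derivative vanishes and the \<open>x\<close>-derivative is lightlike.\<close>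

lemma folding:
  assumes S: "real_part_surface S (\<lambda>w. c1 - 1 * K1 w) (\<lambda>w. c2 - 1 * K2 w) (\<lambda>w. c3 - 1 * K3 w)"
    and p: "p \<in> real_diameter"
  shows "folding_singularity unit_disk S p {S (p + of_real u) | u::real. \<bar>u\<bar> < 1 - cmod p}"
proof -
  note wd = diameter_disk[OF p]
  have "pdx S p = (Complex (- Re (deriv K1 p)) (- Re (deriv K2 p)), - Re (deriv K3 p))"
    unfolding rps_pd(1)[OF S wd] affine_derivs[OF wd] by simp
  then have A: "p \<in> lightlike_points unit_disk S" using lightlike_derivs[OF p] wd by (auto simp: lightlike_points_def)
  obtain v where v: "p = of_real v" "\<bar>v\<bar> < 1" using p by (auto simp: diameter)
  have "pdy (S \<circ> (\<lambda>w. p + w)) (of_real u) = 0" if u: "complex_of_real u \<in> ball 0 (1 - cmod p)" for u :: real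
  proof -
    have in1: "p + of_real u \<in> unit_disk" using u norm_triangle_ineq[of p "of_real u"] by simp
    have "p + of_real u = of_real (v + u)" by (simp add: v)
    moreover have "\<bar>v + u\<bar> < 1" using in1 unfolding v by (simp flip: of_real_add)
    ultimately have rd: "p + of_real u \<in> real_diameter" unfolding diameter by blast
    show ?thesis
      unfolding rps_translated(2)[OF S in1] rps_pd(2)[OF S in1] affine_derivs[OF in1] using real_values[OF rd]
      by (simp add: zero_prod_def complex_eq_iff)
  qed
  then show ?thesis unfolding folding_singularity_def
    using A translation_coordinate[OF wd]
    by (intro conjI exI[of _ "ball 0 (1 - cmod p)"] exI[of _ "\<lambda>w. p + w"]) auto
qed

lemma null:
  assumes S: "real_part_surface S (\<lambda>w. c1 - 1 * K1 w) (\<lambda>w. c2 - 1 * K2 w) (\<lambda>w. c3 - 1 * K3 w)"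
  shows "null_curve {-1<..<1} (\<lambda>u. S (of_real u))"
  unfolding null_curve_def
proof (intro exI[of _ "\<lambda>u. pdx S (of_real u)"] ballI conjI)
  fix u :: real assume "u \<in> {-1<..<1}"
  then have w: "complex_of_real u \<in> real_diameter" by (simp add: real_diameter_def)
  note wd = diameter_disk[OF w]
  show "((\<lambda>u. S (of_real u)) has_vector_derivative pdx S (of_real u)) (at u within {-1<..<1})"
    using rps_real_curve[OF S wd] by (rule has_vector_derivative_at_within)
  have "pdx S (of_real u) = (Complex (- Re (deriv K1 (of_real u))) (- Re (deriv K2 (of_real u))), - Re (deriv K3 (of_real u)))"
    unfolding rps_pd(1)[OF S wd] affine_derivs[OF wd] by simp
  then show "lightlike (pdx S (of_real u))" using lightlike_derivs[OF w] by simp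
qed

text \<open>The heights over the diameter form a bounded connected set. It contains neither its
  infimum nor its supremum, since an interior extremum would be a zero of the derivative of
  \<open>K3\<close>; hence it is an open interval.\<close>

lemma vertical_segment: "vertical_segment_over z0 ((\<lambda>w. (z0 + Complex (Im (K1 w)) (Im (K2 w)), Re (K3 w))) ` real_diameter)"
proof -
  define h where "h u = Re (K3 (of_real u))" for u :: real
  define A where "A = h ` {-1<..<1}"
  have dh: "(h has_real_derivative Re (deriv K3 (of_real u))) (at u)" if "\<bar>u\<bar> < 1" for u
  proof -
    have "of_real u \<in> unit_disk" using that by simp
    from has_vector_derivative_real_field[OF holomorphic_derivI[OF hol(3) open_ball this]]
    have "((\<lambda>u. K3 (of_real u)) has_vector_derivative deriv K3 (of_real u)) (at u)" by (simp add: o_def)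
    then show ?thesis unfolding h_def by (rule has_field_derivative_Re)
  qed
  have nz: "Re (deriv K3 (of_real u)) \<noteq> 0" if "\<bar>u\<bar> < 1" for u
    using real_relation(2)[of "of_real u"] that by (auto simp: diameter)
  have img: "(\<lambda>w. (z0 + Complex (Im (K1 w)) (Im (K2 w)), Re (K3 w))) ` real_diameter = Pair z0 ` A"
    unfolding A_def h_def image_image real_diameter_def
    by (rule image_cong) (use real_values in \<open>auto simp: diameter abs_less_iff complex_eq_iff\<close>)
  have "continuous_on {-1<..<1} h"
    by (rule continuous_at_imp_continuous_on) (use dh DERIV_isCont in \<open>force simp: abs_less_iff\<close>)
  then have conn: "connected A" unfolding A_def by (rule connected_continuous_image) simp
  obtain B where B: "\<And>w. w \<in> real_diameter \<Longrightarrow> cmod (K3 w) \<le> B" using bdd unfolding bounded_iff by blast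
  have bA: "\<bar>y\<bar> \<le> B" if "y \<in> A" for y
  proof -
    obtain u where u: "y = h u" "\<bar>u\<bar> < 1" using \<open>y \<in> A\<close> by (auto simp: A_def abs_less_iff)
    then have "complex_of_real u \<in> real_diameter" by (auto simp: diameter)
    from B[OF this] show ?thesis using abs_Re_le_cmod[of "K3 (of_real u)"] unfolding u(1) h_def by linarith
  qed
  have ne: "A \<noteq> {}" by (auto simp: A_def)
  have bdA: "bdd_above A" "bdd_below A"
    using bA by (meson abs_le_D1 bdd_aboveI, meson abs_le_D2 bdd_belowI minus_le_iff)
  define a b where "a = Inf A" and "b = Sup A"
  have le: "a \<le> y" "y \<le> b" if "y \<in> A" for y
    unfolding a_def b_def using that bdA by (auto intro: cInf_lower cSup_upper)
  have no_max: False if u: "\<bar>u\<bar> < 1" and "(\<forall>y\<in>A. y \<le> h u) \<or> (\<forall>y\<in>A. h u \<le> y)" for u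
  proof -
    have near: "h v \<in> A" if "\<bar>u - v\<bar> < 1 - \<bar>u\<bar>" for v using that unfolding A_def by (intro imageI) (simp add: abs_less_iff, linarith)
    have "0 < 1 - \<bar>u\<bar>" using u by simp
    then have "Re (deriv K3 (of_real u)) = 0"
      using that(2) DERIV_local_max[OF dh[OF u], of "1 - \<bar>u\<bar>"] DERIV_local_min[OF dh[OF u], of "1 - \<bar>u\<bar>"] near by blast
    then show False using nz[OF u] by simp
  qed
  have notin: "a \<notin> A" "b \<notin> A"
  proof -
    show "a \<notin> A"
    proof
      assume "a \<in> A"
      then obtain u where "a = h u" "\<bar>u\<bar> < 1" by (auto simp: A_def abs_less_iff)
      then show False using no_max[of u] le(1) by auto
    qed
    show "b \<notin> A"
    proof
      assume "b \<in> A"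
      then obtain u where "b = h u" "\<bar>u\<bar> < 1" by (auto simp: A_def abs_less_iff)
      then show False using no_max[of u] le(2) by auto
    qed
  qed
  have Aeq: "A = {a<..<b}"
  proof
    show "A \<subseteq> {a<..<b}" using le notin by (force simp: less_le)
    show "{a<..<b} \<subseteq> A"
    proof
      fix y assume y: "y \<in> {a<..<b}"
      obtain y1 where y1: "y1 \<in> A" "y1 < y" using y cInf_less_iff[OF ne bdA(2)] by (auto simp: a_def)
      obtain y2 where y2: "y2 \<in> A" "y < y2" using y less_cSup_iff[OF ne bdA(1)] by (auto simp: b_def)
      show "y \<in> A" using connectedD_interval[OF conn y1(1) y2(1)] y1 y2 by simp
    qed
  qed
  then have ab: "a < b" using ne by auto
  have "Pair z0 ` A = open_segment (z0, a) (z0, b)"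
  proof -
    have "open_segment a b = {a<..<b}" using ab by (simp add: open_segment_eq_real_ivl)
    then have "A = {(1 - u) *\<^sub>R a + u *\<^sub>R b | u. 0 < u \<and> u < 1}"
      using Aeq ab by (auto simp: in_segment set_eq_iff)
    moreover have "(1 - u) *\<^sub>R z0 + u *\<^sub>R z0 = z0" for u by (simp add: scaleR_left.diff)
    ultimately show ?thesis using ab by (auto simp: in_segment image_iff)
  qed
  then show ?thesis unfolding vertical_segment_over_def img using ab by blast
qed

end

section \<open>Euclidean geometry of the conjugate minimal surface\<close>

lemma holomorphic_C1_on:
  assumes "open U" "G holomorphic_on U"
  shows "C1_on U G"
proof (rule C1_onI[where gx = "deriv G" and gy = "\<lambda>w. \<i> * deriv G w"])
  show "(G has_derivative (\<lambda>h. Re h *\<^sub>R deriv G w + Im h *\<^sub>R (\<i> * deriv G w))) (at w)" if "w \<in> U" for w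
    by (rule has_derivative_eq_rhs[OF holomorphic_derivI[OF assms(2,1) that, unfolded has_field_derivative_def]])
      (auto simp: fun_eq_iff complex_eq_iff algebra_simps)
  have "continuous_on U (deriv G)" by (intro holomorphic_on_imp_continuous_on holomorphic_deriv assms)
  then show "continuous_on U (deriv G)" "continuous_on U (\<lambda>w. \<i> * deriv G w)" by (auto intro: continuous_intros)
qed

lemma C1_on_triple:
  fixes a b c :: "complex \<Rightarrow> real"
  assumes U: "open U" and a: "C1_on U a" and b: "C1_on U b" and c: "C1_on U c"
  shows "C1_on U (\<lambda>w. (Complex (a w) (b w), c w))"
proof -
  have "C1_on U (\<lambda>w. (of_real (a w) :: complex, 0 :: real))"
    by (rule C1_on_bounded_linear[OF U _ a]) (intro bounded_linear_Pair bounded_linear_of_real bounded_linear_zero)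
  moreover have "C1_on U (\<lambda>w. (\<i> * of_real (b w), 0 :: real))"
    by (rule C1_on_bounded_linear[OF U _ b])
      (intro bounded_linear_Pair bounded_linear_zero bounded_linear_compose[OF bounded_linear_mult_right bounded_linear_of_real])
  moreover have "C1_on U (\<lambda>w. (0 :: complex, c w))"
    by (rule C1_on_bounded_linear[OF U _ c]) (intro bounded_linear_Pair bounded_linear_zero bounded_linear_ident)
  ultimately have "C1_on U (\<lambda>w. (of_real (a w) :: complex, 0 :: real) + (\<i> * of_real (b w), 0 :: real) + (0 :: complex, c w))"
    by (intro C1_on_add)
  then show ?thesis by (simp add: Complex_eq)
qed

text \<open>The real and imaginary parts of an isotropic complex vector are orthogonal and of equal
  length, so they are independent as soon as the vector is nonzero.\<close>

lemma rps_immersed: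
  assumes S: "real_part_surface S M1 M2 M3" and w: "w \<in> unit_disk" and nz: "deriv M3 w \<noteq> 0"
    and conf: "(deriv M1 w)\<^sup>2 + (deriv M2 w)\<^sup>2 + (deriv M3 w)\<^sup>2 = 0"
  shows "immersed_at S w"
  unfolding immersed_at_def
proof (intro conjI allI impI)
  show "S differentiable (at w)" by (rule rps_pd(3)[OF S w])
  fix x y :: real assume xy: "x *\<^sub>R pdx S w + y *\<^sub>R pdy S w = 0"
  define a1 a2 b1 b2 c1 c2 where "a1 = Re (deriv M1 w)" and "a2 = Im (deriv M1 w)" and "b1 = Re (deriv M2 w)"
    and "b2 = Im (deriv M2 w)" and "c1 = Re (deriv M3 w)" and "c2 = Im (deriv M3 w)"
  have eqs: "x * a1 = y * a2" "x * b1 = y * b2" "x * c1 = y * c2"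
    using xy unfolding rps_pd(1,2)[OF S w] by (auto simp: zero_prod_def complex_eq_iff a1_def a2_def b1_def b2_def c1_def c2_def)
  have n: "a1\<^sup>2 + b1\<^sup>2 + c1\<^sup>2 = a2\<^sup>2 + b2\<^sup>2 + c2\<^sup>2" and o: "a1 * a2 + b1 * b2 + c1 * c2 = 0"
    using arg_cong[OF conf, of Re] arg_cong[OF conf, of Im]
    by (simp_all add: power2_eq_square a1_def a2_def b1_def b2_def c1_def c2_def mult.commute)
  have pos: "0 < c1\<^sup>2 + c2\<^sup>2" using nz by (simp add: c1_def c2_def sum_power2_gt_zero_iff complex_eq_iff)
  have "0 \<le> a1\<^sup>2" "0 \<le> b1\<^sup>2" "0 \<le> c1\<^sup>2" "0 \<le> a2\<^sup>2" "0 \<le> b2\<^sup>2" "0 \<le> c2\<^sup>2" by simp_all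
  then have N: "a1\<^sup>2 + b1\<^sup>2 + c1\<^sup>2 \<noteq> 0" using n pos by linarith
  have "x * (a1\<^sup>2 + b1\<^sup>2 + c1\<^sup>2) = x * a1 * a1 + x * b1 * b1 + x * c1 * c1" by (simp add: power2_eq_square algebra_simps)
  also have "\<dots> = y * (a1 * a2 + b1 * b2 + c1 * c2)" unfolding eqs by (simp add: algebra_simps)
  finally show x0: "x = 0" using o N by simp
  have "y * (a2\<^sup>2 + b2\<^sup>2 + c2\<^sup>2) = y * a2 * a2 + y * b2 * b2 + y * c2 * c2" by (simp add: power2_eq_square algebra_simps)
  also have "\<dots> = 0" unfolding eqs[symmetric] x0 by simp
  finally show "y = 0" using n N by simp
qed

text \<open>Adding \<open>\<i> * K\<close> to the holomorphic combination of \<open>u\<close> and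
  \<open>v\<close> leaves a constant real part, so the sum is constant.\<close>

lemma harmonic_conjugate_unique:
  assumes v: "harmonic_conjugate unit_disk u v" and K: "K holomorphic_on unit_disk"
    and u: "\<And>w. w \<in> unit_disk \<Longrightarrow> u w = x0 + Im (K w)"
  obtains c where "\<And>w. w \<in> unit_disk \<Longrightarrow> v w = c - Re (K w)"
proof -
  define D where "D w = Complex (u w) (v w) + \<i> * K w - of_real x0" for w
  have hD: "D holomorphic_on unit_disk"
    using v K unfolding D_def harmonic_conjugate_def by (intro holomorphic_intros) auto
  have re: "Re (D w) = 0" if "w \<in> unit_disk" for w using u[OF that] by (simp add: D_def)
  have "\<exists>c. \<forall>w\<in>unit_disk. D w = c"
  proof (rule has_field_derivative_zero_constant[OF convex_ball])
    fix w assume w: "w \<in> unit_disk"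
    have d: "(D has_field_derivative deriv D w) (at w)" by (rule holomorphic_derivI[OF hD open_ball w])
    have "((\<lambda>w. Re (D w)) has_derivative (\<lambda>h. Re (deriv D w * h))) (at w)"
      by (rule has_derivative_Re[OF d[unfolded has_field_derivative_def]])
    moreover have "((\<lambda>w. Re (D w)) has_derivative (\<lambda>h. 0)) (at w)"
      by (rule has_derivative_transform_within_open[OF has_derivative_const[of 0] open_ball w]) (simp add: re)
    ultimately have *: "(\<lambda>h. Re (deriv D w * h)) = (\<lambda>h. 0)" by (rule has_derivative_unique)
    have "deriv D w = 0" using fun_cong[OF *, of 1] fun_cong[OF *, of \<i>] by (simp add: complex_eq_iff)
    then show "(D has_field_derivative 0) (at w within unit_disk)" using d by (simp add: has_field_derivative_at_within)
  qed
  then obtain c where c: "\<And>w. w \<in> unit_disk \<Longrightarrow> D w = c" by blast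
  show thesis
  proof (rule that[of "Im c"])
    fix w assume "w \<in> unit_disk"
    from arg_cong[OF c[OF this], of Im] show "v w = Im c - Re (K w)" by (simp add: D_def)
  qed
qed

context reflected_surface
begin

lemma affine_deriv2:
  assumes "K holomorphic_on unit_disk" "w \<in> unit_disk"
  shows "deriv (deriv (\<lambda>w. c - d * K w)) w = - (d * deriv (deriv K) w)"
proof -
  have h: "deriv K holomorphic_on unit_disk" by (rule holomorphic_deriv[OF assms(1) open_ball])
  have "((\<lambda>w. - (d * deriv K w)) has_field_derivative - (d * deriv (deriv K) w)) (at w)"
    by (intro DERIV_minus DERIV_cmult holomorphic_derivI[OF h open_ball assms(2)])
  then have "(deriv (\<lambda>w. c - d * K w) has_field_derivative - (d * deriv (deriv K) w)) (at w)"
    by (rule has_field_derivative_transform_within_open[OF _ open_ball assms(2)]) (simp add: affine_deriv[OF assms(1)])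
  then show ?thesis by (rule DERIV_imp_deriv)
qed

text \<open>The Gauss map of the conjugate minimal surface, in stereographic coordinates up to the
  factor \<open>\<i>\<close>, and the corresponding unit normal. On the diameter \<open>G\<close> has modulus 1.\<close>

definition "G w = (deriv K1 w + \<i> * deriv K2 w) / deriv K3 w"
definition "N w = (Complex (- 2 * inverse (1 + (Re (G w))\<^sup>2 + (Im (G w))\<^sup>2) * Im (G w))
  (2 * inverse (1 + (Re (G w))\<^sup>2 + (Im (G w))\<^sup>2) * Re (G w)), 1 - 2 * inverse (1 + (Re (G w))\<^sup>2 + (Im (G w))\<^sup>2))"
definition "U = {w \<in> unit_disk. deriv K3 w \<noteq> 0}"

lemma open_U: "open U"
proof -
  have "U = (deriv K3 -` (- {0})) \<inter> unit_disk" by (auto simp: U_def)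
  then show ?thesis
    using continuous_on_open_vimage[OF open_ball] holomorphic_on_imp_continuous_on[OF hol_deriv(3)] by (metis open_delete open_UNIV Compl_eq_Diff_UNIV)
qed

lemma diameter_U: "real_diameter \<subseteq> U"
  using regular diameter_disk by (auto simp: U_def)

lemma hol_G: "G holomorphic_on U"
proof -
  have sub: "U \<subseteq> unit_disk" by (auto simp: U_def)
  show ?thesis unfolding G_def
    by (intro holomorphic_on_divide holomorphic_on_add holomorphic_on_mult holomorphic_on_const
        hol_deriv[THEN holomorphic_on_subset, OF sub]) (simp add: U_def)
qed

lemma denominator_pos: "0 < 1 + x\<^sup>2 + y\<^sup>2" for x y :: real
  by (simp add: add_pos_nonneg)

lemma C1_N: "C1_on U N"
proof -
  have C: "C1_on U G" by (rule holomorphic_C1_on[OF open_U hol_G])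
  have x: "C1_on U (\<lambda>w. Re (G w))" and y: "C1_on U (\<lambda>w. Im (G w))"
    by (rule C1_on_bounded_linear[OF open_U bounded_linear_Re C], rule C1_on_bounded_linear[OF open_U bounded_linear_Im C])
  define i where "i w = inverse (1 + (Re (G w))\<^sup>2 + (Im (G w))\<^sup>2)" for w
  have "C1_on U (\<lambda>w. 1 + Re (G w) * Re (G w) + Im (G w) * Im (G w))"
    by (rule C1_on_add[OF C1_on_add[OF C1_on_const C1_on_mult[OF x x]] C1_on_mult[OF y y]])
  then have "C1_on U (\<lambda>w. 1 + (Re (G w))\<^sup>2 + (Im (G w))\<^sup>2)" by (simp add: power2_eq_square)
  then have D: "C1_on U i" unfolding i_def
    by (rule C1_on_inverse) (metis denominator_pos less_irrefl)
  have "C1_on U (\<lambda>w. (Complex (- 2 * i w * Im (G w)) (2 * i w * Re (G w)), 1 + - 2 * i w))"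
    by (rule C1_on_triple[OF open_U C1_on_mult[OF C1_on_mult[OF C1_on_const D] y]
          C1_on_mult[OF C1_on_mult[OF C1_on_const D] x] C1_on_add[OF C1_on_const C1_on_mult[OF C1_on_const D]]])
  moreover have "N = (\<lambda>w. (Complex (- 2 * i w * Im (G w)) (2 * i w * Re (G w)), 1 + - 2 * i w))"
    by (simp add: fun_eq_iff N_def i_def)
  ultimately show ?thesis by simp
qed

lemma norm_N: "norm (N w) = 1"
proof -
  define x y i where "x = Re (G w)" and "y = Im (G w)" and "i = inverse (1 + x\<^sup>2 + y\<^sup>2)"
  have i: "i * (1 + x\<^sup>2 + y\<^sup>2) = 1" using denominator_pos[of x y] by (simp add: i_def)
  have "(norm (N w))\<^sup>2 = (- 2 * i * y)\<^sup>2 + (2 * i * x)\<^sup>2 + (1 - 2 * i)\<^sup>2"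
    unfolding N_def x_def[symmetric] y_def[symmetric] i_def[symmetric] by (simp add: norm_Pair cmod_power2)
  also have "\<dots> = 4 * i * (i * (1 + x\<^sup>2 + y\<^sup>2)) + 1 - 4 * i" by (simp add: power2_eq_square algebra_simps)
  finally have "(norm (N w))\<^sup>2 = 1" unfolding i by simp
  then show ?thesis by (metis abs_norm_cancel abs_1 power2_eq_1_iff norm_ge_zero abs_of_nonneg abs_minus_cancel)
qed

text \<open>Orthogonality of the normal to both partial derivatives, as one complex equation with
  the denominator \<open>1 + \<bar>G\<bar>\<^sup>2\<close> cleared. It follows from
  \<open>K1' + \<i> * K2' = G * K3'\<close> and \<open>G * (K1' - \<i> * K2') = K3'\<close>, the two
  factors of \<open>conf\<close>.\<close>

lemma N_isotropic:
  assumes w: "w \<in> U"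
  shows "- 2 * of_real (Im (G w)) * deriv K1 w + 2 * of_real (Re (G w)) * deriv K2 w
    + of_real ((Re (G w))\<^sup>2 + (Im (G w))\<^sup>2 - 1) * (\<i> * deriv K3 w) = 0"
proof -
  let ?a = "deriv K1 w" let ?b = "deriv K2 w" let ?c = "deriv K3 w" let ?g = "G w"
  have wd: "w \<in> unit_disk" and c: "?c \<noteq> 0" using w by (auto simp: U_def)
  have g1: "?a + \<i> * ?b = ?g * ?c" using c by (simp add: G_def)
  have "?g * ?c * (?a - \<i> * ?b) = ?c * ?c"
    unfolding g1[symmetric] using conf[OF wd] by (simp add: power2_eq_square algebra_simps)
  then have g2: "?g * (?a - \<i> * ?b) = ?c" using c by (simp add: mult.assoc mult.left_commute)
  have "2 * of_real (Re ?g) = ?g + cnj ?g" "2 * of_real (Im ?g) = - \<i> * (?g - cnj ?g)"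
    by (simp_all add: complex_eq_iff)
  then have "- 2 * of_real (Im ?g) * ?a + 2 * of_real (Re ?g) * ?b = \<i> * (?g - cnj ?g) * ?a + (?g + cnj ?g) * ?b" by simp
  also have "\<dots> = \<i> * (?g * (?a - \<i> * ?b)) - \<i> * cnj ?g * (?a + \<i> * ?b)" by (simp add: algebra_simps)
  also have "\<dots> = \<i> * ?c - \<i> * (?g * cnj ?g) * ?c" unfolding g1 g2 by (simp add: algebra_simps)
  also have "?g * cnj ?g = of_real ((Re ?g)\<^sup>2 + (Im ?g)\<^sup>2)" by (simp add: complex_mult_cnj)
  finally show ?thesis by (simp add: algebra_simps)
qed

text \<open>On the diameter the velocity and the acceleration are horizontal, while the other
  partial derivative is vertical; so the tangential acceleration is parallel to the velocity. The
  normal is horizontal there too, and its derivative is a multiple of the velocity because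
  \<open>G\<close> moves on the unit circle.\<close>

lemma conjugate_geodesic_curvature_line:
  assumes S: "real_part_surface S (\<lambda>w. c1 - 1 * K1 w) (\<lambda>w. c2 - 1 * K2 w) (\<lambda>w. c3 - \<i> * K3 w)"
    and h: "\<And>w. w \<in> real_diameter \<Longrightarrow> snd (S w) = h"
  shows "horizontal_geodesic_curvature_line unit_disk S {-1<..<1} complex_of_real h"
proof -
  have rd: "complex_of_real s \<in> real_diameter" if "s \<in> {-1<..<1}" for s using that by (simp add: real_diameter_def)
  have pds: "pdx S w = (Complex (- Re (deriv K1 w)) (- Re (deriv K2 w)), Im (deriv K3 w))"
    "pdy S w = (Complex (Im (deriv K1 w)) (Im (deriv K2 w)), Re (deriv K3 w))" if w: "w \<in> unit_disk" for w
    unfolding rps_pd(1,2)[OF S w] affine_derivs[OF w] by simp_all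
  have imm: "immersed_at S w" if "w \<in> U" for w
  proof (rule rps_immersed[OF S])
    show w: "w \<in> unit_disk" using that by (simp add: U_def)
    show "deriv (\<lambda>w. c3 - \<i> * K3 w) w \<noteq> 0" using that unfolding affine_derivs[OF w] by (simp add: U_def)
    show "(deriv (\<lambda>w. c1 - 1 * K1 w) w)\<^sup>2 + (deriv (\<lambda>w. c2 - 1 * K2 w) w)\<^sup>2 + (deriv (\<lambda>w. c3 - \<i> * K3 w) w)\<^sup>2 = 0"
      using conf[OF w] unfolding affine_derivs[OF w] by (simp add: power_mult_distrib)
  qed
  have vel: "(S \<circ> complex_of_real has_vector_derivative pdx S (of_real s)) (at s)" if "s \<in> {-1<..<1}" for s
    using rps_real_curve[OF S diameter_disk[OF rd[OF that]]] by (simp add: o_def)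
  have vel_real: "pdx S (of_real s) = (Complex (- Re (deriv K1 (of_real s))) (- Re (deriv K2 (of_real s))), 0)"
    if "s \<in> {-1<..<1}" for s
    unfolding pds(1)[OF diameter_disk[OF rd[OF that]]] using real_values(6)[OF rd[OF that]] by simp
  have vel_nz: "pdx S (of_real s) \<noteq> 0" if "s \<in> {-1<..<1}" for s
    unfolding vel_real[OF that] using real_relation(3)[OF rd[OF that]] by (auto simp: zero_prod_def complex_eq_iff)
  have "geodesic_on unit_disk S {-1<..<1} complex_of_real"
    unfolding geodesic_on_def
  proof (rule exI[of _ "\<lambda>s. pdx S (of_real s)"], rule exI[of _ "\<lambda>s. pdx (pdx S) (of_real s)"], intro ballI conjI)
    fix s :: real assume s: "s \<in> {-1<..<1}"
    let ?w = "complex_of_real s"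
    note wd = diameter_disk[OF rd[OF s]]
    show "?w \<in> unit_disk" by (rule wd)
    show "immersed_at S ?w" using imm diameter_U rd[OF s] by blast
    show "(S \<circ> complex_of_real has_vector_derivative pdx S ?w) (at s)" by (rule vel[OF s])
    show "((\<lambda>s. pdx S (of_real s)) has_vector_derivative pdx (pdx S) ?w) (at s)"
      by (rule rps_real_curve[OF rps_pd_surface(1)[OF S] wd])
    show "pdx S ?w \<noteq> 0" by (rule vel_nz[OF s])
    have acc: "snd (pdx (pdx S) ?w) = 0"
      unfolding rps_pd(1)[OF rps_pd_surface(1)[OF S] wd] affine_deriv2[OF hol(3) wd] using real_values(9)[OF rd[OF s]] by simp
    let ?v = "pdx S ?w" let ?a = "pdx (pdx S) ?w"
    show "\<exists>l. normal_vector S ?w (?a - l *\<^sub>R ?v)"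
    proof (intro exI)
      have "?v \<bullet> ?v \<noteq> 0" using vel_nz[OF s] by simp
      then have "(?a - ((?a \<bullet> ?v) / (?v \<bullet> ?v)) *\<^sub>R ?v) \<bullet> ?v = 0" by (simp add: inner_diff_left)
      moreover have "(?a - ((?a \<bullet> ?v) / (?v \<bullet> ?v)) *\<^sub>R ?v) \<bullet> pdy S ?w = 0"
        unfolding pds(2)[OF wd] using acc vel_real[OF s] real_values(4,5)[OF rd[OF s]]
        by (cases ?a) (simp add: inner_complex_def)
      ultimately show "normal_vector S ?w (?a - ((?a \<bullet> ?v) / (?v \<bullet> ?v)) *\<^sub>R ?v)" by (simp add: normal_vector_def)
    qed
  qed
  moreover have "curvature_line_on unit_disk S {-1<..<1} complex_of_real"
    unfolding curvature_line_on_def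
  proof (intro exI[of _ U] exI[of _ N] conjI ballI open_U C1_N norm_N)
    show "complex_of_real ` {-1<..<1} \<subseteq> U" using rd diameter_U by blast
    show "U \<subseteq> unit_disk" by (auto simp: U_def)
    show "immersed_at S w" if "w \<in> U" for w by (rule imm[OF that])
    show "normal_vector S w (N w)" if w: "w \<in> U" for w
    proof -
      have wd: "w \<in> unit_disk" using w by (simp add: U_def)
      define x y i where "x = Re (G w)" and "y = Im (G w)" and "i = inverse (1 + x\<^sup>2 + y\<^sup>2)"
      have i: "i * (1 + x\<^sup>2 + y\<^sup>2) = 1" using denominator_pos[of x y] by (simp add: i_def)
      have Nw: "N w = (Complex (- 2 * i * y) (2 * i * x), 1 - 2 * i)"
        unfolding N_def x_def[symmetric] y_def[symmetric] i_def[symmetric] by simp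
      have i': "1 - 2 * i = i * (x\<^sup>2 + y\<^sup>2 - 1)" using i by (simp add: algebra_simps)
      have z: "- 2 * y * Re (deriv K1 w) + 2 * x * Re (deriv K2 w) - (x\<^sup>2 + y\<^sup>2 - 1) * Im (deriv K3 w) = 0"
        "- 2 * y * Im (deriv K1 w) + 2 * x * Im (deriv K2 w) + (x\<^sup>2 + y\<^sup>2 - 1) * Re (deriv K3 w) = 0"
        using arg_cong[OF N_isotropic[OF w], of Re] arg_cong[OF N_isotropic[OF w], of Im]
        unfolding x_def y_def by simp_all
      have "N w \<bullet> pdx S w = - i * (- 2 * y * Re (deriv K1 w) + 2 * x * Re (deriv K2 w) - (x\<^sup>2 + y\<^sup>2 - 1) * Im (deriv K3 w))"
        unfolding Nw pds(1)[OF wd] i' by (simp add: inner_complex_def algebra_simps)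
      moreover have "N w \<bullet> pdy S w = i * (- 2 * y * Im (deriv K1 w) + 2 * x * Im (deriv K2 w) + (x\<^sup>2 + y\<^sup>2 - 1) * Re (deriv K3 w))"
        unfolding Nw pds(2)[OF wd] i' by (simp add: inner_complex_def algebra_simps)
      ultimately show ?thesis unfolding normal_vector_def z by simp
    qed
    fix s :: real assume s: "s \<in> {-1<..<1}"
    let ?w = "complex_of_real s"
    note wr = rd[OF s] and wd = diameter_disk[OF rd[OF s]]
    have wU: "?w \<in> U" using wr diameter_U by blast
    have Nreal: "N (of_real u) = (\<i> * G (of_real u), 0)" if u: "u \<in> {-1<..<1}" for u
    proof -
      note r = real_values[OF rd[OF u]] and rel = real_relation[OF rd[OF u]]
      define C where "C = Re (deriv K3 (of_real u))"
      have c: "deriv K3 (of_real u) = of_real C" using r by (simp add: complex_eq_iff C_def)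
      have g: "Re (G (of_real u)) = Re (deriv K1 (of_real u)) / C" "Im (G (of_real u)) = Re (deriv K2 (of_real u)) / C"
        unfolding G_def c using r by (simp_all add: Re_divide_of_real Im_divide_of_real)
      have "(Re (G (of_real u)))\<^sup>2 + (Im (G (of_real u)))\<^sup>2 = 1"
        unfolding g using rel unfolding C_def[symmetric] by (simp add: power_divide flip: add_divide_distrib)
      then have two: "1 + (Re (G (of_real u)))\<^sup>2 + (Im (G (of_real u)))\<^sup>2 = 2" by simp
      show ?thesis unfolding N_def two by (simp add: complex_eq_iff)
    qed
    define a b c a' b' c' where "a = Re (deriv K1 ?w)" and "b = Re (deriv K2 ?w)" and "c = Re (deriv K3 ?w)"
      and "a' = Re (deriv (deriv K1) ?w)" and "b' = Re (deriv (deriv K2) ?w)" and "c' = Re (deriv (deriv K3) ?w)"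
    have cs: "deriv K1 ?w = of_real a" "deriv K2 ?w = of_real b" "deriv K3 ?w = of_real c"
      "deriv (deriv K1) ?w = of_real a'" "deriv (deriv K2) ?w = of_real b'" "deriv (deriv K3) ?w = of_real c'"
      using real_values[OF wr] by (simp_all add: complex_eq_iff a_def b_def c_def a'_def b'_def c'_def)
    have c0: "c \<noteq> 0" and abc: "a\<^sup>2 + b\<^sup>2 = c\<^sup>2" using real_relation[OF wr] by (auto simp: a_def b_def c_def)
    note d2 = holomorphic_derivI[OF hol_deriv(1) open_ball wd] holomorphic_derivI[OF hol_deriv(2) open_ball wd]
      holomorphic_derivI[OF hol_deriv(3) open_ball wd]
    have abc': "a * a' + b * b' = c * c'"
    proof -
      have "((\<lambda>w. (deriv K1 w)\<^sup>2 + (deriv K2 w)\<^sup>2) has_field_derivative 2 * of_real a * of_real a' + 2 * of_real b * of_real b') (at ?w)"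
        using d2(1,2) unfolding cs by (auto intro!: derivative_eq_intros simp: cs)
      then have "((\<lambda>w. (deriv K3 w)\<^sup>2) has_field_derivative 2 * of_real a * of_real a' + 2 * of_real b * of_real b') (at ?w)"
        by (rule has_field_derivative_transform_within_open[OF _ open_ball wd]) (simp add: conf)
      moreover have "((\<lambda>w. (deriv K3 w)\<^sup>2) has_field_derivative 2 * of_real c * of_real c') (at ?w)"
        using d2(3) unfolding cs by (auto intro!: derivative_eq_intros simp: cs)
      ultimately have "2 * of_real a * of_real a' + 2 * of_real b * of_real b' = (2 * of_real c * of_real c' :: complex)"
        by (rule DERIV_unique)
      then have "complex_of_real (2 * a * a' + 2 * b * b') = of_real (2 * c * c')" by simp
      then have "2 * a * a' + 2 * b * b' = 2 * c * c'" by (simp only: of_real_eq_iff)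
      then show ?thesis by simp
    qed
    have "(G has_field_derivative ((of_real a' + \<i> * of_real b') * of_real c - (of_real a + \<i> * of_real b) * of_real c') / (of_real c * of_real c)) (at ?w)"
    proof -
      have "deriv K3 ?w \<noteq> 0" using c0 cs by simp
      from DERIV_divide[OF DERIV_add[OF d2(1) DERIV_cmult[OF d2(2), of \<i>]] d2(3) this]
      show ?thesis unfolding cs G_def[abs_def] .
    qed
    \<comment> \<open>On the diameter \<open>G\<close> is the unit vector
      \<open>(a + \<i> * b) / c\<close>, which turns at the rate
      \<open>(a * b' - a' * b) / c\<^sup>2\<close>; dividing once more by \<open>c\<close> expresses
      its derivative through \<open>a + \<i> * b\<close>. Multiplication by \<open>\<i>\<close>
      makes this \<open>k\<close> times the velocity, whose horizontal part is
      \<open>- (a + \<i> * b)\<close>.\<close>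
    moreover define k where "k = (a * b' - a' * b) / c ^ 3"
    moreover have "((of_real a' + \<i> * of_real b') * of_real c - (of_real a + \<i> * of_real b) * of_real c') / (of_real c * of_real c)
       = \<i> * of_real k * (of_real a + \<i> * of_real b)"
    proof -
      have r1: "(a' * c - a * c') * c = - (a * b' - a' * b) * b"
      proof -
        have "(a' * c - a * c') * c = a' * c\<^sup>2 - a * (c * c')" by (simp add: power2_eq_square algebra_simps)
        also have "\<dots> = - (a * b' - a' * b) * b" unfolding abc[symmetric] abc'[symmetric] by (simp add: power2_eq_square algebra_simps)
        finally show ?thesis .
      qed
      have r2: "(b' * c - b * c') * c = (a * b' - a' * b) * a"
      proof -
        have "(b' * c - b * c') * c = b' * c\<^sup>2 - b * (c * c')" by (simp add: power2_eq_square algebra_simps)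
        also have "\<dots> = (a * b' - a' * b) * a" unfolding abc[symmetric] abc'[symmetric] by (simp add: power2_eq_square algebra_simps)
        finally show ?thesis .
      qed
      have e: "x / (c * c) = x * c / c ^ 3" for x using c0 by (simp add: power3_eq_cube)
      have q1: "(a' * c - a * c') / (c * c) = - k * b" unfolding e r1 k_def by (simp only: minus_divide_left mult_minus_left times_divide_eq_left)
      have q2: "(b' * c - b * c') / (c * c) = k * a" unfolding e r2 by (simp add: k_def)
      have "((of_real a' + \<i> * of_real b') * of_real c - (of_real a + \<i> * of_real b) * of_real c') / (of_real c * of_real c)
        = of_real ((a' * c - a * c') / (c * c)) + \<i> * of_real ((b' * c - b * c') / (c * c))"
        by (simp add: algebra_simps diff_divide_distrib add_divide_distrib)
      also have "\<dots> = \<i> * of_real k * (of_real a + \<i> * of_real b)" unfolding q1 q2 by (simp add: complex_eq_iff)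
      finally show ?thesis .
    qed
    ultimately have dG: "(G has_field_derivative \<i> * of_real k * (of_real a + \<i> * of_real b)) (at ?w)" by simp
    have "((\<lambda>u. G (of_real u)) has_vector_derivative \<i> * of_real k * (of_real a + \<i> * of_real b)) (at s)"
      using has_vector_derivative_real_field[OF dG] by (simp add: o_def)
    then have "((\<lambda>u. (\<i> * G (of_real u), 0::real)) has_vector_derivative (\<i> * (\<i> * of_real k * (of_real a + \<i> * of_real b)), 0)) (at s)"
      by (intro has_vector_derivative_Pair has_vector_derivative_mult_right has_vector_derivative_const)
    also have "(\<i> * (\<i> * of_real k * (of_real a + \<i> * of_real b)), 0::real) = k *\<^sub>R pdx S ?w"
      unfolding vel_real[OF s] by (simp add: complex_eq_iff a_def b_def)
    finally have "((\<lambda>u. (\<i> * G (of_real u), 0::real)) has_vector_derivative k *\<^sub>R pdx S ?w) (at s)" .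
    then have "(N \<circ> complex_of_real has_vector_derivative k *\<^sub>R pdx S ?w) (at s)"
      by (rule has_vector_derivative_transform_within_open[OF _ open_greaterThanLessThan s]) (simp add: Nreal)
    then show "\<exists>v k. (S \<circ> complex_of_real has_vector_derivative v) (at s) \<and> v \<noteq> 0 \<and>
        (N \<circ> complex_of_real has_vector_derivative (k::real) *\<^sub>R v) (at s)"
      using vel[OF s] vel_nz[OF s] by blast
  qed
  ultimately show ?thesis unfolding horizontal_geodesic_curvature_line_def using h rd by blast
qed

end

section \<open>The extended surfaces at a corner\<close>

lemma infinite_boundary_signs:
  assumes "tends_to_plus_infinity_on \<Omega> \<phi> I1 \<or> tends_to_minus_infinity_on \<Omega> \<phi> I1"
    and "tends_to_plus_infinity_on \<Omega> \<phi> I2 \<or> tends_to_minus_infinity_on \<Omega> \<phi> I2"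
    and "b \<longrightarrow>
           tends_to_plus_infinity_on \<Omega> \<phi> I1 \<and> tends_to_minus_infinity_on \<Omega> \<phi> I2 \<or>
           tends_to_minus_infinity_on \<Omega> \<phi> I1 \<and> tends_to_plus_infinity_on \<Omega> \<phi> I2"
  obtains \<sigma>1 \<sigma>2 :: real where "\<sigma>1 \<in> {1, -1}" "\<sigma>2 \<in> {1, -1}" "b \<Longrightarrow> \<sigma>1 \<noteq> \<sigma>2"
    "\<And>z. z \<in> I1 \<Longrightarrow> filterlim (\<lambda>z. \<sigma>1 * \<phi> z) at_top (at z within \<Omega>)"
    "\<And>z. z \<in> I2 \<Longrightarrow> filterlim (\<lambda>z. \<sigma>2 * \<phi> z) at_top (at z within \<Omega>)"
proof -
  have p: "\<forall>z\<in>I. filterlim (\<lambda>z. 1 * \<phi> z) at_top (at z within \<Omega>)" if "tends_to_plus_infinity_on \<Omega> \<phi> I" for I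
    using that by (simp add: tends_to_plus_infinity_on_def)
  have m: "\<forall>z\<in>I. filterlim (\<lambda>z. -1 * \<phi> z) at_top (at z within \<Omega>)" if "tends_to_minus_infinity_on \<Omega> \<phi> I" for I
    using that by (simp add: tends_to_minus_infinity_on_def filterlim_uminus_at_bot)
  show thesis
  proof (cases b)
    case True
    then show thesis using assms(3) p m that[of 1 "-1"] that[of "-1" 1] by (metis insertCI one_neq_neg_one)
  next
    case False
    have "\<exists>\<sigma>\<in>{1, -1}. \<forall>z\<in>I. filterlim (\<lambda>z. \<sigma> * \<phi> z) at_top (at z within \<Omega>)"
      if "tends_to_plus_infinity_on \<Omega> \<phi> I \<or> tends_to_minus_infinity_on \<Omega> \<phi> I" for I
      using that p[of I] m[of I] by blast
    from this[OF assms(1)] this[OF assms(2)] False show thesis using that by blast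
  qed
qed

text \<open>Keeps \<open>T'\<close> from vanishing identically, so that the arc has a part on which
  it has no zeros.\<close>

lemma not_constant_of_infinite_boundary:
  assumes \<Omega>: "open \<Omega>" and p: "p \<in> frontier \<Omega>" and lim: "filterlim (\<lambda>z. \<sigma> * \<phi> z) at_top (at p within \<Omega>)"
    and bij: "bij_betw f unit_disk \<Omega>"
  shows "\<not> (\<lambda>w. Complex (\<phi> (f w)) (\<psi> (f w))) constant_on unit_disk"
proof
  assume "(\<lambda>w. Complex (\<phi> (f w)) (\<psi> (f w))) constant_on unit_disk"
  then obtain c where c: "\<And>w. w \<in> unit_disk \<Longrightarrow> Complex (\<phi> (f w)) (\<psi> (f w)) = c" by (auto simp: constant_on_def)
  have const: "\<phi> z = Re c" if z: "z \<in> \<Omega>" for z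
  proof -
    obtain w where "w \<in> unit_disk" "z = f w" using bij z by (auto simp: bij_betw_def)
    then show ?thesis using c[of w] by auto
  qed
  have "p \<notin> \<Omega>" "p \<in> closure \<Omega>" using p \<Omega> by (auto simp: frontier_def interior_open)
  then have "at p within \<Omega> \<noteq> bot" by (simp add: closure_def trivial_limit_within)
  moreover have "eventually (\<lambda>z. \<sigma> * Re c + 1 \<le> \<sigma> * \<phi> z) (at p within \<Omega>)"
    using lim unfolding filterlim_at_top by blast
  moreover have "eventually (\<lambda>z. z \<in> \<Omega>) (at p within \<Omega>)" by (simp add: eventually_at_filter)
  ultimately have "\<exists>z. \<sigma> * Re c + 1 \<le> \<sigma> * \<phi> z \<and> z \<in> \<Omega>"
    using eventually_happens eventually_conj by blast
  then show False using const by auto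
qed

theorem corollary1p3:
  fixes \<Omega> I1 I2 :: "complex set" and \<phi> \<psi> :: "complex \<Rightarrow> real" and f :: "complex \<Rightarrow> complex"
    and z0 z1 z2 :: complex and \<alpha> :: real
  assumes "jordan_domain \<Omega>"
    and "minimal_surface_solution \<Omega> \<phi>"
    and "maximal_surface_solution \<Omega> \<psi>" and "dual_solution \<Omega> \<phi> \<psi>"
    and "corresponding_harmonic_map \<Omega> \<phi> f"
    and "z1 \<noteq> z0" and "I1 = open_segment z0 z1" and "I1 \<subseteq> frontier \<Omega>"
    and "z2 \<noteq> z0" and "I2 = open_segment z0 z2" and "I2 \<subseteq> frontier \<Omega>"
    and "interior_angle \<Omega> z0 z1 z2 \<alpha>"
    and "tends_to_plus_infinity_on \<Omega> \<phi> I1 \<or> tends_to_minus_infinity_on \<Omega> \<phi> I1"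
    and "tends_to_plus_infinity_on \<Omega> \<phi> I2 \<or> tends_to_minus_infinity_on \<Omega> \<phi> I2"
    and "\<alpha> = pi \<Longrightarrow>
           tends_to_plus_infinity_on \<Omega> \<phi> I1 \<and> tends_to_minus_infinity_on \<Omega> \<phi> I2 \<or>
           tends_to_minus_infinity_on \<Omega> \<phi> I1 \<and> tends_to_plus_infinity_on \<Omega> \<phi> I2"
  shows "\<exists>L F t t'. extended_surfaces \<phi> \<psi> f L F t t' \<and>
     \<comment> \<open>\<open>X_min = (F, t)\<close>\<close>
     vertical_segment_over z0 L \<and>
     symmetric_by (vertical_half_turn z0) (\<lambda>w. (F w, t w)) \<and>
     \<comment> \<open>\<open>X_max = (F, t')\<close>\<close>
     (\<exists>q. (\<forall>p\<in>real_diameter. shrinking_singularity unit_disk (\<lambda>w. (F w, t' w)) p q) \<and>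
          symmetric_by (point_reflection q) (\<lambda>w. (F w, t' w))) \<and>
     (\<forall>F'. harmonic_conjugate_c unit_disk F F' \<longrightarrow>
        \<comment> \<open>\<open>X_min\<^sup>* = (F', t')\<close>\<close>
        generalized_minimal_surface unit_disk (\<lambda>w. (F' w, t' w)) \<and>
        (\<exists>h. horizontal_geodesic_curvature_line unit_disk (\<lambda>w. (F' w, t' w))
               {-1<..<1} complex_of_real h \<and>
             symmetric_by (horizontal_reflection h) (\<lambda>w. (F' w, t' w))) \<and>
        \<comment> \<open>\<open>X_max\<^sup>* = (F', - t)\<close>\<close>
        generalized_maximal_surface unit_disk (\<lambda>w. (F' w, - t w)) \<and>
        folding_singularity unit_disk (\<lambda>w. (F' w, - t w)) 0
          ((\<lambda>w. (F' w, - t w)) ` real_diameter) \<and>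
        (\<forall>p\<in>real_diameter. \<exists>\<Gamma>. folding_singularity unit_disk (\<lambda>w. (F' w, - t w)) p \<Gamma>) \<and>
        null_curve {-1<..<1} (\<lambda>u. (F' (of_real u), - t (of_real u))) \<and>
        symmetric_by (\<lambda>x. x) (\<lambda>w. (F' w, - t w)))"
proof -
  let ?T = "\<lambda>w. Complex (\<phi> (f w)) (\<psi> (f w))"
  have bij: "bij_betw f unit_disk \<Omega>" using assms(5) by (simp add: corresponding_harmonic_map_def)
  have op: "open \<Omega>" using assms(1) by (simp add: jordan_domain_def)
  obtain X1 X2 where X: "X1 holomorphic_on unit_disk" "X2 holomorphic_on unit_disk" "?T holomorphic_on unit_disk"
    "\<And>w. w \<in> unit_disk \<Longrightarrow> Im (X1 w) = Re (f w)" "\<And>w. w \<in> unit_disk \<Longrightarrow> Im (X2 w) = Im (f w)"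
    "\<And>w. w \<in> unit_disk \<Longrightarrow> (deriv X1 w)\<^sup>2 + (deriv X2 w)\<^sup>2 = (deriv ?T w)\<^sup>2"
    "\<And>w. w \<in> unit_disk \<Longrightarrow> 0 < Im (deriv X1 w * cnj (deriv X2 w))"
    by (rule Weierstrass_data[OF assms(2,4,5)]) (rule that; blast)
  have signs: "\<alpha> = pi \<longrightarrow>
           tends_to_plus_infinity_on \<Omega> \<phi> I1 \<and> tends_to_minus_infinity_on \<Omega> \<phi> I2 \<or>
           tends_to_minus_infinity_on \<Omega> \<phi> I1 \<and> tends_to_plus_infinity_on \<Omega> \<phi> I2"
    using assms(15) by blast
  show ?thesis
  proof (rule infinite_boundary_signs[OF assms(13,14) signs])
    fix \<sigma>1 \<sigma>2 :: real assume \<sigma>: "\<sigma>1 \<in> {1, -1}" "\<sigma>2 \<in> {1, -1}" "\<alpha> = pi \<Longrightarrow> \<sigma>1 \<noteq> \<sigma>2"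
      and lim1: "\<And>z. z \<in> I1 \<Longrightarrow> filterlim (\<lambda>z. \<sigma>1 * \<phi> z) at_top (at z within \<Omega>)"
      and lim2: "\<And>z. z \<in> I2 \<Longrightarrow> filterlim (\<lambda>z. \<sigma>2 * \<phi> z) at_top (at z within \<Omega>)"
    show ?thesis
    proof (rule corner_boundary_arc[OF X bij assms(6,9,12) lim1[unfolded assms(7)] lim2[unfolded assms(10)] \<sigma>])
      fix a0 \<delta> assume arc: "cmod a0 = 1" "0 < \<delta>"
        "\<And>a. cmod a = 1 \<Longrightarrow> dist a a0 < \<delta> \<Longrightarrow> (f \<longlongrightarrow> z0) (at a within unit_disk)"
      have "midpoint z0 z1 \<in> I1" using assms(6,7) midpoint_in_open_segment by metis
      then have nc: "\<not> ?T constant_on unit_disk"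
        using not_constant_of_infinite_boundary[OF op _ lim1 bij] assms(8) by blast
      show ?thesis
      proof (rule extension_across_arc[OF X nc arc])
        fix \<kappa> K1 K2 K3 q assume \<kappa>: "\<kappa> holomorphic_on upper_half_disk" "bij_betw \<kappa> upper_half_disk unit_disk"
          and holK: "K1 holomorphic_on unit_disk" "K2 holomorphic_on unit_disk" "K3 holomorphic_on unit_disk"
          and fK: "\<And>w. w \<in> upper_half_disk \<Longrightarrow> f (\<kappa> w) = z0 + Complex (Im (K1 w)) (Im (K2 w))"
          and TK: "\<And>w. w \<in> upper_half_disk \<Longrightarrow> ?T (\<kappa> w) = K3 w + \<i> * of_real q"
          and K: "\<And>w. w \<in> unit_disk \<Longrightarrow> K1 (cnj w) = cnj (K1 w)" "\<And>w. w \<in> unit_disk \<Longrightarrow> K2 (cnj w) = cnj (K2 w)"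
          "\<And>w. w \<in> unit_disk \<Longrightarrow> K3 (cnj w) = cnj (K3 w)"
          "\<And>w. w \<in> unit_disk \<Longrightarrow> (deriv K1 w)\<^sup>2 + (deriv K2 w)\<^sup>2 = (deriv K3 w)\<^sup>2"
          "\<And>w. w \<in> upper_half_disk \<Longrightarrow> 0 < Im (deriv K1 w * cnj (deriv K2 w))"
          "\<And>w. w \<in> real_diameter \<Longrightarrow> deriv K3 w \<noteq> 0" "bounded (K3 ` real_diameter)"
        interpret reflected_surface K1 K2 K3 by unfold_locales (rule holK K | assumption)+
        define F where "F w = z0 + Complex (Im (K1 w)) (Im (K2 w))" for w
        define t where "t w = Re (K3 w)" for w
        define t' where "t' w = Im (K3 w) + q" for w
        define L where "L = (\<lambda>w. (F w, t w)) ` real_diameter"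
        have Smin: "real_part_surface (\<lambda>w. (F w, t w)) (\<lambda>w. of_real (Re z0) - \<i> * K1 w) (\<lambda>w. of_real (Im z0) - \<i> * K2 w) (\<lambda>w. 0 - (-1) * K3 w)"
          by (rule affine_surface) (simp add: F_def t_def complex_eq_iff)
        have Smax: "real_part_surface (\<lambda>w. (F w, t' w)) (\<lambda>w. of_real (Re z0) - \<i> * K1 w) (\<lambda>w. of_real (Im z0) - \<i> * K2 w) (\<lambda>w. of_real q - \<i> * K3 w)"
          by (rule affine_surface) (simp add: F_def t'_def complex_eq_iff)
        have onL: "F w = z0" "t' w = q" if "w \<in> real_diameter" for w
          using real_values(1-3)[OF that] by (simp_all add: F_def t'_def complex_eq_iff)
        have maxmin: "generalized_minimal_surface unit_disk (\<lambda>w. (F w, t w))" "generalized_maximal_surface unit_disk (\<lambda>w. (F w, t' w))"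
          by (rule affine_minimal[OF Smin]; simp) (rule affine_maximal[OF Smax], simp)
        have ext: "extended_surfaces \<phi> \<psi> f L F t t'"
          unfolding extended_surfaces_def
        proof (intro conjI exI[of _ \<kappa>] ballI \<kappa> maxmin)
          fix w assume w: "w \<in> upper_half_disk"
          show "F w = f (\<kappa> w)" by (simp add: fK[OF w] F_def)
          show "t w = \<phi> (f (\<kappa> w))" using arg_cong[OF TK[OF w], of Re] by (simp add: t_def)
          show "t' w = \<psi> (f (\<kappa> w))" using arg_cong[OF TK[OF w], of Im] by (simp add: t'_def)
        next
          have "(\<lambda>w. K3 w + \<i> * of_real q) holomorphic_on unit_disk" by (intro holomorphic_intros holK)
          then show "harmonic_conjugate unit_disk t t'"
            unfolding harmonic_conjugate_def by (rule holomorphic_transform) (simp add: t_def t'_def complex_eq_iff)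
          show "(\<lambda>w. (F w, t w)) ` real_diameter = L" by (simp add: L_def)
        qed
        have conj: "generalized_minimal_surface unit_disk (\<lambda>w. (F' w, t' w)) \<and>
              (\<exists>h. horizontal_geodesic_curvature_line unit_disk (\<lambda>w. (F' w, t' w))
                     {-1<..<1} complex_of_real h \<and>
                   symmetric_by (horizontal_reflection h) (\<lambda>w. (F' w, t' w))) \<and>
              generalized_maximal_surface unit_disk (\<lambda>w. (F' w, - t w)) \<and>
              folding_singularity unit_disk (\<lambda>w. (F' w, - t w)) 0
                ((\<lambda>w. (F' w, - t w)) ` real_diameter) \<and>
              (\<forall>p\<in>real_diameter. \<exists>\<Gamma>. folding_singularity unit_disk (\<lambda>w. (F' w, - t w)) p \<Gamma>) \<and>
              null_curve {-1<..<1} (\<lambda>u. (F' (of_real u), - t (of_real u))) \<and>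
              symmetric_by (\<lambda>x. x) (\<lambda>w. (F' w, - t w))"
          if F': "harmonic_conjugate_c unit_disk F F'" for F'
        proof -
          \<comment> \<open>Any admissible conjugate is determined up to translation, so the claims
            for an arbitrary \<open>F'\<close> reduce to one explicit surface.\<close>
          obtain c1 where c1: "\<And>w. w \<in> unit_disk \<Longrightarrow> Re (F' w) = c1 - Re (K1 w)"
            using harmonic_conjugate_unique[OF _ holK(1), of "\<lambda>w. Re (F w)" "\<lambda>w. Re (F' w)" "Re z0"] F'
            by (auto simp: harmonic_conjugate_c_def F_def)
          obtain c2 where c2: "\<And>w. w \<in> unit_disk \<Longrightarrow> Im (F' w) = c2 - Re (K2 w)"
            using harmonic_conjugate_unique[OF _ holK(2), of "\<lambda>w. Im (F w)" "\<lambda>w. Im (F' w)" "Im z0"] F'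
            by (auto simp: harmonic_conjugate_c_def F_def)
          have F'eq: "F' w = Complex (c1 - Re (K1 w)) (c2 - Re (K2 w))" if "w \<in> unit_disk" for w
            using c1[OF that] c2[OF that] by (simp add: complex_eq_iff)
          have Smin': "real_part_surface (\<lambda>w. (F' w, t' w)) (\<lambda>w. of_real c1 - 1 * K1 w) (\<lambda>w. of_real c2 - 1 * K2 w) (\<lambda>w. of_real q - \<i> * K3 w)"
            by (rule affine_surface) (simp add: F'eq t'_def)
          have Smax': "real_part_surface (\<lambda>w. (F' w, - t w)) (\<lambda>w. of_real c1 - 1 * K1 w) (\<lambda>w. of_real c2 - 1 * K2 w) (\<lambda>w. 0 - 1 * K3 w)"
            by (rule affine_surface) (simp add: F'eq t_def)
          have F'sym: "F' (cnj w) = F' w" if "w \<in> unit_disk" for w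
            using that K(1,2)[OF that] F'eq[OF that] F'eq[OF cnj_disk[OF that]] by simp
          show ?thesis
          proof (intro conjI ballI exI[of _ q])
            show "generalized_minimal_surface unit_disk (\<lambda>w. (F' w, t' w))" by (rule affine_minimal[OF Smin']) simp_all
            show "horizontal_geodesic_curvature_line unit_disk (\<lambda>w. (F' w, t' w)) {-1<..<1} complex_of_real q"
              by (rule conjugate_geodesic_curvature_line[OF Smin']) (simp add: onL)
            show "symmetric_by (horizontal_reflection q) (\<lambda>w. (F' w, t' w))"
              unfolding symmetric_by_def horizontal_reflection_def using F'sym K(3) by (simp add: t'_def)
            show "generalized_maximal_surface unit_disk (\<lambda>w. (F' w, - t w))" by (rule affine_maximal[OF Smax']) simp
            show "\<exists>\<Gamma>. folding_singularity unit_disk (\<lambda>w. (F' w, - t w)) p \<Gamma>" if "p \<in> real_diameter" for p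
              using folding[OF Smax' that] by blast
            have "{(F' (0 + of_real u), - t (0 + of_real u)) | u::real. \<bar>u\<bar> < 1 - cmod 0} = (\<lambda>w. (F' w, - t w)) ` real_diameter"
              by (auto simp: diameter)
            then show "folding_singularity unit_disk (\<lambda>w. (F' w, - t w)) 0 ((\<lambda>w. (F' w, - t w)) ` real_diameter)"
              using folding[OF Smax' zero_diameter] by simp
            show "null_curve {-1<..<1} (\<lambda>u. (F' (of_real u), - t (of_real u)))" by (rule null[OF Smax'])
            show "symmetric_by (\<lambda>x. x) (\<lambda>w. (F' w, - t w))"
              unfolding symmetric_by_def using F'sym K(3) by (simp add: t_def)
          qed
        qed
        show ?thesis
        proof (rule exI[of _ L], rule exI[of _ F], rule exI[of _ t], rule exI[of _ t'],
            intro exI[of _ "(z0, q)"] conjI allI impI ballI ext)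
          show "vertical_segment_over z0 L" using vertical_segment by (simp add: L_def F_def t_def)
          show "symmetric_by (vertical_half_turn z0) (\<lambda>w. (F w, t w))"
            unfolding symmetric_by_def vertical_half_turn_def using K(1-3) by (simp add: F_def t_def complex_eq_iff)
          show "shrinking_singularity unit_disk (\<lambda>w. (F w, t' w)) p (z0, q)" if "p \<in> real_diameter" for p
            by (rule shrinking[OF Smax _ that]) (simp add: onL)
          show "symmetric_by (point_reflection (z0, q)) (\<lambda>w. (F w, t' w))"
            unfolding symmetric_by_def point_reflection_def using K(1-3)
            by (simp add: F_def t'_def complex_eq_iff scaleR_2)
        qed (use conj in blast)+
      qed
    qed
  qed
qed

end
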